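(* Let $n\ge1$, let $g:\mathbb{R}^n\to(0,\infty)$ be a positive smooth function, and let $\lambda:\mathbb{R}\to(0,\infty)$ be a function for which there is a constant $C_0>0$ such that $C_0^{-1}\le\lambda(r)/\lambda(r')\le C_0$ for all $r,r'\in\mathbb{R}$ with $|r-r'|\le1$. Then there exist constants $C>0$ and $M\ge0$ such that, for all $a\in S^0_0(\lambda)$, all $u\in C_c^\infty(\mathbb{R}^n)$ and all $t\in[0,1]$, \[ \|\mathrm{Op}^{g,t}(a)u\|_{L^2(g^{1/2}dq)}\le C\,|a|_{\lambda:M,0,0}\,\|u\|_{L^2(g^{1/2}dq)} . \]
   Context: Notation: $q=(r,\theta)\in\mathbb{R}\times\mathbb{R}^{n-1}=\mathbb{R}^n$, dual variable $p=(\rho,\eta)\in\mathbb{R}\times\mathbb{R}^{n-1}$; multiindices are split as $A=(\alpha_0,\alpha)$, $B=(\beta_0,\beta)\in\mathbb{Z}_{\ge0}\times\mathbb{Z}_{\ge0}^{n-1}$ with $|A|=\alpha_0+|\alpha|$; $\langle\rho\oplus\eta\rangle:=(1+\rho^2+|\eta|^2)^{1/2}$. Symbol class: for $m\in\mathbb{R}$, $\sigma\in[0,1]$, $a\in C^\infty(\mathbb{R}^{2n})$ belongs to $S^m_\sigma(\lambda)$ if for all $M\ge0$ there is $C_M>0$ with $|(\lambda(r)^{-1}\partial_\theta)^\alpha(\lambda(r)\partial_\eta)^\beta\partial_r^{\alpha_0}\partial_\rho^{\beta_0}a(q,p)|\le C_M\langle\rho\oplus\lambda(r)^{-1}\eta\rangle^{m-\sigma|B|}$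 for all $(q,p)\in\mathbb{R}^{2n}$ and $|A|+|B|\le M$. Here the powers of $\lambda(r)$ stand to the left of all derivatives (so $\lambda$ is never differentiated). Seminorms: $|a|_{\lambda:M,m,\sigma}:=\sum_{|A|+|B|\le M}\sup_{(q,p)}\langle\rho\oplus\lambda(r)^{-1}\eta\rangle^{-m+\sigma|B|}|(\lambda(r)^{-1}\partial_\theta)^\alpha(\lambda(r)\partial_\eta)^\beta\partial_r^{\alpha_0}\partial_\rho^{\beta_0}a(q,p)|$. Quantization: for $t\in[0,1]$, $\mathrm{Op}^{g,t}(a)u(q):=(2\pi)^{-n}g(q)^{-1/4}\int_{\mathbb{R}^n}dp\int_{\mathbb{R}^n}dq'\,a(tq+(1-t)q',p)e^{ip\cdot(q-q')}u(q')g(q')^{1/4}$, an iterated integral (first in $q'$, then in $p$). $L^2(g^{1/2}dq)$ is the $L^2$ space on $\mathbb{R}^n$ with measure $g(q)^{1/2}dq$. *)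

theory Defs
  imports "HOL-Analysis.Analysis"
begin

text \<open>
  Points of \<open>\<real>\<^sup>n\<close> are vectors \<open>q :: real^'n\<close> with \<open>n = CARD('n)\<close>.  The splitting
  \<open>q = (r, \<theta>)\<close> of \<open>\<real>\<^sup>n = \<real> \<times> \<real>\<^bsup>n-1\<^esup>\<close> is encoded by a distinguished index \<open>k :: 'n\<close>:
  \<open>r = q $ k\<close>, and \<open>\<theta>\<close> consists of the components \<open>q $ i\<close> with \<open>i \<noteq> k\<close>; likewise
  \<open>p = (\<rho>, \<eta>)\<close>.  This includes \<open>n = 1\<close>, where there is no \<open>\<theta>\<close>.
  A multiindex is a function \<open>A :: 'n \<Rightarrow> nat\<close>, with \<open>\<alpha>\<^sub>0 = A k\<close> and \<open>\<alpha>\<close> the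
  remaining entries.
\<close>

subsection \<open>Smooth functions and iterated partial derivatives\<close>

primrec C_k :: "nat \<Rightarrow> ('a::euclidean_space \<Rightarrow> 'b::real_normed_vector) \<Rightarrow> bool" where
  "C_k 0 f \<longleftrightarrow> continuous_on UNIV f"
| "C_k (Suc j) f \<longleftrightarrow> f differentiable_on UNIV \<and>
     (\<forall>b\<in>Basis. C_k j (\<lambda>x. frechet_derivative f (at x) b))"

definition smooth :: "('a::euclidean_space \<Rightarrow> 'b::real_normed_vector) \<Rightarrow> bool" where
  "smooth f \<longleftrightarrow> (\<forall>j. C_k j f)"

definition smooth_compact_support :: "('a::euclidean_space \<Rightarrow> 'b::real_normed_vector) \<Rightarrow> bool" where
  "smooth_compact_support u \<longleftrightarrow> smooth u \<and> compact (closure {x. u x \<noteq> 0})"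

definition deriv_q :: "'n \<Rightarrow> ((real^'n) \<times> (real^'n) \<Rightarrow> complex) \<Rightarrow> (real^'n) \<times> (real^'n) \<Rightarrow> complex" where
  "deriv_q i f = (\<lambda>x. frechet_derivative f (at x) (axis i 1, 0))"

definition deriv_p :: "'n \<Rightarrow> ((real^'n) \<times> (real^'n) \<Rightarrow> complex) \<Rightarrow> (real^'n) \<times> (real^'n) \<Rightarrow> complex" where
  "deriv_p i f = (\<lambda>x. frechet_derivative f (at x) (0, axis i 1))"

text \<open>
  The index type carries no order, so an enumeration of it is chosen to fix the order in
  which the partial derivatives are applied; on smooth functions, the only ones on which
  \<open>mixed_deriv\<close> is used, they commute and the choice is irrelevant.
\<close>

definition index_list :: "'n::finite list" where
  "index_list = (SOME xs. distinct xs \<and> set xs = UNIV)"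

lemma index_list: "distinct (index_list :: 'n::finite list)" "set (index_list :: 'n list) = UNIV"
proof -
  have "\<exists>xs :: 'n list. distinct xs \<and> set xs = UNIV"
    using finite_distinct_list[of "UNIV :: 'n set"] by auto
  from someI_ex[OF this]
  show "distinct (index_list :: 'n list)" "set (index_list :: 'n list) = UNIV"
    unfolding index_list_def by auto
qed

definition mixed_deriv :: "('n::finite \<Rightarrow> nat) \<Rightarrow> ('n \<Rightarrow> nat) \<Rightarrow>
    ((real^'n) \<times> (real^'n) \<Rightarrow> complex) \<Rightarrow> (real^'n) \<times> (real^'n) \<Rightarrow> complex" where
  "mixed_deriv A B f =
     foldr (\<lambda>i. deriv_q i ^^ A i) index_list (foldr (\<lambda>i. deriv_p i ^^ B i) index_list f)"

subsection \<open>Symbol classes and seminorms\<close>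

definition mi_order :: "('n::finite \<Rightarrow> nat) \<Rightarrow> nat" where
  "mi_order A = (\<Sum>i\<in>UNIV. A i)"

definition mi_order_tail :: "'n::finite \<Rightarrow> ('n \<Rightarrow> nat) \<Rightarrow> nat" where
  "mi_order_tail k A = (\<Sum>i\<in>UNIV - {k}. A i)"

text \<open>\<open>jap k l p\<close> is \<open>\<langle>\<rho> \<oplus> l\<^sup>-\<^sup>1\<eta>\<rangle>\<close>.\<close>

definition jap :: "'n::finite \<Rightarrow> real \<Rightarrow> real^'n \<Rightarrow> real" where
  "jap k l p = sqrt (1 + (p $ k)\<^sup>2 + (\<Sum>i\<in>UNIV - {k}. (inverse l * p $ i)\<^sup>2))"

text \<open>
  \<open>(\<lambda>(r)\<^sup>-\<^sup>1\<partial>\<^sub>\<theta>)\<^sup>\<alpha> (\<lambda>(r)\<partial>\<^sub>\<eta>)\<^sup>\<beta> \<partial>\<^sub>r\<^sup>\<alpha>\<^sup>0 \<partial>\<^sub>\<rho>\<^sup>\<beta>\<^sup>0 a\<close>, the powers of \<open>\<lambda>(r)\<close> standing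
  to the left of all derivatives; thus only \<open>\<alpha>\<close> and \<open>\<beta>\<close>, not \<open>\<alpha>\<^sub>0\<close> and \<open>\<beta>\<^sub>0\<close>, contribute
  powers of \<open>\<lambda>(r)\<close>.
\<close>

definition weighted_deriv :: "'n::finite \<Rightarrow> (real \<Rightarrow> real) \<Rightarrow> ('n \<Rightarrow> nat) \<Rightarrow> ('n \<Rightarrow> nat) \<Rightarrow>
    ((real^'n) \<times> (real^'n) \<Rightarrow> complex) \<Rightarrow> (real^'n) \<times> (real^'n) \<Rightarrow> complex" where
  "weighted_deriv k lam A B a = (\<lambda>(q, p).
     (inverse (lam (q $ k)) ^ mi_order_tail k A * lam (q $ k) ^ mi_order_tail k B)
       *\<^sub>R mixed_deriv A B a (q, p))"

definition symbol_class :: "'n::finite \<Rightarrow> (real \<Rightarrow> real) \<Rightarrow> real \<Rightarrow> real \<Rightarrow>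
    ((real^'n) \<times> (real^'n) \<Rightarrow> complex) set" where
  "symbol_class k lam m \<sigma> = {a. smooth a \<and>
     (\<forall>M::nat. \<exists>C>0. \<forall>q p A B. mi_order A + mi_order B \<le> M \<longrightarrow>
        norm (weighted_deriv k lam A B a (q, p))
          \<le> C * jap k (lam (q $ k)) p powr (m - \<sigma> * real (mi_order B)))}"

lemma finite_mi_pairs:
  "finite {(A :: 'n::finite \<Rightarrow> nat, B :: 'n \<Rightarrow> nat). mi_order A + mi_order B \<le> M}"
proof (rule finite_subset)
  have le: "A i \<le> M" if "mi_order A \<le> M" for A :: "'n \<Rightarrow> nat" and i
    using that member_le_sum[of i UNIV A] by (simp add: mi_order_def)
  show "{(A :: 'n \<Rightarrow> nat, B :: 'n \<Rightarrow> nat). mi_order A + mi_order B \<le> M}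
      \<subseteq> (UNIV \<rightarrow>\<^sub>E {..M}) \<times> (UNIV \<rightarrow>\<^sub>E {..M})"
  proof clarsimp
    fix A B :: "'n \<Rightarrow> nat"
    assume "mi_order A + mi_order B \<le> M"
    then have "mi_order A \<le> M" "mi_order B \<le> M" by linarith+
    then show "A \<in> UNIV \<rightarrow>\<^sub>E {..M} \<and> B \<in> UNIV \<rightarrow>\<^sub>E {..M}"
      using le[of A] le[of B] by (simp add: PiE_UNIV_domain)
  qed
  show "finite (((UNIV :: 'n set) \<rightarrow>\<^sub>E {..M}) \<times> ((UNIV :: 'n set) \<rightarrow>\<^sub>E {..M}))"
    by (intro finite_cartesian_product finite_PiE) auto
qed

text \<open>
  The supremum is real-valued; it is taken over a bounded set whenever
  \<open>a \<in> symbol_class k lam m \<sigma>\<close>.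
\<close>

definition symbol_seminorm :: "'n::finite \<Rightarrow> (real \<Rightarrow> real) \<Rightarrow> nat \<Rightarrow> real \<Rightarrow> real \<Rightarrow>
    ((real^'n) \<times> (real^'n) \<Rightarrow> complex) \<Rightarrow> real" where
  "symbol_seminorm k lam M m \<sigma> a =
     (\<Sum>(A, B)\<in>{(A, B). mi_order A + mi_order B \<le> M}.
        SUP (q, p)\<in>UNIV. jap k (lam (q $ k)) p powr (- m + \<sigma> * real (mi_order B))
          * norm (weighted_deriv k lam A B a (q, p)))"

subsection \<open>Quantization and the weighted $L^2$ space\<close>

definition Op :: "(real^'n::finite \<Rightarrow> real) \<Rightarrow> real \<Rightarrow> ((real^'n) \<times> (real^'n) \<Rightarrow> complex) \<Rightarrow>
    (real^'n \<Rightarrow> complex) \<Rightarrow> real^'n \<Rightarrow> complex" where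
  "Op g t a u q =
     ((2 * pi) powr (- real CARD('n)) * g q powr (- 1/4)) *\<^sub>R
     (LINT p|lborel. LINT q'|lborel.
        a (t *\<^sub>R q + (1 - t) *\<^sub>R q', p) * exp (\<i> * complex_of_real (p \<bullet> (q - q')))
          * u q' * complex_of_real (g q' powr (1/4)))"

definition weighted_measure :: "(real^'n::finite \<Rightarrow> real) \<Rightarrow> (real^'n) measure" where
  "weighted_measure g = density lborel (\<lambda>q. ennreal (g q powr (1/2)))"

definition L2_space :: "'a measure \<Rightarrow> ('a \<Rightarrow> complex) set" where
  "L2_space \<mu> = {f \<in> borel_measurable \<mu>. integrable \<mu> (\<lambda>x. (norm (f x))\<^sup>2)}"

text \<open>
  The Bochner integral of a non-integrable function is 0, so bounds on \<open>L2_norm \<mu> f\<close>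
  are meaningful only together with \<open>f \<in> L2_space \<mu>\<close>.
\<close>

definition L2_norm :: "'a measure \<Rightarrow> ('a \<Rightarrow> complex) \<Rightarrow> real" where
  "L2_norm \<mu> f = sqrt (LINT x|\<mu>. (norm (f x))\<^sup>2)"

end

theory Submission
  imports Defs "HOL-Probability.Probability"
begin

text \<open>
  Conjugation with \<open>g\<^bsup>1/4\<^esup>\<close> reduces the estimate to \<open>L\<^sup>2(dq)\<close>.  After a regularisation of the
  \<open>p\<close>-integral, one bounds the form
  \<open>\<integral>\<integral>\<integral> b(x,y,p) e\<^bsup>ip(x-y)\<^esup> u(y) v(x) dy dx dp\<close> with \<open>b(x,y,p) = a(tx+(1-t)y,p)\<close>,
  uniformly in \<open>t\<close>.  If \<open>b\<close> depends on \<open>p\<close> only, the bound is Bessel's inequality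
  \<open>\<integral>|\<F>u|\<^sup>2 \<le> (2\<pi>)\<^sup>n \<integral>|u|\<^sup>2\<close> together with the inequality of the means.  For \<open>x\<close> and \<open>y\<close> in
  boxes whose sides are \<open>1\<close> in \<open>r\<close> and \<open>1/\<lambda>\<close> in \<open>\<theta>\<close>, the fundamental theorem of calculus
  in each coordinate of \<open>x\<close> and \<open>y\<close> reduces to that case.  Integration by parts in the component
  of \<open>p\<close> along which the boxes are farthest apart gives decay in their distance, and Schur's test
  sums over the boxes, first within a pair of strips \<open>r \<in> [i,i+1)\<close>, \<open>r' \<in> [j,j+1)\<close>, then over
  the pairs.
\<close>

subsection \<open>Fourier transforms of Gaussians\<close>

text \<open>A symbol of order 0 need not decay in \<open>p\<close>, and \<open>lam\<close> is merely
  slowly varying, so neither an absolutely convergent kernel nor cutoffs smoothly adapted to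
  \<open>lam\<close> are at hand. Bounds on forms survive multiplication of the amplitude by
  measurable functions of \<open>x\<close> and of \<open>y\<close> of modulus at most 1: cells may
  be cut sharply, and the half-lines coming from the fundamental theorem of calculus cost nothing.
  Integration by parts acts in \<open>p\<close> alone and never meets these factors. On matched
  boxes \<open>lam\<close> cancels up to powers of \<open>C0\<close>: a derivative in a coordinate
  of \<open>q\<close> costs the reciprocal of the side and is integrated over that side; a
  derivative in \<open>p\<close> contributes the side, and division by the separation of the boxes
  removes it. The seminorm has order \<open>4 * CARD('n)\<close>: each coordinate of
  \<open>q\<close> is differentiated at most twice, and \<open>2 * CARD('n)\<close> derivatives in
  one component of \<open>p\<close> give a decay in the largest index difference that is bounded by
  a product of weights, one per coordinate, each summable over the integers.\<close>

lemma borel_measurable_cis [measurable (raw)]: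
  "f \<in> borel_measurable M \<Longrightarrow> (\<lambda>x. cis (f x)) \<in> borel_measurable M"
  by (rule measurable_compose[where g=cis]) (auto intro!: borel_measurable_continuous_onI continuous_intros)

lemma prod_Basis_vec:
  fixes h :: "real^'n::finite \<Rightarrow> 'b::comm_monoid_mult"
  shows "(\<Prod>b\<in>Basis. h b) = (\<Prod>l\<in>UNIV. h (axis l 1))"
proof -
  have B: "(Basis :: (real^'n) set) = range (\<lambda>l. axis l 1)"
    by (auto simp: Basis_vec_def)
  have "inj (\<lambda>l::'n. axis l (1::real))"
    by (auto simp: inj_on_def axis_eq_axis)
  then show ?thesis
    by (simp add: B prod.reindex o_def)
qed

text \<open>Lebesgue measure on vectors is the image of the product measure indexed by
  \<open>Basis\<close>, so Fubini for product measures applies once the coordinates are re-indexed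
  by \<open>axis l 1\<close>.\<close>

lemma lborel_prod_vec:
  fixes f :: "'n::finite \<Rightarrow> real \<Rightarrow> 'b::{real_normed_field,banach,second_countable_topology}"
  assumes f: "\<And>l. integrable lborel (f l)"
  shows "integrable lborel (\<lambda>x::real^'n. \<Prod>l\<in>UNIV. f l (x $ l))"
    and "(LINT x|(lborel :: (real^'n) measure). (\<Prod>l\<in>UNIV. f l (x $ l))) = (\<Prod>l\<in>UNIV. LINT x|lborel. f l x)"
proof -
  interpret product_sigma_finite "\<lambda>b::real^'n. lborel :: real measure"
    by standard
  let ?T = "\<lambda>g. \<Sum>b\<in>Basis. g b *\<^sub>R b :: real^'n"
  define F where "F b = f (SOME l. b = axis l 1)" for b :: "real^'n"
  have F: "F (axis l 1) = f l" for l
    by (simp add: F_def axis_eq_axis)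
  have T: "?T g $ l = g (axis l 1)" for g l
    using inner_sum_left_Basis[of "axis l 1 :: real^'n" g]
    by (simp add: inner_axis)
  have e: "(\<Prod>l\<in>UNIV. f l (?T g $ l)) = (\<Prod>b\<in>Basis. F b (g b))" for g
    unfolding T prod_Basis_vec F ..
  have m: "(\<lambda>x::real^'n. \<Prod>l\<in>UNIV. f l (x $ l)) \<in> borel_measurable borel"
    using f[THEN borel_measurable_integrable] by measurable
  have iF: "integrable lborel (F b)" for b
    by (simp add: F_def f)
  have i: "integrable (PiM Basis (\<lambda>b. lborel)) (\<lambda>g. \<Prod>b\<in>Basis. F b (g b))"
    by (rule product_integrable_prod) (auto simp: iF)
  have mT: "?T \<in> measurable (PiM Basis (\<lambda>b. lborel)) borel"
    by measurable
  show "integrable lborel (\<lambda>x::real^'n. \<Prod>l\<in>UNIV. f l (x $ l))"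
    unfolding lborel_eq[where 'a="real^'n"] using i by (subst integrable_distr_eq[OF mT m]) (simp only: e)
  have "(LINT x|(lborel :: (real^'n) measure). (\<Prod>l\<in>UNIV. f l (x $ l))) = (LINT g|PiM Basis (\<lambda>b. lborel). (\<Prod>b\<in>Basis. F b (g b)))"
    unfolding lborel_eq[where 'a="real^'n"] by (subst integral_distr[OF mT m]) (simp only: e)
  also have "\<dots> = (\<Prod>b\<in>Basis. LINT x|lborel. F b x)"
    by (rule product_integral_prod) (auto simp: iF)
  finally show "(LINT x|(lborel :: (real^'n) measure). (\<Prod>l\<in>UNIV. f l (x $ l))) = (\<Prod>l\<in>UNIV. LINT x|lborel. f l x)"
    by (simp add: prod_Basis_vec F)
qed

text \<open>Up to the substitution \<open>x = \<sigma> * p\<close> this is the characteristic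
  function of the standard normal distribution at \<open>s / \<sigma>\<close>.\<close>

lemma gauss_fourier_1:
  assumes "\<sigma> > 0"
  shows "integrable lborel (\<lambda>p::real. complex_of_real (exp (- (\<sigma> * p)\<^sup>2 / 2)) * cis (p * s))" (is ?A)
    and "(LINT p|lborel. complex_of_real (exp (- (\<sigma> * p)\<^sup>2 / 2)) * cis (p * s))
      = complex_of_real (2 * pi * normal_density 0 \<sigma> s)" (is ?B)
proof -
  let ?f = "\<lambda>x. complex_of_real (std_normal_density x) * cis (s / \<sigma> * x)"
  have "(LINT x|std_normal_distribution. iexp (s / \<sigma> * x)) = char std_normal_distribution (s / \<sigma>)"
    by (simp add: char_def)
  moreover have "(LINT x|std_normal_distribution. iexp (s / \<sigma> * x))
     = (LINT x|lborel. std_normal_density x *\<^sub>R iexp (s / \<sigma> * x))"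
    by (subst integral_density) (auto simp: normal_density_nonneg)
  ultimately have I: "(LINT x|lborel. ?f x) = complex_of_real (exp (- (s / \<sigma>)\<^sup>2 / 2))"
    by (simp add: char_std_normal_distribution scaleR_conv_of_real cis_conv_exp)
  have i: "integrable lborel ?f"
  proof (rule Bochner_Integration.integrable_bound)
    show "integrable lborel std_normal_density"
      by simp
  qed (auto simp: norm_mult normal_density_nonneg)
  have i2: "integrable lborel (\<lambda>x. ?f (0 + \<sigma> * x))"
    using lborel_integrable_real_affine[OF i, of \<sigma> 0] assms by simp
  have I2: "(LINT x|lborel. ?f (0 + \<sigma> * x)) = complex_of_real (exp (- (s / \<sigma>)\<^sup>2 / 2)) / \<sigma>"
    using lborel_integral_real_affine[of \<sigma> ?f 0] assms I by (simp add: scaleR_conv_of_real field_simps)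
  have e: "complex_of_real (exp (- (\<sigma> * p)\<^sup>2 / 2)) * cis (p * s) = complex_of_real (sqrt (2 * pi)) * ?f (0 + \<sigma> * p)" for p
    using assms by (simp add: std_normal_density_def mult.commute flip: of_real_mult)
  show ?A unfolding e using i2 by simp
  have "sqrt (2 * pi) * (exp (- (s / \<sigma>)\<^sup>2 / 2) / \<sigma>) = 2 * pi * normal_density 0 \<sigma> s"
    using assms by (simp add: normal_density_def power_divide real_sqrt_mult field_simps)
  then show ?B unfolding e using I2 by (simp flip: of_real_mult of_real_divide)
qed

definition gaussian_vec :: "real \<Rightarrow> real^'n::finite \<Rightarrow> real" where
  "gaussian_vec \<sigma> p = (\<Prod>l\<in>UNIV. exp (- (\<sigma> * p $ l)\<^sup>2 / 2))"

text \<open>Up to the factor \<open>(2 * pi) ^ CARD('n)\<close>, the Fourier transform of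
  \<open>gaussian_vec \<sigma>\<close>. Its mass is one for every \<open>\<sigma> > 0\<close>, which
  keeps the constant in Bessel's inequality independent of the Gaussian.\<close>

definition normal_vec :: "real \<Rightarrow> real^'n::finite \<Rightarrow> real" where
  "normal_vec \<sigma> x = (\<Prod>l\<in>UNIV. normal_density 0 \<sigma> (x $ l))"

lemma cis_inner_vec: "cis (p \<bullet> s) = (\<Prod>l\<in>UNIV. cis (p $ l * s $ l))" for p s :: "real^'n::finite"
  by (simp add: inner_vec_def cis_conv_exp sum_distrib_left exp_sum)

lemma gauss_fourier:
  fixes s :: "real^'n::finite"
  assumes "\<sigma> > 0"
  shows "integrable lborel (\<lambda>p. complex_of_real (gaussian_vec \<sigma> p) * cis (p \<bullet> s))"
    and "(LINT p|lborel. complex_of_real (gaussian_vec \<sigma> p) * cis (p \<bullet> s))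
      = complex_of_real ((2 * pi) ^ CARD('n) * normal_vec \<sigma> s)"
proof -
  have e: "complex_of_real (gaussian_vec \<sigma> p) * cis (p \<bullet> s)
     = (\<Prod>l\<in>UNIV. complex_of_real (exp (- (\<sigma> * p $ l)\<^sup>2 / 2)) * cis (p $ l * s $ l))" for p
    by (simp only: gaussian_vec_def cis_inner_vec prod.distrib of_real_prod)
  show "integrable lborel (\<lambda>p. complex_of_real (gaussian_vec \<sigma> p) * cis (p \<bullet> s))"
    unfolding e by (rule lborel_prod_vec(1)) (rule gauss_fourier_1(1)[OF assms])
  have "(LINT p|lborel. complex_of_real (gaussian_vec \<sigma> p) * cis (p \<bullet> s))
      = (\<Prod>l\<in>UNIV. complex_of_real (2 * pi * normal_density 0 \<sigma> (s $ l)))"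
    unfolding e by (subst lborel_prod_vec(2)) (rule gauss_fourier_1[OF assms], simp only: gauss_fourier_1(2)[OF assms])
  also have "\<dots> = complex_of_real ((2 * pi) ^ CARD('n) * normal_vec \<sigma> s)"
    unfolding normal_vec_def of_real_prod[symmetric] prod.distrib by simp
  finally show "(LINT p|lborel. complex_of_real (gaussian_vec \<sigma> p) * cis (p \<bullet> s))
      = complex_of_real ((2 * pi) ^ CARD('n) * normal_vec \<sigma> s)" .
qed

lemma gaussian_vec_props:
  shows "0 \<le> gaussian_vec \<sigma> p" "gaussian_vec \<sigma> p \<le> 1" "gaussian_vec \<sigma> \<in> borel_measurable borel"
  by (auto simp: gaussian_vec_def[abs_def] intro!: prod_nonneg prod_le_1)

lemma gaussian_vec_integrable:
  assumes "\<sigma> > 0"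
  shows "integrable lborel (gaussian_vec \<sigma>)"
proof -
  have "integrable lborel (\<lambda>p. norm (complex_of_real (gaussian_vec \<sigma> p) * cis (p \<bullet> 0)))"
    by (intro integrable_norm gauss_fourier assms)
  then show ?thesis
    by (simp add: gaussian_vec_props norm_mult)
qed

lemma gaussian_vec_tendsto:
  fixes p :: "real^'n::finite"
  shows "(\<lambda>j. gaussian_vec (1 / real (Suc j)) p) \<longlonglongrightarrow> 1"
proof -
  have "(\<lambda>j. gaussian_vec (1 / real (Suc j)) p) \<longlonglongrightarrow> (\<Prod>l\<in>(UNIV::'n set). exp (- (0 * p $ l)\<^sup>2 / 2))"
    unfolding gaussian_vec_def by (intro tendsto_intros LIMSEQ_Suc[OF lim_1_over_n] lim_1_over_n) auto
  then show ?thesis by simp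
qed

lemma normal_vec_props:
  assumes "\<sigma> > 0"
  shows "0 \<le> normal_vec \<sigma> x" "normal_vec \<sigma> \<in> borel_measurable borel" "integrable lborel (normal_vec \<sigma>)"
    "integral\<^sup>L lborel (normal_vec \<sigma>) = 1" "normal_vec \<sigma> (x - y) = normal_vec \<sigma> (y - x)"
proof -
  show "0 \<le> normal_vec \<sigma> x" "normal_vec \<sigma> \<in> borel_measurable borel"
    by (auto simp: normal_vec_def[abs_def] intro!: prod_nonneg)
  show "integrable lborel (normal_vec \<sigma>)" "integral\<^sup>L lborel (normal_vec \<sigma>) = 1"
    using lborel_prod_vec[of "\<lambda>l. normal_density 0 \<sigma>"] assms by (simp_all add: normal_vec_def[abs_def])
  show "normal_vec \<sigma> (x - y) = normal_vec \<sigma> (y - x)"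
    by (simp add: normal_vec_def normal_density_def power2_commute)
qed

subsection \<open>Oscillatory forms and Bessel's inequality\<close>

lemma borel_measurable_fst_borel [measurable (raw)]:
  fixes f :: "'c \<Rightarrow> 'a::second_countable_topology \<times> 'b::second_countable_topology"
  assumes "f \<in> borel_measurable M"
  shows "(\<lambda>x. fst (f x)) \<in> borel_measurable M" "(\<lambda>x. snd (f x)) \<in> borel_measurable M"
  using assms by (auto intro!: measurable_compose[OF assms] borel_measurable_continuous_onI continuous_intros)

lemma integrable_lborel_times:
  fixes f :: "'a::euclidean_space \<Rightarrow> real" and g :: "'b::euclidean_space \<Rightarrow> real"
  assumes "integrable lborel f" "integrable lborel g"
  shows "integrable lborel (\<lambda>z. f (fst z) * g (snd z))"
proof -
  have m: "f \<in> borel_measurable borel" "g \<in> borel_measurable borel"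
    using assms[THEN borel_measurable_integrable] by auto
  have "integrable (lborel \<Otimes>\<^sub>M lborel) (\<lambda>z. f (fst z) * g (snd z))"
  proof (rule lborel_pair.Fubini_integrable)
    show "(\<lambda>z. f (fst z) * g (snd z)) \<in> borel_measurable (lborel \<Otimes>\<^sub>M lborel)"
      using m by measurable
    show "integrable lborel (\<lambda>x. LINT y|lborel. norm (f (fst (x, y)) * g (snd (x, y))))"
      using assms by (simp add: abs_mult)
  qed (use assms in simp)
  then show ?thesis by (simp add: lborel_prod)
qed

section \<open>Amplitudes dominated in the frequency, and their oscillatory forms\<close>

abbreviation xv :: "('a \<times> 'a) \<times> 'a \<Rightarrow> 'a" where "xv z \<equiv> fst (fst z)"
abbreviation yv :: "('a \<times> 'a) \<times> 'a \<Rightarrow> 'a" where "yv z \<equiv> snd (fst z)"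
abbreviation pv :: "('a \<times> 'a) \<times> 'a \<Rightarrow> 'a" where "pv z \<equiv> snd z"

text \<open>Integrability makes the triple integral \<open>osc_form\<close> absolutely convergent;
  square integrability is what the estimates are about.\<close>

definition L1_L2 :: "('a::euclidean_space \<Rightarrow> complex) \<Rightarrow> bool" where
  "L1_L2 u \<longleftrightarrow> integrable lborel u \<and> integrable lborel (\<lambda>x. (norm (u x))\<^sup>2)"

definition sq_norm :: "('a::euclidean_space \<Rightarrow> complex) \<Rightarrow> real" where
  "sq_norm u = (LINT x|lborel. (norm (u x))\<^sup>2)"

text \<open>Against integrable \<open>u\<close> and \<open>v\<close>, a majorant in \<open>p\<close>
  alone is what Fubini requires; the regulariser of the \<open>p\<close>-integral will provide
  it.\<close>

definition amplitude :: "(('a::euclidean_space \<times> 'a) \<times> 'a \<Rightarrow> complex) \<Rightarrow> bool" where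
  "amplitude b \<longleftrightarrow> b \<in> borel_measurable borel \<and> (\<exists>D. integrable lborel D \<and> (\<forall>z. norm (b z) \<le> D (pv z)))"

text \<open>Bilinear, without conjugation of \<open>v\<close>; a conjugate is put into an argument
  where positivity or duality is used.\<close>

definition osc_form :: "(('a::euclidean_space \<times> 'a) \<times> 'a \<Rightarrow> complex) \<Rightarrow> ('a \<Rightarrow> complex) \<Rightarrow> ('a \<Rightarrow> complex) \<Rightarrow> complex"
  where "osc_form b u v = (LINT z|lborel. b z * cis (pv z \<bullet> (xv z - yv z)) * u (yv z) * v (xv z))"

text \<open>The bound is stated in the additive form that the arithmetic-geometric mean inequality
  yields; this is what makes Schur's test a plain summation.\<close>

definition form_bnd :: "(('a::euclidean_space \<times> 'a) \<times> 'a \<Rightarrow> complex) \<Rightarrow> real \<Rightarrow> bool" where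
  "form_bnd b M \<longleftrightarrow> amplitude b \<and> (\<forall>u v. L1_L2 u \<longrightarrow> L1_L2 v \<longrightarrow> norm (osc_form b u v) \<le> M * ((sq_norm u + sq_norm v) / 2))"

lemma L1_L2_measurable: "L1_L2 u \<Longrightarrow> u \<in> borel_measurable borel"
  using borel_measurable_integrable by (fastforce simp: L1_L2_def)

lemma sq_norm_nonneg [simp]: "0 \<le> sq_norm u"
  by (simp add: sq_norm_def)

lemma L1_L2_cnj: "L1_L2 u \<Longrightarrow> L1_L2 (\<lambda>x. cnj (u x))"
  by (simp add: L1_L2_def)

lemma sq_norm_cnj: "sq_norm (\<lambda>x. cnj (u x)) = sq_norm u"
  by (simp add: sq_norm_def)

lemma L1_L2_mult:
  assumes u: "L1_L2 u" and a: "\<alpha> \<in> borel_measurable borel" "\<And>x. norm (\<alpha> x) \<le> 1"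
  shows "L1_L2 (\<lambda>x. \<alpha> x * u x)" "sq_norm (\<lambda>x. \<alpha> x * u x) \<le> sq_norm u"
proof -
  note [measurable] = a(1) L1_L2_measurable[OF u]
  have le: "norm (\<alpha> x * u x) \<le> norm (u x)" for x
    using mult_right_mono[OF a(2)[of x], of "norm (u x)"] by (simp add: norm_mult)
  have le2: "(norm (\<alpha> x * u x))\<^sup>2 \<le> (norm (u x))\<^sup>2" for x
    using le by (intro power_mono) auto
  have i2: "integrable lborel (\<lambda>x. (norm (\<alpha> x * u x))\<^sup>2)"
    by (rule Bochner_Integration.integrable_bound[of _ "\<lambda>x. (norm (u x))\<^sup>2"]) (use u le2 in \<open>auto simp: L1_L2_def\<close>)
  then show "L1_L2 (\<lambda>x. \<alpha> x * u x)"
    unfolding L1_L2_def using u le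
    by (auto simp: L1_L2_def intro!: Bochner_Integration.integrable_bound[of _ u])
  show "sq_norm (\<lambda>x. \<alpha> x * u x) \<le> sq_norm u"
    unfolding sq_norm_def using i2 u le2 by (intro integral_mono) (auto simp: L1_L2_def)
qed

lemma osc_form_integrable:
  assumes b: "amplitude b" and u: "integrable lborel u" and v: "integrable lborel v"
  shows "integrable lborel (\<lambda>z. b z * cis (pv z \<bullet> (xv z - yv z)) * u (yv z) * v (xv z))"
proof -
  obtain D where D: "integrable lborel D" "\<And>z. norm (b z) \<le> D (pv z)" and b': "b \<in> borel_measurable borel"
    using b by (auto simp: amplitude_def)
  note [measurable] = b' u[THEN borel_measurable_integrable, simplified] v[THEN borel_measurable_integrable, simplified]
  have i: "integrable lborel (\<lambda>z. (norm (v (xv z)) * norm (u (yv z))) * D (pv z))"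
    by (rule integrable_lborel_times[OF integrable_lborel_times[of "\<lambda>x. norm (v x)" "\<lambda>x. norm (u x)"], simplified])
      (use u v D in auto)
  show ?thesis
  proof (rule Bochner_Integration.integrable_bound[OF i])
    show "AE z in lborel. norm (b z * cis (pv z \<bullet> (xv z - yv z)) * u (yv z) * v (xv z))
       \<le> norm ((norm (v (xv z)) * norm (u (yv z))) * D (pv z))"
    proof (rule AE_I2)
      fix z :: "('a \<times> 'a) \<times> 'a"
      have "0 \<le> D (pv z)" using D(2)[of z] norm_ge_zero order_trans by blast
      then show "norm (b z * cis (pv z \<bullet> (xv z - yv z)) * u (yv z) * v (xv z))
       \<le> norm ((norm (v (xv z)) * norm (u (yv z))) * D (pv z))"
        using mult_left_mono[OF D(2)[of z], of "norm (v (xv z)) * norm (u (yv z))"]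
        by (simp add: norm_mult abs_mult mult_ac)
    qed
  qed measurable
qed

lemma lborel_split_fst:
  fixes f :: "'a::euclidean_space \<times> 'b::euclidean_space \<Rightarrow> 'c::{banach,second_countable_topology}"
  assumes "integrable lborel f"
  shows "(LINT z|lborel. f z) = (LINT x|lborel. LINT y|lborel. f (x, y))"
    "(LINT z|lborel. f z) = (LINT y|lborel. LINT x|lborel. f (x, y))"
    "integrable lborel (\<lambda>x. LINT y|lborel. f (x, y))"
    "integrable lborel (\<lambda>y. LINT x|lborel. f (x, y))"
    "AE x in lborel. integrable lborel (\<lambda>y. f (x, y))"
    "AE y in lborel. integrable lborel (\<lambda>x. f (x, y))"
proof -
  have f: "integrable (lborel \<Otimes>\<^sub>M lborel) f"
    using assms by (simp add: lborel_prod)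
  then have f': "integrable (lborel \<Otimes>\<^sub>M lborel) (\<lambda>(x, y). f (x, y))"
    by simp
  show "(LINT z|lborel. f z) = (LINT x|lborel. LINT y|lborel. f (x, y))"
    using lborel_pair.integral_fst'[OF f] by (simp add: lborel_prod)
  then show "(LINT z|lborel. f z) = (LINT y|lborel. LINT x|lborel. f (x, y))"
    using lborel_pair.Fubini_integral[OF f'] by simp
  show "integrable lborel (\<lambda>x. LINT y|lborel. f (x, y))"
    using lborel_pair.integrable_fst'[OF f] .
  show "integrable lborel (\<lambda>y. LINT x|lborel. f (x, y))"
    using lborel_pair.integrable_snd[OF f'] .
  show "AE x in lborel. integrable lborel (\<lambda>y. f (x, y))"
    using lborel_pair.AE_integrable_fst'[OF f] .
  show "AE y in lborel. integrable lborel (\<lambda>x. f (x, y))"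
    using lborel_pair.AE_integrable_snd[OF f'] .
qed

section \<open>Fourier transforms and Bessel's inequality\<close>

definition fourier :: "('a::euclidean_space \<Rightarrow> complex) \<Rightarrow> 'a \<Rightarrow> complex" where
  "fourier u p = (LINT y|lborel. u y * cis (p \<bullet> y))"

lemma fourier_uminus: "fourier u (- p) = cnj (fourier (\<lambda>y. cnj (u y)) p)"
  using Bochner_Integration.integral_cnj[of lborel "\<lambda>y. cnj (u y) * cis (p \<bullet> y)"] by (simp add: fourier_def cis_cnj)

text \<open>Fubini for the same triple integral in two orders: integrating \<open>x\<close> and
  \<open>y\<close> first gives the Fourier side, integrating \<open>p\<close> first a convolution
  kernel. Bessel's inequality compares the two for a Gaussian \<open>c\<close>.\<close>

lemma osc_form_fourier:
  fixes c :: "'a::euclidean_space \<Rightarrow> complex"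
  assumes c: "integrable lborel c" and u: "integrable lborel u" and v: "integrable lborel v"
  shows "osc_form (\<lambda>z. c (pv z)) u v = (LINT p|lborel. c p * fourier u (- p) * fourier v p)"
    and "integrable lborel (\<lambda>p. c p * fourier u (- p) * fourier v p)"
    and "osc_form (\<lambda>z. c (pv z)) u v = (LINT w|lborel. (LINT p|lborel. c p * cis (p \<bullet> (fst w - snd w))) * u (snd w) * v (fst w))"
    and "integrable lborel (\<lambda>w. (LINT p|lborel. c p * cis (p \<bullet> (fst w - snd w))) * u (snd w) * v (fst w))"
proof -
  note [measurable] = borel_measurable_integrable[OF c, simplified]
  have "integrable lborel (\<lambda>p. norm (c p))"
    using c by simp
  then have "amplitude (\<lambda>z. c (pv z))"
    unfolding amplitude_def by (intro conjI exI[of _ "\<lambda>p. norm (c p)"]) auto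
  note i = osc_form_integrable[OF this u v]
  have e: "(LINT w|lborel. c p * cis (p \<bullet> (fst w - snd w)) * u (snd w) * v (fst w))
     = c p * fourier u (- p) * fourier v p" (is "?l = _") for p
  proof -
    have *: "integrable lborel (\<lambda>w. (v (fst w) * cis (p \<bullet> fst w)) * (u (snd w) * cis (- (p \<bullet> snd w))))"
    proof (rule Bochner_Integration.integrable_bound)
      show "integrable lborel (\<lambda>w. norm (v (fst w)) * norm (u (snd w)))"
        by (rule integrable_lborel_times) (use u v in auto)
      note [measurable] = u[THEN borel_measurable_integrable, simplified] v[THEN borel_measurable_integrable, simplified]
      show "(\<lambda>w. (v (fst w) * cis (p \<bullet> fst w)) * (u (snd w) * cis (- (p \<bullet> snd w)))) \<in> borel_measurable lborel"
        by measurable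
    qed (auto simp: norm_mult)
    have "cis (p \<bullet> (fst w - snd w)) = cis (p \<bullet> fst w) * cis (- (p \<bullet> snd w))" for w :: "'a \<times> 'a"
      by (simp add: cis_mult inner_diff_right)
    then have "?l = (LINT w|lborel. c p * ((v (fst w) * cis (p \<bullet> fst w)) * (u (snd w) * cis (- (p \<bullet> snd w)))))"
      by (simp add: mult_ac)
    also have "\<dots> = c p * (fourier v p * fourier u (- p))"
      unfolding integral_mult_right_zero lborel_split_fst(1)[OF *] by (simp add: fourier_def)
    finally show ?thesis by (simp add: mult_ac)
  qed
  show "osc_form (\<lambda>z. c (pv z)) u v = (LINT p|lborel. c p * fourier u (- p) * fourier v p)"
    unfolding osc_form_def lborel_split_fst(2)[OF i] by (simp add: e)
  show "integrable lborel (\<lambda>p. c p * fourier u (- p) * fourier v p)"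
    using lborel_split_fst(4)[OF i] by (simp add: e)
  show "osc_form (\<lambda>z. c (pv z)) u v = (LINT w|lborel. (LINT p|lborel. c p * cis (p \<bullet> (fst w - snd w))) * u (snd w) * v (fst w))"
    unfolding osc_form_def lborel_split_fst(1)[OF i] by simp
  show "integrable lborel (\<lambda>w. (LINT p|lborel. c p * cis (p \<bullet> (fst w - snd w))) * u (snd w) * v (fst w))"
    using lborel_split_fst(3)[OF i] by simp
qed


lemma lborel_shift:
  fixes f :: "'a::euclidean_space \<Rightarrow> 'b::{banach,second_countable_topology}"
  assumes "integrable lborel f"
  shows "integrable lborel (\<lambda>x. f (c + x))" "(LINT x|lborel. f (c + x)) = (LINT x|lborel. f x)"
proof -
  have m: "(+) c \<in> measurable lborel borel" by measurable
  have f: "f \<in> borel_measurable borel"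
    using borel_measurable_integrable[OF assms] by simp
  have "integrable (distr lborel borel ((+) c)) f"
    using assms by (simp add: lborel_distr_plus)
  then show "integrable lborel (\<lambda>x. f (c + x))"
    by (subst (asm) integrable_distr_eq[OF m f])
  have "(LINT x|distr lborel borel ((+) c). f x) = (LINT x|lborel. f (c + x))"
    by (rule integral_distr[OF m f])
  then show "(LINT x|lborel. f (c + x)) = (LINT x|lborel. f x)"
    by (simp add: lborel_distr_plus)
qed

text \<open>Fatou's lemma. The alternative \<open>f x = 0\<close> admits points where nothing is
  known about convergence; it accommodates the default value 0 of a \<open>p\<close>-integral that
  does not converge absolutely.\<close>

lemma fatou_bound:
  fixes f :: "'a \<Rightarrow> real"
  assumes m: "f \<in> borel_measurable M" and F: "\<And>j. integrable M (F j)" "\<And>j x. 0 \<le> F j x"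
    and B: "\<And>j. (LINT x|M. F j x) \<le> B"
    and lim: "\<And>x. x \<in> space M \<Longrightarrow> f x = 0 \<or> (\<lambda>j. F j x) \<longlonglongrightarrow> f x"
    and nonneg: "\<And>x. 0 \<le> f x"
  shows "integrable M f" "(LINT x|M. f x) \<le> B"
proof -
  have "0 \<le> (LINT x|M. F 0 x)" using F by simp
  with B[of 0] have "0 \<le> B" by simp
  have [measurable]: "F j \<in> borel_measurable M" for j
    using F(1) by auto
  have "(\<integral>\<^sup>+x. ennreal (f x) \<partial>M) \<le> (\<integral>\<^sup>+x. liminf (\<lambda>j. ennreal (F j x)) \<partial>M)"
  proof (rule nn_integral_mono)
    fix x assume "x \<in> space M"
    from lim[OF this] show "ennreal (f x) \<le> liminf (\<lambda>j. ennreal (F j x))"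
    proof
      assume "(\<lambda>j. F j x) \<longlonglongrightarrow> f x"
      then have "(\<lambda>j. ennreal (F j x)) \<longlonglongrightarrow> ennreal (f x)"
        by (rule tendsto_ennrealI)
      then show ?thesis
        by (simp add: lim_imp_Liminf)
    qed simp
  qed
  also have "\<dots> \<le> liminf (\<lambda>j. \<integral>\<^sup>+x. ennreal (F j x) \<partial>M)"
    by (rule nn_integral_liminf) measurable
  also have "\<dots> \<le> liminf (\<lambda>j::nat. ennreal B)"
    using F B by (intro Liminf_mono always_eventually) (auto simp: nn_integral_eq_integral intro: ennreal_leI)
  also have "\<dots> = ennreal B"
    by (simp add: Liminf_const)
  finally have le: "(\<integral>\<^sup>+x. ennreal (f x) \<partial>M) \<le> ennreal B" .
  show i: "integrable M f"
    using m nonneg le_less_trans[OF le ennreal_less_top] by (intro integrableI_nonneg) auto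
  show "(LINT x|M. f x) \<le> B"
    using le \<open>0 \<le> B\<close> nonneg by (simp add: nn_integral_eq_integral[OF i])
qed

lemma integrable_convolution_fst:
  fixes h k :: "'a::euclidean_space \<Rightarrow> real"
  assumes h: "integrable lborel h" and k: "integrable lborel k"
  shows "integrable lborel (\<lambda>w. k (snd w - fst w) * h (fst w))"
    "(LINT w|lborel. k (snd w - fst w) * h (fst w)) = (LINT x|lborel. k x) * (LINT x|lborel. h x)"
proof -
  note [measurable] = h[THEN borel_measurable_integrable, simplified] k[THEN borel_measurable_integrable, simplified]
  have i: "integrable lborel (\<lambda>y. k (y - x))" "(LINT y|lborel. k (y - x)) = (LINT x|lborel. k x)" for x
    using lborel_shift[OF k, of "- x"] by simp_all
  have n: "(LINT y|lborel. \<bar>k (y - x)\<bar>) = (LINT x|lborel. \<bar>k x\<bar>)" for x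
    using lborel_shift(2)[OF integrable_abs[OF k], of "- x"] by simp
  have "integrable (lborel \<Otimes>\<^sub>M lborel) (\<lambda>w. k (snd w - fst w) * h (fst w))"
  proof (rule lborel_pair.Fubini_integrable)
    show "(\<lambda>w. k (snd w - fst w) * h (fst w)) \<in> borel_measurable (lborel \<Otimes>\<^sub>M lborel)"
      by (simp add: lborel_prod)
    show "integrable lborel (\<lambda>x. LINT y|lborel. norm (k (snd (x, y) - fst (x, y)) * h (fst (x, y))))"
      using n h by (simp add: abs_mult)
  qed (use i in simp)
  then show I: "integrable lborel (\<lambda>w. k (snd w - fst w) * h (fst w))"
    by (simp add: lborel_prod)
  show "(LINT w|lborel. k (snd w - fst w) * h (fst w)) = (LINT x|lborel. k x) * (LINT x|lborel. h x)"
    by (simp add: lborel_split_fst(1)[OF I] i)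
qed

lemma lborel_swap:
  fixes f :: "'a::euclidean_space \<times> 'b::euclidean_space \<Rightarrow> 'c::{banach,second_countable_topology}"
  assumes "integrable lborel f"
  shows "integrable lborel (\<lambda>w. f (snd w, fst w))"
    "(LINT w|lborel. f (snd w, fst w)) = (LINT w|lborel. f w)"
proof -
  have f: "integrable (lborel \<Otimes>\<^sub>M lborel) f"
    using assms by (simp add: lborel_prod)
  show "integrable lborel (\<lambda>w. f (snd w, fst w))"
    using lborel_pair.integrable_product_swap[OF f] by (simp add: lborel_prod split_beta')
  show "(LINT w|lborel. f (snd w, fst w)) = (LINT w|lborel. f w)"
    using lborel_pair.integral_product_swap[OF borel_measurable_integrable[OF f]]
    by (simp add: lborel_prod split_beta')
qed

lemma integrable_convolution_snd:
  fixes h k :: "'a::euclidean_space \<Rightarrow> real"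
  assumes h: "integrable lborel h" and k: "integrable lborel k"
  shows "integrable lborel (\<lambda>w. k (fst w - snd w) * h (snd w))"
    "(LINT w|lborel. k (fst w - snd w) * h (snd w)) = (LINT x|lborel. k x) * (LINT x|lborel. h x)"
  using lborel_swap[OF integrable_convolution_fst(1)[OF h k]] integrable_convolution_fst(2)[OF h k]
  by simp_all

lemma fourier_measurable:
  assumes [measurable]: "u \<in> borel_measurable borel"
  shows "fourier u \<in> borel_measurable borel"
proof -
  have "(\<lambda>w. u (snd w) * cis (fst w \<bullet> snd w)) \<in> borel_measurable (borel \<Otimes>\<^sub>M lborel)"
    by measurable
  then show ?thesis
    unfolding fourier_def[abs_def] by (intro lborel.borel_measurable_lebesgue_integral) (simp add: case_prod_beta)
qed

text \<open>For Gaussian \<open>c\<close> and mutually conjugate arguments, the Fourier side of the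
  form is the integral sought, and the kernel side is \<open>(2 * pi) ^ CARD('n)\<close> times a
  quadratic form with kernel \<open>normal_vec \<sigma> (x - y)\<close>. The inequality of the means
  and the unit mass of the kernel then give the bound.\<close>

lemma fourier_bessel_gauss:
  fixes u :: "real^'n::finite \<Rightarrow> complex"
  assumes u: "L1_L2 u" and s: "\<sigma> > 0"
  shows "integrable lborel (\<lambda>p. gaussian_vec \<sigma> p * (norm (fourier u p))\<^sup>2)"
    and "(LINT p|lborel. gaussian_vec \<sigma> p * (norm (fourier u p))\<^sup>2) \<le> (2 * pi) ^ CARD('n) * sq_norm u"
proof -
  let ?c = "\<lambda>p. complex_of_real (gaussian_vec \<sigma> p)" and ?u' = "\<lambda>x. cnj (u x)" and ?K = "(2 * pi) ^ CARD('n)"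
  let ?n = "\<lambda>x. (norm (u x))\<^sup>2"
  have c: "integrable lborel ?c"
    by (rule integrable_of_real) (rule gaussian_vec_integrable[OF s])
  have u1: "integrable lborel u" "integrable lborel ?u'" and u2: "integrable lborel ?n"
    using u by (auto simp: L1_L2_def)
  have e: "?c p * fourier ?u' (- p) * fourier u p = complex_of_real (gaussian_vec \<sigma> p * (norm (fourier u p))\<^sup>2)" for p
    unfolding of_real_mult complex_norm_square by (simp add: fourier_uminus[of ?u'] mult_ac)
  note F = osc_form_fourier[OF c u1(2,1)]
  show "integrable lborel (\<lambda>p. gaussian_vec \<sigma> p * (norm (fourier u p))\<^sup>2)"
    using F(2) unfolding e complex_of_real_integrable_eq .
  have k: "(LINT p|lborel. ?c p * cis (p \<bullet> (fst w - snd w))) = complex_of_real (?K * normal_vec \<sigma> (fst w - snd w))" for w :: "(real^'n) \<times> (real^'n)"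
    by (rule gauss_fourier(2)[OF s])
  have sy: "normal_vec \<sigma> (fst w - snd w) = normal_vec \<sigma> (snd w - fst w)" for w :: "(real^'n) \<times> (real^'n)"
    using normal_vec_props(5)[OF s] .
  note cf = integrable_convolution_fst[OF u2 normal_vec_props(3)[OF s]]
  note cs = integrable_convolution_snd[OF u2 normal_vec_props(3)[OF s]]
  let ?b = "\<lambda>w. ?K * ((normal_vec \<sigma> (snd w - fst w) * ?n (fst w) + normal_vec \<sigma> (fst w - snd w) * ?n (snd w)) / 2)"
  have "complex_of_real (LINT p|lborel. gaussian_vec \<sigma> p * (norm (fourier u p))\<^sup>2) = osc_form (\<lambda>z. ?c (pv z)) ?u' u"
    unfolding F(1) e by (rule integral_complex_of_real[symmetric])
  also have "\<dots> = (LINT w|lborel. complex_of_real (?K * normal_vec \<sigma> (fst w - snd w)) * ?u' (snd w) * u (fst w))"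
    unfolding F(3) k ..
  finally have "\<bar>LINT p|lborel. gaussian_vec \<sigma> p * (norm (fourier u p))\<^sup>2\<bar>
    = norm (LINT w|lborel. complex_of_real (?K * normal_vec \<sigma> (fst w - snd w)) * ?u' (snd w) * u (fst w))"
    by (simp only: norm_of_real[where 'a=complex, symmetric])
  also have "\<dots> \<le> (LINT w|lborel. ?b w)"
  proof (rule Bochner_Integration.integral_norm_bound_integral)
    show "integrable lborel (\<lambda>w. complex_of_real (?K * normal_vec \<sigma> (fst w - snd w)) * ?u' (snd w) * u (fst w))"
      using F(4) unfolding k .
    show "integrable lborel ?b"
      using cf(1) cs(1) by simp
    fix w :: "(real^'n) \<times> (real^'n)"
    have "norm (u (snd w)) * norm (u (fst w)) \<le> (?n (fst w) + ?n (snd w)) / 2"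
      using sum_squares_bound[of "norm (u (snd w))" "norm (u (fst w))"] by (simp add: field_simps)
    from mult_left_mono[OF this, of "?K * normal_vec \<sigma> (fst w - snd w)"]
    show "norm (complex_of_real (?K * normal_vec \<sigma> (fst w - snd w)) * ?u' (snd w) * u (fst w)) \<le> ?b w"
      by (simp add: norm_mult abs_mult norm_power sy[of w] abs_of_nonneg[OF normal_vec_props(1)[OF s]] normal_vec_props(1)[OF s] field_simps del: of_real_mult)
  qed
  also have "\<dots> = ?K * sq_norm u"
    using cf cs by (simp add: sq_norm_def normal_vec_props(4)[OF s])
  finally show "(LINT p|lborel. gaussian_vec \<sigma> p * (norm (fourier u p))\<^sup>2) \<le> ?K * sq_norm u"
    by simp
qed

text \<open>The Gaussian is widened to the constant 1, and Fatou's lemma keeps the bound. As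
  \<open>fourier\<close> carries no normalising factor, the constant is
  \<open>(2 * pi) ^ CARD('n)\<close>.\<close>

lemma fourier_bessel:
  fixes u :: "real^'n::finite \<Rightarrow> complex"
  assumes u: "L1_L2 u"
  shows "integrable lborel (\<lambda>p. (norm (fourier u p))\<^sup>2)"
    and "(LINT p|lborel. (norm (fourier u p))\<^sup>2) \<le> (2 * pi) ^ CARD('n) * sq_norm u"
proof -
  have [measurable]: "fourier u \<in> borel_measurable borel"
    by (rule fourier_measurable[OF L1_L2_measurable[OF u]])
  have lim: "(\<lambda>j. gaussian_vec (1 / real (Suc j)) p * (norm (fourier u p))\<^sup>2) \<longlonglongrightarrow> (norm (fourier u p))\<^sup>2" for p
    using tendsto_mult[OF gaussian_vec_tendsto[of p] tendsto_const[of "(norm (fourier u p))\<^sup>2"]] by simp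
  have nn: "0 \<le> gaussian_vec (1 / real (Suc j)) p * (norm (fourier u p))\<^sup>2" for j p
    by (simp add: gaussian_vec_props)
  show "integrable lborel (\<lambda>p. (norm (fourier u p))\<^sup>2)"
    "(LINT p|lborel. (norm (fourier u p))\<^sup>2) \<le> (2 * pi) ^ CARD('n) * sq_norm u"
    by (rule fatou_bound[OF _ fourier_bessel_gauss(1)[OF u] nn fourier_bessel_gauss(2)[OF u] disjI2[OF lim]]; simp)+
qed

lemma form_bnd_fourier_multiplier:
  fixes c :: "real^'n::finite \<Rightarrow> complex"
  assumes c: "integrable lborel c" and M: "\<And>p. norm (c p) \<le> M"
  shows "form_bnd (\<lambda>z. c (pv z)) ((2 * pi) ^ CARD('n) * M)"
  unfolding form_bnd_def
proof (intro conjI allI impI)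
  note [measurable] = borel_measurable_integrable[OF c, simplified]
  have "integrable lborel (\<lambda>p. norm (c p))"
    using c by simp
  then show "amplitude (\<lambda>z. c (pv z))"
    unfolding amplitude_def by (intro conjI exI[of _ "\<lambda>p. norm (c p)"]) auto
  fix u v :: "real^'n \<Rightarrow> complex" assume u: "L1_L2 u" and v: "L1_L2 v"
  \<comment> \<open>\<open>fourier u (- p)\<close> has the modulus of the transform of
    \<open>?u'\<close> at \<open>p\<close>, so Bessel applies without reflecting
    \<open>p\<close>.\<close>
  let ?u' = "\<lambda>x. cnj (u x)"
  have uv: "integrable lborel u" "integrable lborel v"
    using u v by (auto simp: L1_L2_def)
  note F = osc_form_fourier[OF c uv]
  note Bu = fourier_bessel[OF L1_L2_cnj[OF u]] and Bv = fourier_bessel[OF v]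
  have M0: "0 \<le> M" using M[of 0] norm_ge_zero order_trans by blast
  let ?b = "\<lambda>p. M * (((norm (fourier ?u' p))\<^sup>2 + (norm (fourier v p))\<^sup>2) / 2)"
  have "norm (osc_form (\<lambda>z. c (pv z)) u v) \<le> (LINT p|lborel. ?b p)"
    unfolding F(1)
  proof (rule Bochner_Integration.integral_norm_bound_integral[OF F(2)])
    show "integrable lborel ?b"
      using Bu(1) Bv(1) by simp
    fix p
    have "norm (fourier ?u' p) * norm (fourier v p) \<le> ((norm (fourier ?u' p))\<^sup>2 + (norm (fourier v p))\<^sup>2) / 2"
      using sum_squares_bound[of "norm (fourier ?u' p)" "norm (fourier v p)"] by (simp add: field_simps)
    then show "norm (c p * fourier u (- p) * fourier v p) \<le> ?b p"
      unfolding norm_mult fourier_uminus[of u] complex_mod_cnj mult.assoc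
      by (intro mult_mono[OF M[of p]] M0) simp_all
  qed
  also have "\<dots> = M * (((LINT p|lborel. (norm (fourier ?u' p))\<^sup>2) + (LINT p|lborel. (norm (fourier v p))\<^sup>2)) / 2)"
    using Bu(1) Bv(1) by simp
  also have "\<dots> \<le> M * (((2 * pi) ^ CARD('n) * sq_norm u + (2 * pi) ^ CARD('n) * sq_norm v) / 2)"
    using Bu(2) Bv(2) M0 by (intro mult_left_mono divide_right_mono add_mono) (simp_all add: sq_norm_cnj)
  also have "\<dots> = (2 * pi) ^ CARD('n) * M * ((sq_norm u + sq_norm v) / 2)"
    by (simp add: algebra_simps)
  finally show "norm (osc_form (\<lambda>z. c (pv z)) u v) \<le> (2 * pi) ^ CARD('n) * M * ((sq_norm u + sq_norm v) / 2)" .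
qed

section \<open>Stability of form bounds under products, sums and superpositions\<close>

lemma form_bnd_mono: "form_bnd b M \<Longrightarrow> M \<le> M' \<Longrightarrow> form_bnd b M'"
  unfolding form_bnd_def by (meson sq_norm_nonneg add_nonneg_nonneg divide_nonneg_nonneg mult_right_mono order_trans zero_le_numeral)

lemma form_bnd_amplitude: "form_bnd b M \<Longrightarrow> amplitude b"
  by (simp add: form_bnd_def)

lemma amplitude_mult:
  assumes b: "amplitude b" and m[measurable]: "\<alpha> \<in> borel_measurable borel" "\<beta> \<in> borel_measurable borel"
    and le: "\<And>x. norm (\<alpha> x) \<le> 1" "\<And>x. norm (\<beta> x) \<le> 1"
  shows "amplitude (\<lambda>z. \<alpha> (xv z) * \<beta> (yv z) * b z)"
proof -
  obtain D where D: "integrable lborel D" "\<And>z. norm (b z) \<le> D (pv z)" and [measurable]: "b \<in> borel_measurable borel"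
    using b by (auto simp: amplitude_def)
  have "norm (\<alpha> (xv z) * \<beta> (yv z) * b z) \<le> D (pv z)" for z
  proof -
    have "norm (\<alpha> (xv z)) * norm (\<beta> (yv z)) \<le> 1"
      by (intro mult_le_one) (auto simp: le)
    from mult_mono[OF this D(2)[of z]] show ?thesis
      by (simp add: norm_mult)
  qed
  with D(1) show ?thesis
    unfolding amplitude_def by (intro conjI exI[of _ D]) auto
qed

text \<open>The factors are moved from the amplitude onto \<open>v\<close> and \<open>u\<close>,
  whose norms they do not increase. Every sharp cutoff, half-line and exponential of the proof
  enters through this.\<close>

lemma form_bnd_mult:
  assumes b: "form_bnd b M" and m: "\<alpha> \<in> borel_measurable borel" "\<beta> \<in> borel_measurable borel"
    and le: "\<And>x. norm (\<alpha> x) \<le> 1" "\<And>x. norm (\<beta> x) \<le> 1" and M: "0 \<le> M"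
  shows "form_bnd (\<lambda>z. \<alpha> (xv z) * \<beta> (yv z) * b z) M"
  unfolding form_bnd_def
proof (intro conjI allI impI)
  show "amplitude (\<lambda>z. \<alpha> (xv z) * \<beta> (yv z) * b z)"
    by (rule amplitude_mult[OF form_bnd_amplitude[OF b] m le])
  fix u v :: "'a \<Rightarrow> complex" assume u: "L1_L2 u" and v: "L1_L2 v"
  have "osc_form (\<lambda>z. \<alpha> (xv z) * \<beta> (yv z) * b z) u v = osc_form b (\<lambda>y. \<beta> y * u y) (\<lambda>x. \<alpha> x * v x)"
    by (simp add: osc_form_def mult_ac)
  also have "norm \<dots> \<le> M * ((sq_norm (\<lambda>y. \<beta> y * u y) + sq_norm (\<lambda>x. \<alpha> x * v x)) / 2)"
    using b L1_L2_mult(1)[OF u m(2) le(2)] L1_L2_mult(1)[OF v m(1) le(1)] by (auto simp: form_bnd_def)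
  also have "\<dots> \<le> M * ((sq_norm u + sq_norm v) / 2)"
    using L1_L2_mult(2)[OF u m(2) le(2)] L1_L2_mult(2)[OF v m(1) le(1)] M
    by (intro mult_left_mono divide_right_mono add_mono) auto
  finally show "norm (osc_form (\<lambda>z. \<alpha> (xv z) * \<beta> (yv z) * b z) u v) \<le> M * ((sq_norm u + sq_norm v) / 2)" .
qed

lemma amplitude_add:
  assumes "amplitude b" "amplitude c" shows "amplitude (\<lambda>z. b z + c z)"
proof -
  obtain D E where D: "integrable lborel D" "\<And>z. norm (b z) \<le> D (pv z)" and [measurable]: "b \<in> borel_measurable borel"
    and E: "integrable lborel E" "\<And>z. norm (c z) \<le> E (pv z)" and [measurable]: "c \<in> borel_measurable borel"
    using assms by (auto simp: amplitude_def)
  show ?thesis unfolding amplitude_def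
    by (intro conjI exI[of _ "\<lambda>p. D p + E p"]) (use D E in \<open>auto intro: norm_triangle_mono\<close>)
qed

lemma osc_form_add:
  assumes "amplitude b" "amplitude c" "integrable lborel u" "integrable lborel v"
  shows "osc_form (\<lambda>z. b z + c z) u v = osc_form b u v + osc_form c u v"
  using osc_form_integrable[OF assms(1,3,4)] osc_form_integrable[OF assms(2,3,4)]
  by (simp add: osc_form_def distrib_right)

lemma form_bnd_add:
  assumes b: "form_bnd b M" and c: "form_bnd c M'"
  shows "form_bnd (\<lambda>z. b z + c z) (M + M')"
  unfolding form_bnd_def
proof (intro conjI allI impI)
  show "amplitude (\<lambda>z. b z + c z)" by (intro amplitude_add form_bnd_amplitude[OF b] form_bnd_amplitude[OF c])
  fix u v :: "'a \<Rightarrow> complex" assume u: "L1_L2 u" and v: "L1_L2 v"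
  then have "osc_form (\<lambda>z. b z + c z) u v = osc_form b u v + osc_form c u v"
    by (intro osc_form_add form_bnd_amplitude[OF b] form_bnd_amplitude[OF c]) (auto simp: L1_L2_def)
  also have "norm \<dots> \<le> M * ((sq_norm u + sq_norm v) / 2) + M' * ((sq_norm u + sq_norm v) / 2)"
    using b c u v by (intro norm_triangle_mono) (auto simp: form_bnd_def)
  finally show "norm (osc_form (\<lambda>z. b z + c z) u v) \<le> (M + M') * ((sq_norm u + sq_norm v) / 2)"
    by (simp add: distrib_right)
qed

text \<open>The form is linear in the amplitude, so a superposition is bounded by the integral of
  the bounds; the product majorant \<open>E \<tau> * D p\<close> makes the interchange of integrals
  legitimate. It serves the fundamental theorem of calculus as well as the Laplace integral for
  \<open>1/s\<close>.\<close>

lemma form_bnd_integral: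
  fixes B :: "real \<Rightarrow> ('a::euclidean_space \<times> 'a) \<times> 'a \<Rightarrow> complex"
  assumes m[measurable]: "(\<lambda>w. B (fst w) (snd w)) \<in> borel_measurable borel"
    and E: "integrable lborel E" and D: "integrable lborel D"
    and le: "\<And>\<tau> z. norm (B \<tau> z) \<le> E \<tau> * D (pv z)"
    and b: "\<And>\<tau>. form_bnd (B \<tau>) (M * E \<tau>)"
  shows "form_bnd (\<lambda>z. LINT \<tau>|lborel. B \<tau> z) (M * (LINT \<tau>|lborel. E \<tau>))"
  unfolding form_bnd_def
proof (intro conjI allI impI)
  note [measurable] = D[THEN borel_measurable_integrable, simplified] E[THEN borel_measurable_integrable, simplified]
  have le': "norm (LINT \<tau>|lborel. B \<tau> z) \<le> (LINT \<tau>|lborel. E \<tau>) * D (pv z)" for z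
  proof -
    have m': "(\<lambda>\<tau>. B \<tau> z) \<in> borel_measurable borel"
      using measurable_compose[OF _ m, of "\<lambda>\<tau>. (\<tau>, z)" borel] by simp
    have i: "integrable lborel (\<lambda>\<tau>. E \<tau> * D (pv z))" using E by simp
    have "norm (LINT \<tau>|lborel. B \<tau> z) \<le> (LINT \<tau>|lborel. E \<tau> * D (pv z))"
    proof (rule Bochner_Integration.integral_norm_bound_integral[OF _ i])
      show "integrable lborel (\<lambda>\<tau>. B \<tau> z)"
        by (rule Bochner_Integration.integrable_bound[OF i]) (use m' in \<open>auto intro: order_trans[OF le abs_ge_self]\<close>)
    qed (rule le)
    then show ?thesis by simp
  qed
  have "(\<lambda>w. B (snd w) (fst w)) \<in> borel_measurable (borel \<Otimes>\<^sub>M lborel)"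
    using measurable_compose[OF _ m, of "\<lambda>w. (snd w, fst w)" "borel \<Otimes>\<^sub>M lborel"] by simp
  then have "(\<lambda>z. LINT \<tau>|lborel. B \<tau> z) \<in> borel_measurable borel"
    by (intro lborel.borel_measurable_lebesgue_integral) (simp add: case_prod_beta)
  then show "amplitude (\<lambda>z. LINT \<tau>|lborel. B \<tau> z)"
    unfolding amplitude_def using D le' by (intro conjI exI[of _ "\<lambda>p. (LINT \<tau>|lborel. E \<tau>) * D p"]) auto
  fix u v :: "'a \<Rightarrow> complex" assume u: "L1_L2 u" and v: "L1_L2 v"
  then have uv: "integrable lborel u" "integrable lborel v"
    by (auto simp: L1_L2_def)
  note [measurable] = L1_L2_measurable[OF u] L1_L2_measurable[OF v]
  let ?g = "\<lambda>z. cis (pv z \<bullet> (xv z - yv z)) * u (yv z) * v (xv z)"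
  have i: "integrable lborel (\<lambda>w. E (fst w) * norm (complex_of_real (D (pv (snd w))) * ?g (snd w)))"
  proof (rule integrable_lborel_times[OF E])
    have "amplitude (\<lambda>z. complex_of_real (D (pv z)))"
      unfolding amplitude_def using D by (intro conjI exI[of _ "\<lambda>p. \<bar>D p\<bar>"]) auto
    from osc_form_integrable[OF this uv] show "integrable lborel (\<lambda>z. norm (complex_of_real (D (pv z)) * ?g z))"
      by (intro integrable_norm) (simp add: mult.assoc)
  qed
  have I: "integrable lborel (\<lambda>w. B (fst w) (snd w) * ?g (snd w))"
  proof (rule Bochner_Integration.integrable_bound[OF i])
    show "(\<lambda>w. B (fst w) (snd w) * ?g (snd w)) \<in> borel_measurable lborel"
      by measurable
    show "AE w in lborel. norm (B (fst w) (snd w) * ?g (snd w))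
       \<le> norm (E (fst w) * norm (complex_of_real (D (pv (snd w))) * ?g (snd w)))"
    proof (rule AE_I2)
      fix w :: "real \<times> ('a \<times> 'a) \<times> 'a"
      have "norm (B (fst w) (snd w)) \<le> \<bar>E (fst w)\<bar> * \<bar>D (pv (snd w))\<bar>"
        using order_trans[OF le abs_ge_self] by (simp add: abs_mult)
      from mult_right_mono[OF this, of "norm (?g (snd w))"]
      show "norm (B (fst w) (snd w) * ?g (snd w))
       \<le> norm (E (fst w) * norm (complex_of_real (D (pv (snd w))) * ?g (snd w)))"
        by (simp add: norm_mult abs_mult mult_ac)
    qed
  qed
  have "osc_form (\<lambda>z. LINT \<tau>|lborel. B \<tau> z) u v = (LINT z|lborel. LINT \<tau>|lborel. B \<tau> z * ?g z)"
    by (simp add: osc_form_def mult.assoc)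
  also have "\<dots> = (LINT \<tau>|lborel. LINT z|lborel. B \<tau> z * ?g z)"
    using lborel_split_fst(1,2)[OF I] by simp
  also have "\<dots> = (LINT \<tau>|lborel. osc_form (B \<tau>) u v)"
    by (simp add: osc_form_def mult.assoc)
  also have "norm \<dots> \<le> (LINT \<tau>|lborel. M * E \<tau> * ((sq_norm u + sq_norm v) / 2))"
  proof (rule Bochner_Integration.integral_norm_bound_integral)
    show "integrable lborel (\<lambda>\<tau>. osc_form (B \<tau>) u v)"
      using lborel_split_fst(3)[OF I] by (simp add: osc_form_def mult.assoc)
    show "integrable lborel (\<lambda>\<tau>. M * E \<tau> * ((sq_norm u + sq_norm v) / 2))"
      using E by simp
    show "norm (osc_form (B \<tau>) u v) \<le> M * E \<tau> * ((sq_norm u + sq_norm v) / 2)" for \<tau>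
      using b[of \<tau>] u v unfolding form_bnd_def by blast
  qed
  also have "\<dots> = M * (LINT \<tau>|lborel. E \<tau>) * ((sq_norm u + sq_norm v) / 2)"
    by simp
  finally show "norm (osc_form (\<lambda>z. LINT \<tau>|lborel. B \<tau> z) u v) \<le> M * (LINT \<tau>|lborel. E \<tau>) * ((sq_norm u + sq_norm v) / 2)" .
qed

subsection \<open>Amplitudes on boxes\<close>

lemma smooth_frechet:
  assumes "smooth f"
  shows "(f has_derivative frechet_derivative f (at x)) (at x)"
    and "b \<in> Basis \<Longrightarrow> smooth (\<lambda>x. frechet_derivative f (at x) b)"
    and "continuous_on UNIV f"
proof -
  have C: "C_k (Suc j) f" for j
    using assms unfolding smooth_def by blast
  show "(f has_derivative frechet_derivative f (at x)) (at x)"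
    using C[of 0] by (simp add: differentiable_on_def frechet_derivative_works)
  show "smooth (\<lambda>x. frechet_derivative f (at x) b)" if "b \<in> Basis"
    using C that by (simp add: smooth_def)
  show "continuous_on UNIV f"
    using assms unfolding smooth_def by (metis C_k.simps(1))
qed

lemma smooth_deriv_q: "smooth f \<Longrightarrow> smooth (deriv_q i f)"
  unfolding deriv_q_def by (rule smooth_frechet(2)) (auto simp: Basis_prod_def Basis_vec_def)

lemma smooth_deriv_p: "smooth f \<Longrightarrow> smooth (deriv_p i f)"
  unfolding deriv_p_def by (rule smooth_frechet(2)) (auto simp: Basis_prod_def Basis_vec_def)

lemma smooth_deriv_p_funpow: "smooth f \<Longrightarrow> smooth ((deriv_p i ^^ k) f)"
  by (induction k) (auto intro: smooth_deriv_p)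

definition vec_upd :: "real^'n::finite \<Rightarrow> 'n \<Rightarrow> real \<Rightarrow> real^'n" where
  "vec_upd z l s = (\<chi> i. if i = l then s else z $ i)"

lemma vec_upd_nth [simp]: "vec_upd z l s $ i = (if i = l then s else z $ i)"
  by (simp add: vec_upd_def)

lemma vec_upd_has_vector_derivative:
  fixes f :: "(real^'n::finite) \<times> (real^'n) \<Rightarrow> complex"
  assumes "smooth f"
  shows "((\<lambda>s. f (vec_upd z l (a + \<sigma> * s), p)) has_vector_derivative
     \<sigma> *\<^sub>R deriv_q l f (vec_upd z l (a + \<sigma> * s), p)) (at s within T)"
proof -
  let ?w = "\<lambda>s. (vec_upd z l a + (\<sigma> * s) *\<^sub>R axis l 1, p)"
  have e: "(vec_upd z l (a + \<sigma> * s), p) = ?w s" for s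
    by (auto simp: vec_eq_iff axis_def)
  have w: "(?w has_derivative (\<lambda>d. ((\<sigma> * d) *\<^sub>R axis l 1, 0))) (at s within T)"
    by (auto intro!: derivative_eq_intros)
  have f: "(f has_derivative frechet_derivative f (at (?w s))) (at (?w s))"
    by (rule smooth_frechet(1)[OF assms])
  have "frechet_derivative f (at (?w s)) ((\<sigma> * d) *\<^sub>R axis l 1, 0) = d *\<^sub>R \<sigma> *\<^sub>R deriv_q l f (?w s)" for d
  proof -
    have "((\<sigma> * d) *\<^sub>R axis l 1, 0) = (d * \<sigma>) *\<^sub>R (axis l 1 :: real^'n, 0 :: real^'n)"
      by (simp add: mult.commute)
    then show ?thesis
      unfolding deriv_q_def by (simp only: linear_scale[OF has_derivative_linear[OF f]] scaleR_scaleR)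
  qed
  with diff_chain_within[OF w has_derivative_at_withinI[OF f]] show ?thesis
    unfolding e has_vector_derivative_def o_def by (simp add: o_def)
qed

text \<open>\<open>True\<close> selects \<open>x\<close> and \<open>False\<close> selects
  \<open>y\<close>, so that one freezing lemma serves both.\<close>

definition side_var :: "bool \<Rightarrow> ('a \<times> 'a) \<times> 'a \<Rightarrow> 'a" where
  "side_var e z = (if e then xv z else yv z)"

definition affine_pt :: "(bool \<Rightarrow> real^'n::finite) \<Rightarrow> real^'n \<Rightarrow> ((real^'n) \<times> (real^'n)) \<times> (real^'n) \<Rightarrow> real^'n" where
  "affine_pt S c z = (\<chi> i. S True $ i * xv z $ i + S False $ i * yv z $ i + c $ i)"

text \<open>In \<open>affine_pt S c\<close> the coordinates of \<open>x\<close> and \<open>y\<close> enter with the coefficients \<open>S True\<close> and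
  \<open>S False\<close>; a frozen coordinate has coefficient 0 and its value is absorbed in \<open>c\<close>.\<close>

definition box_amp :: "(real^'n) set \<Rightarrow> (real^'n) set \<Rightarrow> ((real^'n) \<times> (real^'n) \<Rightarrow> complex) \<Rightarrow> (real^'n \<Rightarrow> complex) \<Rightarrow>
    (bool \<Rightarrow> real^'n::finite) \<Rightarrow> real^'n \<Rightarrow> ((real^'n) \<times> (real^'n)) \<times> (real^'n) \<Rightarrow> complex" where
  "box_amp Q Q' f \<kappa> S c z = indicator Q (xv z) * indicator Q' (yv z) * (f (affine_pt S c z, pv z) * \<kappa> (pv z))"

text \<open>The fundamental theorem of calculus leaves an upper limit that depends on
  \<open>x\<close> or \<open>y\<close>. Written as the half-line
  \<open>\<xi> \<le> side_var e z $ l\<close> inside a fixed interval, it becomes a factor in one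
  position variable, which \<open>form_bnd_mult\<close> absorbs.\<close>

lemma form_bnd_freeze:
  fixes b b0 :: "((real^'n::finite) \<times> (real^'n)) \<times> (real^'n) \<Rightarrow> complex"
  assumes m[measurable]: "(\<lambda>w. B (fst w) (snd w)) \<in> borel_measurable borel"
    and D: "integrable lborel D" "\<And>\<xi> z. \<xi> \<in> {a..a+h} \<Longrightarrow> norm (B \<xi> z) \<le> D (pv z)"
    and b0: "form_bnd b0 M0" and B: "\<And>\<xi>. \<xi> \<in> {a..a+h} \<Longrightarrow> form_bnd (B \<xi>) M1"
    and b: "\<And>z. b z = b0 z + (LINT \<xi>|lborel. indicator {a..a+h} \<xi> * (of_bool (\<xi> \<le> side_var e z $ l) * B \<xi> z))"
    and h: "0 \<le> h" "0 \<le> M1"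
  shows "form_bnd b (M0 + h * M1)"
proof -
  let ?E = "indicat_real {a..a+h}"
  let ?B = "\<lambda>\<xi> z. indicator {a..a+h} \<xi> * (of_bool (\<xi> \<le> side_var e z $ l) * B \<xi> z)"
  have "form_bnd (\<lambda>z. LINT \<xi>|lborel. ?B \<xi> z) (M1 * (LINT \<xi>|lborel. ?E \<xi>))"
  proof (rule form_bnd_integral[OF _ _ D(1)])
    show "(\<lambda>w. ?B (fst w) (snd w)) \<in> borel_measurable borel"
    proof -
      have [measurable]: "(\<lambda>w. side_var e (snd w) $ l) \<in> borel_measurable borel"
        unfolding side_var_def by (cases e) (auto intro!: borel_measurable_continuous_onI continuous_intros)
      have [measurable]: "fst \<in> borel_measurable (borel :: (real \<times> ((real^'n) \<times> (real^'n)) \<times> (real^'n)) measure)"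
        by (intro borel_measurable_continuous_onI continuous_intros)
      show ?thesis unfolding of_bool_def by measurable
    qed
    show "integrable lborel ?E"
      using h by (simp add: integrable_indicator_iff)
    show "norm (?B \<xi> z) \<le> ?E \<xi> * D (pv z)" for \<xi> z
      using D(2)[of \<xi> z] order_trans[OF norm_ge_zero D(2)[of \<xi> z]] by (auto simp: norm_mult indicator_def)
    fix \<xi>
    show "form_bnd (?B \<xi>) (M1 * ?E \<xi>)"
    proof (cases "\<xi> \<in> {a..a+h}")
      case True
      let ?\<alpha> = "\<lambda>x :: real^'n. if e then of_bool (\<xi> \<le> x $ l) else 1 :: complex"
      let ?\<beta> = "\<lambda>x :: real^'n. if e then 1 else of_bool (\<xi> \<le> x $ l) :: complex"
      have "form_bnd (\<lambda>z. ?\<alpha> (xv z) * ?\<beta> (yv z) * B \<xi> z) M1"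
      proof (rule form_bnd_mult[OF B[OF True]])
        show "?\<alpha> \<in> borel_measurable borel" "?\<beta> \<in> borel_measurable borel"
          by (cases e; simp)+
      qed (use h in auto)
      moreover have "?B \<xi> = (\<lambda>z. ?\<alpha> (xv z) * ?\<beta> (yv z) * B \<xi> z)"
        using True by (auto simp: side_var_def fun_eq_iff)
      ultimately show ?thesis using True by simp
    next
      case False
      have "amplitude (\<lambda>z::((real^'n) \<times> (real^'n)) \<times> (real^'n). 0)"
        by (auto simp: amplitude_def intro!: exI[of _ "\<lambda>_. 0"])
      with False show ?thesis
        by (simp add: form_bnd_def osc_form_def)
    qed
  qed
  from form_bnd_add[OF b0 this] show ?thesis
    using h by (simp add: b[abs_def] mult.commute)
qed

lemma continuous_on_affine_pt [continuous_intros]: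
  assumes "\<And>e. continuous_on T (\<lambda>w. S w e)" "continuous_on T c" "continuous_on T z"
  shows "continuous_on T (\<lambda>w. affine_pt (S w) (c w) (z w))"
  unfolding affine_pt_def using assms by (intro continuous_intros)

lemma continuous_on_vec_upd [continuous_intros]:
  assumes "continuous_on T z" "continuous_on T s"
  shows "continuous_on T (\<lambda>w. vec_upd (z w) l (s w))"
  unfolding vec_upd_def
proof (intro continuous_on_vec_lambda)
  show "continuous_on T (\<lambda>x. if i = l then s x else z x $ i)" for i
    using assms by (cases "i = l") (auto intro!: continuous_intros)
qed

lemma affine_pt_freeze:
  "affine_pt (S(e := vec_upd (S e) l 0)) (vec_upd c l (c $ l + S e $ l * \<xi>)) z =
     vec_upd (affine_pt S c z) l ((affine_pt S c z $ l - S e $ l * (side_var e z $ l)) + S e $ l * \<xi>)"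
  by (cases e) (auto simp: vec_eq_iff affine_pt_def side_var_def algebra_simps)

text \<open>One use of the fundamental theorem of calculus, started at the corner \<open>o0\<close>:
  \<open>M0\<close> bounds the value there, \<open>M1\<close> the derivative along the way. The
  chain rule factor \<open>S e $ l\<close> has modulus at most 1 and is dropped, which makes the
  result uniform in \<open>t\<close>. \<open>B1\<close> supplies the majorant for Fubini.\<close>

lemma form_bnd_box_amp_freeze:
  fixes f :: "(real^'n::finite) \<times> (real^'n) \<Rightarrow> complex" and o0 :: "bool \<Rightarrow> real^'n" and h :: "real^'n"
  assumes f: "smooth f"
    and \<kappa>: "integrable lborel \<kappa>"
    and S: "\<bar>S e $ l\<bar> \<le> 1"
    and Q[measurable]: "Q \<in> sets borel" "Q' \<in> sets borel"
    and sub: "Q \<subseteq> cbox (o0 True) (o0 True + h)" "Q' \<subseteq> cbox (o0 False) (o0 False + h)"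
    and h: "\<And>i. h $ i > 0"
    and R: "\<And>z \<xi>. xv z \<in> Q \<Longrightarrow> yv z \<in> Q' \<Longrightarrow> \<xi> \<in> {o0 e $ l..o0 e $ l + h $ l} \<Longrightarrow>
        affine_pt (S(e := vec_upd (S e) l 0)) (vec_upd c l (c $ l + S e $ l * \<xi>)) z \<in> R"
    and B1: "\<And>z p. z \<in> R \<Longrightarrow> norm (deriv_q l f (z, p)) \<le> B1"
    and M0: "form_bnd (box_amp Q Q' f \<kappa> (S(e := vec_upd (S e) l 0)) (vec_upd c l (c $ l + S e $ l * o0 e $ l))) M0"
    and M1: "\<And>\<xi>. \<xi> \<in> {o0 e $ l..o0 e $ l + h $ l} \<Longrightarrow>
        form_bnd (box_amp Q Q' (deriv_q l f) \<kappa> (S(e := vec_upd (S e) l 0)) (vec_upd c l (c $ l + S e $ l * \<xi>))) M1"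
    and "0 \<le> M1" "0 \<le> B1"
  shows "form_bnd (box_amp Q Q' f \<kappa> S c) (M0 + h $ l * M1)"
proof (rule form_bnd_freeze[where a = "o0 e $ l" and e = e and l = l and D = "\<lambda>p. B1 * norm (\<kappa> p)"
      and B = "\<lambda>\<xi> z. complex_of_real (S e $ l) * box_amp Q Q' (deriv_q l f) \<kappa> (S(e := vec_upd (S e) l 0)) (vec_upd c l (c $ l + S e $ l * \<xi>)) z"])
  let ?a = "o0 e $ l" and ?h = "h $ l" and ?s = "S e $ l"
  let ?c = "\<lambda>\<xi>. vec_upd c l (c $ l + ?s * \<xi>)" and ?S = "S(e := vec_upd (S e) l 0)"
  note [measurable] = borel_measurable_integrable[OF \<kappa>, simplified]
  have f': "smooth (deriv_q l f)" by (rule smooth_deriv_q[OF f])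
  show "(\<lambda>w. complex_of_real ?s * box_amp Q Q' (deriv_q l f) \<kappa> ?S (?c (fst w)) (snd w)) \<in> borel_measurable borel"
  proof -
    have [measurable]: "(\<lambda>w. deriv_q l f (affine_pt ?S (?c (fst w)) (snd w), pv (snd w))) \<in> borel_measurable borel"
      by (intro borel_measurable_continuous_onI continuous_on_compose2[OF smooth_frechet(3)[OF f']] continuous_intros) auto
    show ?thesis
      unfolding box_amp_def by measurable
  qed
  show "integrable lborel (\<lambda>p. B1 * norm (\<kappa> p))"
    using \<kappa> by simp
  have le: "norm (complex_of_real ?s * w) \<le> norm w" for w
    using mult_right_mono[OF S, of "norm w"] by (simp add: norm_mult)
  show "norm (complex_of_real ?s * box_amp Q Q' (deriv_q l f) \<kappa> ?S (?c \<xi>) z) \<le> B1 * norm (\<kappa> (pv z))"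
    if \<xi>: "\<xi> \<in> {?a..?a + ?h}" for \<xi> z
  proof -
    have "norm (box_amp Q Q' (deriv_q l f) \<kappa> ?S (?c \<xi>) z) \<le> B1 * norm (\<kappa> (pv z))"
    proof (cases "xv z \<in> Q \<and> yv z \<in> Q'")
      case True
      then show ?thesis
        using B1[OF R[OF _ _ \<xi>], of z "pv z"] by (simp add: box_amp_def norm_mult mult_right_mono)
    next
      case False
      with \<open>0 \<le> B1\<close> show ?thesis by (auto simp: box_amp_def)
    qed
    with le show ?thesis by (rule order_trans)
  qed
  show "form_bnd (box_amp Q Q' f \<kappa> ?S (?c ?a)) M0" by (rule M0)
  show "form_bnd (\<lambda>z. complex_of_real ?s * box_amp Q Q' (deriv_q l f) \<kappa> ?S (?c \<xi>) z) M1" if \<xi>: "\<xi> \<in> {?a..?a + ?h}" for \<xi>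
    using form_bnd_mult[OF M1[OF \<xi>], of "\<lambda>_. complex_of_real ?s" "\<lambda>_. 1"] S \<open>0 \<le> M1\<close> by simp
  show "0 \<le> ?h" using h[of l] by simp
  fix z :: "((real^'n) \<times> (real^'n)) \<times> (real^'n)"
  let ?I = "\<lambda>\<xi>. indicator {?a..?a+?h} \<xi> * (of_bool (\<xi> \<le> side_var e z $ l) * (complex_of_real ?s * box_amp Q Q' (deriv_q l f) \<kappa> ?S (?c \<xi>) z))"
  show "box_amp Q Q' f \<kappa> S c z = box_amp Q Q' f \<kappa> ?S (?c ?a) z + (LINT \<xi>|lborel. ?I \<xi>)"
  proof (cases "xv z \<in> Q \<and> yv z \<in> Q'")
    case True
    let ?\<theta> = "side_var e z $ l"
    have \<theta>: "?a \<le> ?\<theta>" "?\<theta> \<le> ?a + ?h"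
      using True sub by (cases e; auto simp: side_var_def mem_box_cart)+
    let ?F = "\<lambda>\<xi>. f (affine_pt ?S (?c \<xi>) z, pv z)" and ?f = "\<lambda>\<xi>. ?s *\<^sub>R deriv_q l f (affine_pt ?S (?c \<xi>) z, pv z)"
    have "has_bochner_integral lborel (\<lambda>\<xi>. indicator {?a..?\<theta>} \<xi> *\<^sub>R ?f \<xi>) (?F ?\<theta> - ?F ?a)"
    proof (rule has_bochner_integral_FTC_Icc[OF \<theta>(1)])
      show "(?F has_vector_derivative ?f \<xi>) (at \<xi> within {?a..?\<theta>})" for \<xi>
        unfolding affine_pt_freeze by (rule vec_upd_has_vector_derivative[OF f])
      show "continuous_on {?a..?\<theta>} ?f"
        by (intro continuous_intros continuous_on_compose2[OF smooth_frechet(3)[OF f']]) auto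
    qed
    then have "has_bochner_integral lborel (\<lambda>\<xi>. (indicator {?a..?\<theta>} \<xi> *\<^sub>R ?f \<xi>) * \<kappa> (pv z)) ((?F ?\<theta> - ?F ?a) * \<kappa> (pv z))"
      by (rule has_bochner_integral_mult_left)
    moreover have "(\<lambda>\<xi>. (indicator {?a..?\<theta>} \<xi> *\<^sub>R ?f \<xi>) * \<kappa> (pv z)) = ?I"
      using True \<theta> by (auto simp: fun_eq_iff indicator_def box_amp_def scaleR_conv_of_real)
    ultimately have "(LINT \<xi>|lborel. ?I \<xi>) = (?F ?\<theta> - ?F ?a) * \<kappa> (pv z)"
      by (simp add: has_bochner_integral_integral_eq)
    moreover have "affine_pt ?S (?c ?\<theta>) z = affine_pt S c z"
      unfolding affine_pt_freeze by (auto simp: vec_eq_iff)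
    ultimately show ?thesis
      using True by (simp add: box_amp_def algebra_simps)
  qed (auto simp: box_amp_def)
qed (use \<open>0 \<le> M1\<close> in auto)


text \<open>Freezing amounts to replacing a coordinate of \<open>x\<close> or \<open>y\<close> by
  \<open>\<xi>\<close>, and the changed positions still lie in the boxes.\<close>

lemma affine_pt_freeze_range:
  fixes o0 :: "bool \<Rightarrow> real^'n::finite"
  assumes R: "\<And>z. xv z \<in> cbox (o0 True) (o0 True + h) \<Longrightarrow> yv z \<in> cbox (o0 False) (o0 False + h) \<Longrightarrow> affine_pt S c z \<in> R"
    and \<xi>: "\<xi> \<in> {o0 e $ l..o0 e $ l + h $ l}"
    and z: "xv z \<in> cbox (o0 True) (o0 True + h)" "yv z \<in> cbox (o0 False) (o0 False + h)"
  shows "affine_pt (S(e := vec_upd (S e) l 0)) (vec_upd c l (c $ l + S e $ l * \<xi>)) z \<in> R"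
proof -
  let ?z = "if e then ((vec_upd (xv z) l \<xi>, yv z), pv z) else ((xv z, vec_upd (yv z) l \<xi>), pv z)"
  have "affine_pt S c ?z \<in> R"
    by (rule R) (use z \<xi> in \<open>auto simp: mem_box_cart\<close>)
  moreover have "affine_pt (S(e := vec_upd (S e) l 0)) (vec_upd c l (c $ l + S e $ l * \<xi>)) z = affine_pt S c ?z"
    by (cases e) (auto simp: vec_eq_iff affine_pt_def algebra_simps)
  ultimately show ?thesis by simp
qed

text \<open>Freezing the coordinates of \<open>x\<close> and \<open>y\<close> one after the other writes the amplitude as a
  superposition of products of a function of \<open>x\<close>, a function of \<open>y\<close> and a function of \<open>p\<close>, to
  which Bessel's inequality applies.  Each coordinate of \<open>q\<close> is differentiated at most twice,
  once for \<open>x\<close> and once for \<open>y\<close>; working from the end of the list keeps the derivatives in the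
  order of \<open>mixed_deriv\<close>.\<close>

lemma form_bnd_box_amp:
  fixes f :: "(real^'n::finite) \<times> (real^'n) \<Rightarrow> complex" and o0 :: "bool \<Rightarrow> real^'n" and h :: "real^'n"
  assumes \<kappa>: "integrable lborel \<kappa>" "\<And>p. norm (\<kappa> p) \<le> K"
    and Q: "Q \<in> sets borel" "Q' \<in> sets borel"
    and sub: "Q \<subseteq> cbox (o0 True) (o0 True + h)" "Q' \<subseteq> cbox (o0 False) (o0 False + h)"
    and h: "\<And>i. h $ i > 0"
  shows "distinct is \<Longrightarrow> smooth f \<Longrightarrow> (\<And>e i. \<bar>S e $ i\<bar> \<le> 1) \<Longrightarrow> (\<And>e i. i \<notin> set is \<Longrightarrow> S e $ i = 0) \<Longrightarrow>
    (\<And>z. xv z \<in> cbox (o0 True) (o0 True + h) \<Longrightarrow> yv z \<in> cbox (o0 False) (o0 False + h) \<Longrightarrow> affine_pt S c z \<in> R) \<Longrightarrow>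
    (\<And>A z p. (\<And>i. A i \<le> 2) \<Longrightarrow> z \<in> R \<Longrightarrow>
       norm (foldr (\<lambda>i. deriv_q i ^^ A i) is f (z, p)) * (\<Prod>i\<in>set is. h $ i ^ A i) \<le> B) \<Longrightarrow>
    form_bnd (box_amp Q Q' f \<kappa> S c) ((2 * pi) ^ CARD('n) * (4 ^ length is * B * K))"
proof (induction "is" arbitrary: f S c B rule: rev_induct)
  case Nil
  note [measurable] = borel_measurable_integrable[OF \<kappa>(1), simplified] Q
  \<comment> \<open>No free coordinate is left: the symbol is evaluated at a fixed point of
    \<open>R\<close>, and the amplitude is a function of \<open>p\<close> cut to the cells.\<close>
  have "affine_pt S c z = c" for z
    using Nil.prems(4) by (simp add: affine_pt_def vec_eq_iff)
  then have e: "box_amp Q Q' f \<kappa> S c = (\<lambda>z. indicator Q (xv z) * indicator Q' (yv z) * (f (c, pv z) * \<kappa> (pv z)))"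
    by (simp add: fun_eq_iff box_amp_def)
  have "affine_pt S c ((o0 True, o0 False), 0) \<in> R"
    using h by (intro Nil.prems(5)) (auto simp: mem_box_cart less_imp_le)
  then have c: "c \<in> R"
    using Nil.prems(4) by (simp add: affine_pt_def vec_eq_iff)
  have B: "norm (f (c, p)) \<le> B" for p
    using Nil.prems(6)[of "\<lambda>_. 0" c p] c by simp
  have B0: "0 \<le> B" using order_trans[OF norm_ge_zero B[of 0]] .
  have K0: "0 \<le> K" using order_trans[OF norm_ge_zero \<kappa>(2)[of 0]] .
  have m: "(\<lambda>p. f (c, p)) \<in> borel_measurable borel"
    by (intro borel_measurable_continuous_onI continuous_on_compose2[OF smooth_frechet(3)[OF Nil.prems(2)]] continuous_intros) auto
  have i: "integrable lborel (\<lambda>p. f (c, p) * \<kappa> p)"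
  proof (rule Bochner_Integration.integrable_bound)
    show "integrable lborel (\<lambda>p. B * norm (\<kappa> p))" using \<kappa>(1) by simp
    show "(\<lambda>p. f (c, p) * \<kappa> p) \<in> borel_measurable lborel" using m by simp
    show "AE p in lborel. norm (f (c, p) * \<kappa> p) \<le> norm (B * norm (\<kappa> p))"
      using B B0 by (auto simp: norm_mult intro!: mult_right_mono)
  qed
  have "form_bnd (\<lambda>z. f (c, pv z) * \<kappa> (pv z)) ((2 * pi) ^ CARD('n) * (B * K))"
    by (rule form_bnd_fourier_multiplier[OF i]) (auto simp: norm_mult intro!: mult_mono B \<kappa>(2) B0)
  then have "form_bnd (\<lambda>z. indicator Q (xv z) * indicator Q' (yv z) * (f (c, pv z) * \<kappa> (pv z))) ((2 * pi) ^ CARD('n) * (B * K))"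
    by (rule form_bnd_mult) (use B0 K0 in \<open>auto simp: indicator_def\<close>)
  then show ?case
    unfolding e by simp
next
  case (snoc l "is")
  \<comment> \<open>The bound that the induction hypothesis yields for the \<open>j\<close>-th
    derivative in coordinate \<open>l\<close>: each derivative costs a factor
    \<open>1 / h $ l\<close>.\<close>
  let ?N = "\<lambda>j. (2 * pi) ^ CARD('n) * (4 ^ length is * (B / h $ l ^ j) * K)"
  let ?f = "\<lambda>j. (deriv_q l ^^ j) f"
  have l: "l \<notin> set is" "distinct is" using snoc.prems(1) by auto
  have hl: "h $ l > 0" by (rule h)
  have fs: "smooth (?f j)" for j
    by (induction j) (auto intro: snoc.prems(2) smooth_deriv_q)
  have fB: "norm (foldr (\<lambda>i. deriv_q i ^^ A i) is (?f j) (z, p)) * (\<Prod>i\<in>set is. h $ i ^ A i) \<le> B / h $ l ^ j"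
    if "\<And>i. A i \<le> 2" "z \<in> R" "j \<le> 2" for A z p j
  proof -
    \<comment> \<open>Since \<open>l\<close> stands last in the list, \<open>foldr\<close> applies
      its derivatives first, so they can be absorbed into the function to which the induction
      hypothesis is applied.\<close>
    let ?A = "A(l := j)"
    have "foldr (\<lambda>i. deriv_q i ^^ ?A i) is g = foldr (\<lambda>i. deriv_q i ^^ A i) is g" for g
      using l by (intro foldr_cong) auto
    then have f1: "foldr (\<lambda>i. deriv_q i ^^ ?A i) (is @ [l]) f = foldr (\<lambda>i. deriv_q i ^^ A i) is (?f j)"
      by simp
    have "(\<Prod>i\<in>set is. h $ i ^ ?A i) = (\<Prod>i\<in>set is. h $ i ^ A i)"
      using l by (intro prod.cong) auto
    then have f2: "(\<Prod>i\<in>set (is @ [l]). h $ i ^ ?A i) = h $ l ^ j * (\<Prod>i\<in>set is. h $ i ^ A i)"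
      using l by simp
    have "norm (foldr (\<lambda>i. deriv_q i ^^ ?A i) (is @ [l]) f (z, p)) * (\<Prod>i\<in>set (is @ [l]). h $ i ^ ?A i) \<le> B"
      by (rule snoc.prems(6)) (use that in auto)
    then show ?thesis
      unfolding f1 f2 using hl by (simp add: field_simps)
  qed
  have fR: "norm (?f j (z, p)) \<le> B / h $ l ^ j" if "z \<in> R" "j \<le> 2" for j z p
  proof -
    have "foldr (\<lambda>i. deriv_q i ^^ 0) is g = g" for g :: "(real^'n) \<times> (real^'n) \<Rightarrow> complex"
      by (induction "is") auto
    then show ?thesis
      using fB[of "\<lambda>_. 0" z j p] that by simp
  qed
  have "affine_pt S c ((o0 True, o0 False), 0) \<in> R"
    using h by (intro snoc.prems(5)) (auto simp: mem_box_cart less_imp_le)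
  from order_trans[OF norm_ge_zero fR[OF this, of 0]] have B0: "0 \<le> B" by simp
  have K0: "0 \<le> K" using order_trans[OF norm_ge_zero \<kappa>(2)[of 0]] .
  have N0: "0 \<le> ?N j" for j
    using B0 K0 hl by simp
  \<comment> \<open>\<open>?S1\<close> and \<open>?c1\<close> freeze coordinate \<open>l\<close> of
    \<open>x\<close>; \<open>?S2\<close> and \<open>?c2\<close> freeze that of \<open>y\<close> as
    well. Only then do all coefficients at \<open>l\<close> vanish, as the induction hypothesis
    demands.\<close>
  let ?S1 = "S(True := vec_upd (S True) l 0)" and ?c1 = "\<lambda>\<xi>. vec_upd c l (c $ l + S True $ l * \<xi>)"
  let ?S2 = "?S1(False := vec_upd (?S1 False) l 0)"
  let ?c2 = "\<lambda>\<xi> \<zeta>. vec_upd (?c1 \<xi>) l (?c1 \<xi> $ l + ?S1 False $ l * \<zeta>)"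
  have R1: "affine_pt ?S1 (?c1 \<xi>) z \<in> R"
    if "\<xi> \<in> {o0 True $ l..o0 True $ l + h $ l}"
      "xv z \<in> cbox (o0 True) (o0 True + h)" "yv z \<in> cbox (o0 False) (o0 False + h)" for \<xi> z
    by (rule affine_pt_freeze_range[where ?o0.0 = o0 and h = h, OF snoc.prems(5) that])
  have R2: "affine_pt ?S2 (?c2 \<xi> \<zeta>) z \<in> R"
    if "\<xi> \<in> {o0 True $ l..o0 True $ l + h $ l}" "\<zeta> \<in> {o0 False $ l..o0 False $ l + h $ l}"
      "xv z \<in> cbox (o0 True) (o0 True + h)" "yv z \<in> cbox (o0 False) (o0 False + h)" for \<xi> \<zeta> z
    by (rule affine_pt_freeze_range[where ?o0.0 = o0 and h = h, OF R1[OF that(1)] that(2-)])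
  have s2: "form_bnd (box_amp Q Q' (?f j) \<kappa> ?S2 (?c2 \<xi> \<zeta>)) (?N j)"
    if "\<xi> \<in> {o0 True $ l..o0 True $ l + h $ l}" "\<zeta> \<in> {o0 False $ l..o0 False $ l + h $ l}" "j \<le> 2" for \<xi> \<zeta> j
  proof (rule snoc.IH[OF l(2) fs])
    show "\<bar>?S2 e $ i\<bar> \<le> 1" for e i using snoc.prems(3) by auto
    show "?S2 e $ i = 0" if "i \<notin> set is" for e i using snoc.prems(4) that by auto
    show "affine_pt ?S2 (?c2 \<xi> \<zeta>) z \<in> R" if "xv z \<in> cbox (o0 True) (o0 True + h)" "yv z \<in> cbox (o0 False) (o0 False + h)" for z
      by (rule R2[OF \<open>\<xi> \<in> _\<close> \<open>\<zeta> \<in> _\<close> that])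
    show "norm (foldr (\<lambda>i. deriv_q i ^^ A i) is (?f j) (z, p)) * (\<Prod>i\<in>set is. h $ i ^ A i) \<le> B / h $ l ^ j"
      if "\<And>i. A i \<le> 2" "z \<in> R" for A z p
      by (rule fB[OF that \<open>j \<le> 2\<close>])
  qed
  have o: "o0 e $ l \<in> {o0 e $ l..o0 e $ l + h $ l}" for e
    using hl by simp
  have s1: "form_bnd (box_amp Q Q' (?f j) \<kappa> ?S1 (?c1 \<xi>)) (?N j + h $ l * ?N (Suc j))"
    if \<xi>: "\<xi> \<in> {o0 True $ l..o0 True $ l + h $ l}" and j: "j \<le> 1" for \<xi> j
  proof (rule form_bnd_box_amp_freeze[where e = False and l = l and ?o0.0 = o0 and R = R and ?B1.0 = "B / h $ l ^ Suc j", OF fs \<kappa>(1) _ Q sub h])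
    show "\<bar>?S1 False $ l\<bar> \<le> 1" using snoc.prems(3) by simp
    show "affine_pt ?S2 (?c2 \<xi> \<zeta>) z \<in> R" if "xv z \<in> Q" "yv z \<in> Q'" "\<zeta> \<in> {o0 False $ l..o0 False $ l + h $ l}" for z \<zeta>
      using R2[OF \<xi> that(3)] that(1,2) sub by blast
    show "norm (deriv_q l (?f j) (z, p)) \<le> B / h $ l ^ Suc j" if "z \<in> R" for z p
      using fR[OF that, of "Suc j" p] j by simp
    show "form_bnd (box_amp Q Q' (?f j) \<kappa> ?S2 (?c2 \<xi> (o0 False $ l))) (?N j)"
      using s2[OF \<xi> o, of j] j by simp
    show "form_bnd (box_amp Q Q' (deriv_q l (?f j)) \<kappa> ?S2 (?c2 \<xi> \<zeta>)) (?N (Suc j))" if "\<zeta> \<in> {o0 False $ l..o0 False $ l + h $ l}" for \<zeta>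
      using s2[OF \<xi> that, of "Suc j"] j by simp
    show "0 \<le> ?N (Suc j)" by (rule N0)
    show "0 \<le> B / h $ l ^ Suc j" using B0 hl by simp
  qed
  have "form_bnd (box_amp Q Q' f \<kappa> S c) ((?N 0 + h $ l * ?N 1) + h $ l * (?N 1 + h $ l * ?N 2))"
  proof (rule form_bnd_box_amp_freeze[where e = True and l = l and ?o0.0 = o0 and R = R and ?B1.0 = "B / h $ l", OF snoc.prems(2) \<kappa>(1) _ Q sub h])
    show "\<bar>S True $ l\<bar> \<le> 1" using snoc.prems(3) by simp
    show "affine_pt ?S1 (?c1 \<zeta>) z \<in> R" if "xv z \<in> Q" "yv z \<in> Q'" "\<zeta> \<in> {o0 True $ l..o0 True $ l + h $ l}" for z \<zeta>
      using R1[OF that(3)] that(1,2) sub by blast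
    show "norm (deriv_q l f (z, p)) \<le> B / h $ l" if "z \<in> R" for z p
      using fR[OF that, of 1 p] by simp
    show "form_bnd (box_amp Q Q' f \<kappa> ?S1 (?c1 (o0 True $ l))) (?N 0 + h $ l * ?N 1)"
      using s1[OF o, of 0] by simp
    show "form_bnd (box_amp Q Q' (deriv_q l f) \<kappa> ?S1 (?c1 \<zeta>)) (?N 1 + h $ l * ?N 2)" if "\<zeta> \<in> {o0 True $ l..o0 True $ l + h $ l}" for \<zeta>
      using s1[OF that, of 1] by (simp add: numeral_2_eq_2)
    show "0 \<le> ?N 1 + h $ l * ?N 2" by (intro add_nonneg_nonneg mult_nonneg_nonneg[OF less_imp_le[OF hl]] N0)
    show "0 \<le> B / h $ l" using B0 hl by simp
  qed
  \<comment> \<open>Every derivative comes with the length \<open>h $ l\<close> of its interval of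
    integration, so the four terms are equal; hence the factor 4 per coordinate.\<close>
  moreover have "(?N 0 + h $ l * ?N 1) + h $ l * (?N 1 + h $ l * ?N 2) = (2 * pi) ^ CARD('n) * (4 ^ length (is @ [l]) * B * K)"
    using hl by (simp add: field_simps power2_eq_square)
  ultimately show ?case by (simp only:)
qed

subsection \<open>Integration by parts in the frequency\<close>

lemma form_bnd_cmult:
  assumes b: "form_bnd b M"
  shows "form_bnd (\<lambda>z. c * b z) (norm c * M)"
  unfolding form_bnd_def
proof (intro conjI allI impI)
  obtain D where D: "integrable lborel D" "\<And>z. norm (b z) \<le> D (pv z)" and [measurable]: "b \<in> borel_measurable borel"
    using form_bnd_amplitude[OF b] by (auto simp: amplitude_def)
  have "integrable lborel (\<lambda>p. norm c * D p)" using D(1) by simp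
  then show "amplitude (\<lambda>z. c * b z)"
    unfolding amplitude_def
    by (intro conjI exI[of _ "\<lambda>p. norm c * D p"] allI) (simp_all only: norm_mult mult_left_mono[OF D(2)] norm_ge_zero, simp)
  fix u v :: "'a \<Rightarrow> complex" assume uv: "L1_L2 u" "L1_L2 v"
  have "osc_form (\<lambda>z. c * b z) u v = c * osc_form b u v"
    by (simp add: osc_form_def mult.assoc)
  moreover have "norm (osc_form b u v) \<le> M * ((sq_norm u + sq_norm v) / 2)"
    using b uv by (auto simp: form_bnd_def)
  ultimately show "norm (osc_form (\<lambda>z. c * b z) u v) \<le> norm c * M * ((sq_norm u + sq_norm v) / 2)"
    using mult_left_mono[of _ _ "norm c"] by (simp add: norm_mult mult.assoc)
qed

lemma has_bochner_integral_exp_Ici: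
  fixes d :: real
  assumes "d > 0"
  shows "has_bochner_integral lborel (\<lambda>\<tau>. indicator {0..} \<tau> * exp (- (\<tau> * d))) (1 / d)"
proof -
  have "has_bochner_integral lborel (\<lambda>x::real. indicator {0..} x * exp (- x)) 1"
    using has_bochner_integral_I0i_power_exp_m'[of 0] by (simp add: mult.commute)
  from lborel_has_bochner_integral_real_affine_iff[of d "\<lambda>x::real. indicator {0..} x * exp (- x)" 1 0, THEN iffD1, OF _ this]
  have "has_bochner_integral lborel (\<lambda>x. indicator {0..} (0 + d * x) * exp (- (0 + d * x))) (1 /\<^sub>R \<bar>d\<bar>)"
    using assms by simp
  moreover have "indicator {0..} (0 + d * x) * exp (- (0 + d * x)) = indicat_real {0..} x * exp (- (x * d))" for x
    using assms by (auto simp: indicator_def zero_le_mult_iff mult.commute)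
  ultimately show ?thesis
    using assms by (simp add: divide_inverse)
qed

text \<open>Division by the separation of the supports, through \<open>1/s = \<integral>\<^sub>0\<^sup>\<infinity> e\<^bsup>-\<tau>s\<^esup> d\<tau>\<close>: the exponential
  splits into a function of \<open>x\<close> and a function of \<open>y\<close>.\<close>

lemma form_bnd_divide_separation:
  fixes b :: "((real^'n::finite) \<times> (real^'n)) \<times> (real^'n) \<Rightarrow> complex"
  assumes b: "form_bnd b M" and M: "0 \<le> M"
    and supp: "\<And>z. b z \<noteq> 0 \<Longrightarrow> m1 \<le> \<sigma> * xv z $ l \<and> \<sigma> * yv z $ l \<le> m2"
    and d: "m1 - m2 = d" "d > 0"
  shows "form_bnd (\<lambda>z. b z / complex_of_real (\<sigma> * (xv z $ l - yv z $ l))) (M / d)"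
proof -
  obtain D where D: "integrable lborel D" "\<And>z. norm (b z) \<le> D (pv z)" and [measurable]: "b \<in> borel_measurable borel"
    using form_bnd_amplitude[OF b] by (auto simp: amplitude_def)
  let ?E = "\<lambda>\<tau>. indicator {0..} \<tau> * exp (- (\<tau> * d))"
  \<comment> \<open>The truncations by \<open>max 0\<close> keep both factors at most 1 everywhere.
    On the support of \<open>b\<close> and for \<open>\<tau> \<ge> 0\<close> they are inactive, and
    with \<open>s\<close> the separation \<open>\<sigma> * (xv z $ l - yv z $ l)\<close> the three
    exponents add up to \<open>- (\<tau> * s)\<close>, because \<open>s = d + (\<sigma> * xv z $ l -
    m1) + (m2 - \<sigma> * yv z $ l)\<close>.\<close>
  let ?\<alpha> = "\<lambda>\<tau> x. complex_of_real (exp (- (max 0 \<tau> * max 0 (\<sigma> * x $ l - m1))))"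
  let ?\<beta> = "\<lambda>\<tau> y. complex_of_real (exp (- (max 0 \<tau> * max 0 (m2 - \<sigma> * y $ l))))"
  let ?B = "\<lambda>\<tau> z. complex_of_real (?E \<tau>) * (?\<alpha> \<tau> (xv z) * ?\<beta> \<tau> (yv z) * b z)"
  have E: "integrable lborel ?E" "integral\<^sup>L lborel ?E = 1 / d"
    using has_bochner_integral_exp_Ici[OF d(2)] by (auto simp: has_bochner_integral_iff)
  have ab: "norm (?\<alpha> \<tau> x) \<le> 1" "norm (?\<beta> \<tau> x) \<le> 1" for \<tau> x
    by (simp_all add: mult_nonneg_nonneg)
  have ab2: "norm (?\<alpha> \<tau> (xv z) * ?\<beta> \<tau> (yv z) * b z) \<le> norm (b z)" for \<tau> z
  proof -
    have "norm (?\<alpha> \<tau> (xv z)) * norm (?\<beta> \<tau> (yv z)) \<le> 1"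
      by (intro mult_le_one ab norm_ge_zero)
    from mult_right_mono[OF this norm_ge_zero[of "b z"]] show ?thesis
      by (simp only: norm_mult mult_1)
  qed
  have "form_bnd (\<lambda>z. LINT \<tau>|lborel. ?B \<tau> z) (M * integral\<^sup>L lborel ?E)"
  proof (rule form_bnd_integral[OF _ E(1) D(1)])
    have [measurable]: "fst \<in> borel_measurable (borel :: (real \<times> ((real^'n) \<times> (real^'n)) \<times> (real^'n)) measure)"
      "(\<lambda>w. xv (snd w) $ l) \<in> borel_measurable (borel :: (real \<times> ((real^'n) \<times> (real^'n)) \<times> (real^'n)) measure)"
      "(\<lambda>w. yv (snd w) $ l) \<in> borel_measurable (borel :: (real \<times> ((real^'n) \<times> (real^'n)) \<times> (real^'n)) measure)"
      by (intro borel_measurable_continuous_onI continuous_intros)+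
    show "(\<lambda>w. ?B (fst w) (snd w)) \<in> borel_measurable borel"
      by measurable
    show "norm (?B \<tau> z) \<le> ?E \<tau> * D (pv z)" for \<tau> z
      using mult_left_mono[OF order_trans[OF ab2 D(2)], of "?E \<tau>" \<tau> z] unfolding norm_mult[of "complex_of_real (?E \<tau>)"] norm_of_real
      by simp
    fix \<tau>
    have "form_bnd (\<lambda>z. ?\<alpha> \<tau> (xv z) * ?\<beta> \<tau> (yv z) * b z) M"
      by (rule form_bnd_mult[OF b _ _ ab M]) measurable
    then show "form_bnd (?B \<tau>) (M * ?E \<tau>)"
      using form_bnd_cmult[of "\<lambda>z. ?\<alpha> \<tau> (xv z) * ?\<beta> \<tau> (yv z) * b z" M "complex_of_real (?E \<tau>)"]
      by (simp add: norm_mult mult.commute)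
  qed
  moreover have "(LINT \<tau>|lborel. ?B \<tau> z) = b z / complex_of_real (\<sigma> * (xv z $ l - yv z $ l))" for z
  proof (cases "b z = 0")
    case False
    let ?s = "\<sigma> * (xv z $ l - yv z $ l)"
    have s: "?s > 0" "m1 \<le> \<sigma> * xv z $ l" "\<sigma> * yv z $ l \<le> m2"
      using supp[OF False] d by (auto simp: algebra_simps)
    have "?B \<tau> z = complex_of_real (indicator {0..} \<tau> * exp (- (\<tau> * ?s))) * b z" for \<tau>
    proof (cases "0 \<le> \<tau>")
      case True
      have "exp (- (\<tau> * d)) * (exp (- (max 0 \<tau> * max 0 (\<sigma> * xv z $ l - m1))) * exp (- (max 0 \<tau> * max 0 (m2 - \<sigma> * yv z $ l))))
        = exp (- (\<tau> * ?s))"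
        using True s(2,3) d(1) by (auto simp: max_def algebra_simps simp flip: exp_add d(1))
      then show ?thesis using True by (simp flip: of_real_mult mult.assoc)
    qed auto
    then have "(LINT \<tau>|lborel. ?B \<tau> z) = (LINT \<tau>|lborel. complex_of_real (indicator {0..} \<tau> * exp (- (\<tau> * ?s)))) * b z"
      by (simp only: integral_mult_left_zero)
    also have "(LINT \<tau>|lborel. complex_of_real (indicator {0..} \<tau> * exp (- (\<tau> * ?s)))) = complex_of_real (1 / ?s)"
      using has_bochner_integral_exp_Ici[OF s(1)] unfolding integral_complex_of_real by (simp add: has_bochner_integral_iff)
    finally show ?thesis
      by (simp only: of_real_divide of_real_1 times_divide_eq_left mult_1)
  qed simp
  ultimately show ?thesis
    by (simp add: E(2))
qed

text \<open>Translation invariance takes the place of boundary terms: averaging the translates of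
  \<open>G'\<close> along \<open>e\<close> over a unit interval gives the integral of
  \<open>G (e + p) - G p\<close>, which vanishes.\<close>

lemma integral_directional_derivative_eq_0:
  fixes G :: "'a::euclidean_space \<Rightarrow> 'b::euclidean_space"
  assumes G: "integrable lborel G" and G': "integrable lborel G'"
    and der: "\<And>p s. ((\<lambda>s. G (p + s *\<^sub>R e)) has_vector_derivative G' (p + s *\<^sub>R e)) (at s)"
    and cont: "\<And>p. continuous_on UNIV (\<lambda>s::real. G' (p + s *\<^sub>R e))"
  shows "(LINT p|lborel. G' p) = 0"
proof -
  note [measurable] = G'[THEN borel_measurable_integrable, simplified]
  have F: "(LINT s|lborel. indicator {0..1} s *\<^sub>R G' (p + s *\<^sub>R e)) = G (e + p) - G p" for p
  proof -
    have "has_bochner_integral lborel (\<lambda>s. indicator {0..1} s *\<^sub>R G' (p + s *\<^sub>R e)) (G (p + 1 *\<^sub>R e) - G (p + 0 *\<^sub>R e))"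
    proof (rule has_bochner_integral_FTC_Icc)
      show "((\<lambda>s. G (p + s *\<^sub>R e)) has_vector_derivative G' (p + s *\<^sub>R e)) (at s within {0..1})" for s
        using der has_vector_derivative_at_within by blast
    qed (auto intro: continuous_on_subset[OF cont])
    then show ?thesis
      by (simp add: has_bochner_integral_integral_eq add.commute)
  qed
  let ?H = "\<lambda>w. indicat_real {0..1} (fst w) *\<^sub>R G' (snd w + fst w *\<^sub>R e)"
  have sh: "integrable lborel (\<lambda>p. G' (p + s *\<^sub>R e))" "(LINT p|lborel. G' (p + s *\<^sub>R e)) = (LINT p|lborel. G' p)"
    "(LINT p|lborel. norm (G' (p + s *\<^sub>R e))) = (LINT p|lborel. norm (G' p))" for s
    using lborel_shift[OF G', of "s *\<^sub>R e"] lborel_shift(2)[OF integrable_norm[OF G'], of "s *\<^sub>R e"] by (simp_all add: add.commute)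
  have i01: "integrable lborel (indicat_real {0..1::real})"
    by (simp add: integrable_indicator_iff)
  have "integrable (lborel \<Otimes>\<^sub>M lborel) ?H"
  proof (rule lborel_pair.Fubini_integrable)
    show "?H \<in> borel_measurable (lborel \<Otimes>\<^sub>M lborel)"
      by measurable
    show "integrable lborel (\<lambda>s. LINT p|lborel. norm (?H (s, p)))"
      using i01 by (simp add: sh)
    show "AE s in lborel. integrable lborel (\<lambda>p. ?H (s, p))"
      using sh(1) by simp
  qed
  then have H: "integrable lborel ?H"
    by (simp add: lborel_prod)
  have "(LINT p|lborel. G' p) = (LINT s|lborel. indicat_real {0..1::real} s *\<^sub>R (LINT p|lborel. G' p))"
    using i01 by simp
  also have "\<dots> = (LINT s|lborel. LINT p|lborel. ?H (s, p))"
    by (simp add: sh)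
  also have "\<dots> = (LINT p|lborel. LINT s|lborel. ?H (s, p))"
    using lborel_split_fst(1,2)[OF H] by simp
  also have "\<dots> = (LINT p|lborel. G (e + p) - G p)"
    by (simp add: F)
  also have "\<dots> = 0"
    using lborel_shift[OF G, of e] G by simp
  finally show ?thesis .
qed

text \<open>At fixed positions, differentiating the phase along \<open>axis l 1\<close> produces
  \<open>\<i>\<close> times component \<open>l\<close> of \<open>x - y\<close>. Only lines in
  \<open>p\<close> are involved, so sharp cutoffs in \<open>x\<close> and \<open>y\<close> do no
  harm.\<close>

lemma osc_form_integration_by_parts:
  fixes b b' :: "((real^'n::finite) \<times> (real^'n)) \<times> (real^'n) \<Rightarrow> complex"
  assumes b: "amplitude b" and b': "amplitude b'" and sb: "amplitude (\<lambda>z. complex_of_real (xv z $ l - yv z $ l) * b z)"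
    and der: "\<And>w p s. ((\<lambda>s. b (w, p + s *\<^sub>R axis l 1)) has_vector_derivative b' (w, p + s *\<^sub>R axis l 1)) (at s)"
    and cont: "\<And>w p. continuous_on UNIV (\<lambda>s::real. b' (w, p + s *\<^sub>R axis l 1))"
    and u: "integrable lborel u" and v: "integrable lborel v"
  shows "osc_form (\<lambda>z. complex_of_real (xv z $ l - yv z $ l) * b z) u v = \<i> * osc_form b' u v"
proof -
  have sec: "integrable lborel (\<lambda>p. c (w, p) * cis (p \<bullet> (fst w - snd w)))" if c: "amplitude c" for c w
  proof -
    obtain D where D: "integrable lborel D" "\<And>z. norm (c z) \<le> D (pv z)" and m: "c \<in> borel_measurable borel"
      using c by (auto simp: amplitude_def)
    have [measurable]: "(\<lambda>p. c (w, p)) \<in> borel_measurable borel"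
      by (rule measurable_compose[OF _ m]) simp
    have le: "norm (c (w, p)) \<le> \<bar>D p\<bar>" for p
      using D(2)[of "(w, p)"] by simp
    show ?thesis
      by (rule Bochner_Integration.integrable_bound[OF D(1)]) (auto simp: norm_mult le)
  qed
  have key: "(LINT p|lborel. (complex_of_real (xv (w, p) $ l - yv (w, p) $ l) * b (w, p)) * cis (p \<bullet> (fst w - snd w)))
      = \<i> * (LINT p|lborel. b' (w, p) * cis (p \<bullet> (fst w - snd w)))" for w
  proof -
    let ?s = "complex_of_real (fst w $ l - snd w $ l)" and ?e = "\<lambda>p. cis (p \<bullet> (fst w - snd w))"
    let ?G = "\<lambda>p. b (w, p) * ?e p" and ?G' = "\<lambda>p. b' (w, p) * ?e p + b (w, p) * (\<i> * ?s * ?e p)"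
    have i: "integrable lborel ?G" "integrable lborel (\<lambda>p. b' (w, p) * ?e p)"
      by (rule sec[OF b], rule sec[OF b'])
    have i': "integrable lborel (\<lambda>p. b (w, p) * (\<i> * ?s * ?e p))"
      using integrable_mult_right[OF i(1), of "\<i> * ?s"] by (simp add: mult_ac)
    have "(LINT p|lborel. ?G' p) = 0"
    proof (rule integral_directional_derivative_eq_0[OF i(1)])
      show "integrable lborel ?G'" using i(2) i' by simp
      have e: "(p + s *\<^sub>R axis l 1) \<bullet> (fst w - snd w) = p \<bullet> (fst w - snd w) + s * (fst w $ l - snd w $ l)" for p s
        by (simp add: inner_add_left inner_axis')
      show "((\<lambda>s. ?G (p + s *\<^sub>R axis l 1)) has_vector_derivative ?G' (p + s *\<^sub>R axis l 1)) (at s)" for p s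
      proof -
        have "((\<lambda>s. ?e (p + s *\<^sub>R axis l 1)) has_vector_derivative \<i> * ?s * ?e (p + s *\<^sub>R axis l 1)) (at s)"
        proof -
          have c: "cis (a + s * d) = exp (s *\<^sub>R (\<i> * complex_of_real d)) * cis a" for a s d
            by (simp add: cis_conv_exp exp_add[symmetric] scaleR_conv_of_real algebra_simps)
          show ?thesis
            unfolding e c by (rule has_vector_derivative_eq_rhs, rule has_vector_derivative_mult_left,
              rule exp_scaleR_has_vector_derivative_right) (simp add: mult_ac)
        qed
        from has_vector_derivative_mult[OF der this] show ?thesis
          by (simp add: add.commute)
      qed
      show "continuous_on UNIV (\<lambda>s. ?G' (p + s *\<^sub>R axis l 1))" for p
      proof -
        have "continuous_on UNIV (\<lambda>s. b (w, p + s *\<^sub>R axis l 1))"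
          by (intro continuous_at_imp_continuous_on ballI has_vector_derivative_continuous[OF der])
        then show ?thesis
          by (intro continuous_intros cont)
      qed
    qed
    then have "(LINT p|lborel. b' (w, p) * ?e p) + (LINT p|lborel. b (w, p) * (\<i> * ?s * ?e p)) = 0"
      using i(2) i' by simp
    moreover have "(LINT p|lborel. b (w, p) * (\<i> * ?s * ?e p)) = \<i> * (LINT p|lborel. (?s * b (w, p)) * ?e p)"
      unfolding integral_mult_right_zero[symmetric] by (simp add: mult_ac)
    ultimately have "(LINT p|lborel. b' (w, p) * ?e p) = - (\<i> * (LINT p|lborel. (?s * b (w, p)) * ?e p))"
      by (simp only: eq_neg_iff_add_eq_0)
    then have "\<i> * (LINT p|lborel. b' (w, p) * ?e p) = (LINT p|lborel. (?s * b (w, p)) * ?e p)"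
      by (simp only: mult_minus_right mult.assoc[symmetric] complex_i_mult_minus) simp
    then show ?thesis by (simp only: fst_conv snd_conv)
  qed
  show ?thesis
    unfolding osc_form_def lborel_split_fst(1)[OF osc_form_integrable[OF sb u v]] lborel_split_fst(1)[OF osc_form_integrable[OF b' u v]]
      fst_conv snd_conv integral_mult_left_zero
    using key by (simp add: mult.assoc)
qed


text \<open>The \<open>j\<close>-th derivative along \<open>axis l 1\<close> of \<open>\<Prod>\<^sub>i (1 + \<i>\<epsilon>p\<^sub>i)\<^sup>-\<^sup>2\<close>, which regularises the
  \<open>p\<close>-integral.\<close>

definition regulariser :: "real \<Rightarrow> 'n::finite \<Rightarrow> nat \<Rightarrow> real^'n \<Rightarrow> complex" where
  "regulariser \<epsilon> l j p = (\<Prod>i\<in>UNIV - {l}. inverse (1 + \<i> * complex_of_real (\<epsilon> * p $ i)) ^ 2)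
     * ((- \<i> * complex_of_real \<epsilon>) ^ j * fact (j + 1) * inverse (1 + \<i> * complex_of_real (\<epsilon> * p $ l)) ^ (j + 2))"

lemma one_plus_i_nonzero [simp]: "1 + \<i> * complex_of_real t \<noteq> 0"
  by (auto simp: complex_eq_iff)

lemma norm_inverse_one_plus_i: "norm (inverse (1 + \<i> * complex_of_real t)) \<le> 1"
proof -
  have "\<bar>Re (1 + \<i> * complex_of_real t)\<bar> \<le> norm (1 + \<i> * complex_of_real t)"
    by (rule abs_Re_le_cmod)
  then have "1 \<le> norm (1 + \<i> * complex_of_real t)" by simp
  then show ?thesis
    by (simp add: norm_inverse inverse_le_1_iff)
qed

lemma regulariser_0: "regulariser \<epsilon> l 0 p = (\<Prod>i\<in>UNIV. inverse (1 + \<i> * complex_of_real (\<epsilon> * p $ i)) ^ 2)"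
  unfolding regulariser_def by (subst (2) prod.remove[of _ l]) (auto simp: mult.commute power2_eq_square)

lemma regulariser_eq_regulariser_0:
  "regulariser \<epsilon> l j p = regulariser \<epsilon> l 0 p * ((- \<i> * complex_of_real \<epsilon>) ^ j * fact (j + 1) * inverse (1 + \<i> * complex_of_real (\<epsilon> * p $ l)) ^ j)"
  by (simp add: regulariser_def power_add mult_ac)

lemma norm_regulariser_0: "norm (regulariser \<epsilon> l 0 p) \<le> 1"
  unfolding regulariser_0 prod_norm[symmetric] norm_power
  by (intro prod_le_1 conjI power_le_one norm_inverse_one_plus_i zero_le_power norm_ge_zero)

text \<open>Differentiating an inverse square \<open>j\<close> times produces
  \<open>fact (j + 1)\<close>. A derivative thus costs \<open>\<epsilon>\<close> and keeps the
  integrable profile.\<close>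

lemma norm_regulariser_le: "norm (regulariser \<epsilon> l j p) \<le> norm (regulariser \<epsilon> l 0 p) * (\<bar>\<epsilon>\<bar> ^ j * fact (j + 1))"
proof -
  have "norm (inverse (1 + \<i> * complex_of_real (\<epsilon> * p $ l))) ^ j \<le> 1"
    by (intro power_le_one norm_inverse_one_plus_i norm_ge_zero)
  then have "\<bar>\<epsilon>\<bar> ^ j * fact (j + 1) * norm (inverse (1 + \<i> * complex_of_real (\<epsilon> * p $ l))) ^ j \<le> \<bar>\<epsilon>\<bar> ^ j * fact (j + 1) * 1"
    by (intro mult_left_mono) auto
  then have "norm ((- \<i> * complex_of_real \<epsilon>) ^ j * fact (j + 1) * inverse (1 + \<i> * complex_of_real (\<epsilon> * p $ l)) ^ j) \<le> \<bar>\<epsilon>\<bar> ^ j * fact (j + 1)"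
    by (simp only: norm_mult norm_power norm_minus_cancel norm_ii norm_of_real norm_fact mult_1)
  then show ?thesis
    unfolding regulariser_eq_regulariser_0[of \<epsilon> l j] norm_mult[of "regulariser \<epsilon> l 0 p"] by (intro mult_left_mono norm_ge_zero)
qed

lemma norm_regulariser: "norm (regulariser \<epsilon> l j p) \<le> \<bar>\<epsilon>\<bar> ^ j * fact (j + 1)"
  using order_trans[OF norm_regulariser_le mult_right_mono[OF norm_regulariser_0]] by simp

lemma continuous_regulariser: "continuous_on T (regulariser \<epsilon> l j)"
  unfolding regulariser_def[abs_def] by (intro continuous_intros) (auto simp del: of_real_mult)

text \<open>The exponent 2 turns each factor into one of modulus
  \<open>1 / (1 + (\<epsilon> * x)\<^sup>2)\<close>, and further derivatives are dominated by the
  undifferentiated product.\<close>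

lemma regulariser_integrable:
  assumes "\<epsilon> \<noteq> 0"
  shows "integrable lborel (regulariser \<epsilon> l j)"
proof -
  have 1: "integrable lborel (\<lambda>x. inverse (1 + \<i> * complex_of_real (\<epsilon> * x)) ^ 2)"
  proof -
    have "integrable lborel (\<lambda>x::real. inverse (1 + x\<^sup>2))"
      using integrable_inverse_1_plus_square by (simp add: set_integrable_def einterval_def)
    from lborel_integrable_real_affine[OF this assms, of 0]
    have i: "integrable lborel (\<lambda>x. inverse (1 + (\<epsilon> * x)\<^sup>2))" by simp
    show ?thesis
    proof (rule Bochner_Integration.integrable_bound[OF i])
      have "norm (inverse (1 + \<i> * complex_of_real t) ^ 2) = inverse (1 + t\<^sup>2)" for t
      proof -
        have "norm (1 + \<i> * complex_of_real t) ^ 2 = 1 + t\<^sup>2"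
          by (simp add: cmod_power2)
        then show ?thesis
          by (simp only: norm_power norm_inverse power_inverse)
      qed
      then show "AE x in lborel. norm (inverse (1 + \<i> * complex_of_real (\<epsilon> * x)) ^ 2) \<le> norm (inverse (1 + (\<epsilon> * x)\<^sup>2))"
        by (intro AE_I2) (simp del: of_real_mult)
    qed measurable
  qed
  have 0: "integrable lborel (regulariser \<epsilon> l 0)"
    unfolding regulariser_0[abs_def] by (rule lborel_prod_vec(1)[OF 1])
  have i: "integrable lborel (\<lambda>p. norm (regulariser \<epsilon> l 0 p) * (\<bar>\<epsilon>\<bar> ^ j * fact (j + 1)))"
    using 0 by simp
  show ?thesis
  proof (rule Bochner_Integration.integrable_bound[OF i])
    show "AE p in lborel. norm (regulariser \<epsilon> l j p) \<le> norm (norm (regulariser \<epsilon> l 0 p) * (\<bar>\<epsilon>\<bar> ^ j * fact (j + 1)))"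
      using order_trans[OF norm_regulariser_le abs_ge_self] by (intro AE_I2) (simp only: real_norm_def)
  qed (auto intro!: borel_measurable_continuous_onI continuous_regulariser)
qed

lemma regulariser_has_vector_derivative:
  "((\<lambda>s. regulariser \<epsilon> l j (p + s *\<^sub>R axis l 1)) has_vector_derivative regulariser \<epsilon> l (Suc j) (p + s *\<^sub>R axis l 1)) (at s)"
proof -
  let ?P = "(\<Prod>i\<in>UNIV - {l}. inverse (1 + \<i> * complex_of_real (\<epsilon> * p $ i)) ^ 2)"
  let ?c = "\<lambda>j. (- \<i> * complex_of_real \<epsilon>) ^ j * fact (j + 1) :: complex"
  have e: "regulariser \<epsilon> l j (p + s *\<^sub>R axis l 1) = ?P * (?c j * inverse (1 + \<i> * complex_of_real \<epsilon> * (complex_of_real (p $ l) + complex_of_real s)) ^ (j + 2))" for s j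
  proof -
    have "(\<Prod>i\<in>UNIV - {l}. inverse (1 + \<i> * complex_of_real (\<epsilon> * (p + s *\<^sub>R axis l 1) $ i)) ^ 2) = ?P"
      by (intro prod.cong) (auto simp: axis_def)
    then show ?thesis
      by (simp add: regulariser_def axis_def mult.assoc)
  qed
  \<comment> \<open>Here \<open>t\<close> is complex: a power of an affine function is
    differentiated, and the result is restricted to the real line at the end.\<close>
  let ?w = "\<lambda>t. 1 + \<i> * complex_of_real \<epsilon> * (complex_of_real (p $ l) + t)"
  have nz: "?w (complex_of_real s) \<noteq> 0"
    using one_plus_i_nonzero[of "\<epsilon> * (p $ l + s)"] by (simp add: mult.assoc)
  let ?v = "inverse (?w (complex_of_real s))" and ?k = "- \<i> * complex_of_real \<epsilon>"
  have "(?w has_field_derivative \<i> * complex_of_real \<epsilon>) (at (complex_of_real s))"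
    by (auto intro!: derivative_eq_intros)
  from DERIV_power[OF DERIV_inverse_fun[OF this nz], of "j + 2"]
  have "((\<lambda>t. inverse (?w t) ^ (j + 2)) has_field_derivative ?k * of_nat (j + 2) * ?v ^ (j + 3)) (at (complex_of_real s))"
    by (rule DERIV_cong) (simp add: numeral_3_eq_3 mult_ac flip: power_inverse)
  from DERIV_cmult[OF DERIV_cmult[OF this, of "?c j"], of ?P]
  have "((\<lambda>t. ?P * (?c j * inverse (?w t) ^ (j + 2))) has_field_derivative ?P * (?c (Suc j) * ?v ^ (Suc j + 2))) (at (complex_of_real s))"
  proof (rule DERIV_cong)
    have "?c (Suc j) = ?c j * (?k * of_nat (j + 2))"
      by (simp add: algebra_simps)
    then show "?P * (?c j * (?k * of_nat (j + 2) * ?v ^ (j + 3))) = ?P * (?c (Suc j) * ?v ^ (Suc j + 2))"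
      by (simp only: mult.assoc add_Suc_shift numeral_3_eq_3 add_2_eq_Suc' add_Suc_right add_Suc add_0_right)
  qed
  from has_vector_derivative_real_field[OF this]
  show ?thesis unfolding e by (simp add: o_def)
qed


lemma deriv_p_has_vector_derivative:
  fixes f :: "(real^'n::finite) \<times> (real^'n) \<Rightarrow> complex"
  assumes "smooth f"
  shows "((\<lambda>s. f (z, p + s *\<^sub>R axis l 1)) has_vector_derivative deriv_p l f (z, p + s *\<^sub>R axis l 1)) (at s)"
proof -
  let ?w = "\<lambda>s. (z, p + s *\<^sub>R axis l 1)"
  have w: "(?w has_derivative (\<lambda>d. (0, d *\<^sub>R axis l 1))) (at s)"
    by (auto intro!: derivative_eq_intros)
  have f: "(f has_derivative frechet_derivative f (at (?w s))) (at (?w s))"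
    by (rule smooth_frechet(1)[OF assms])
  have "frechet_derivative f (at (?w s)) (0, d *\<^sub>R axis l 1) = d *\<^sub>R deriv_p l f (?w s)" for d
  proof -
    have "(0, d *\<^sub>R axis l 1) = d *\<^sub>R (0 :: real^'n, axis l 1 :: real^'n)"
      by simp
    then show ?thesis
      unfolding deriv_p_def by (simp only: linear_scale[OF has_derivative_linear[OF f]])
  qed
  with diff_chain_at[OF w f] show ?thesis
    unfolding has_vector_derivative_def by (simp add: o_def)
qed

text \<open>Multiply by component \<open>l\<close> of \<open>x - y\<close>, trade this factor for a
  derivative in \<open>p\<close>, and divide it out again at the price \<open>1 / d\<close>. The
  product rule puts the derivative on the symbol (\<open>M1\<close>) or on the regulariser
  (\<open>M2\<close>). The sign \<open>\<sigma>\<close> orients the axis so that \<open>Q\<close>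
  lies on the upper side; \<open>L\<close> keeps the multiplied amplitude dominated.\<close>

lemma form_bnd_box_amp_integration_by_parts:
  fixes f :: "(real^'n::finite) \<times> (real^'n) \<Rightarrow> complex"
  assumes f: "smooth f"
    and b: "amplitude (box_amp Q Q' f (regulariser \<epsilon> l j) S c)"
    and b1: "form_bnd (box_amp Q Q' (deriv_p l f) (regulariser \<epsilon> l j) S c) M1"
    and b2: "form_bnd (box_amp Q Q' f (regulariser \<epsilon> l (Suc j)) S c) M2"
    and sep: "\<And>x. x \<in> Q \<Longrightarrow> m1 \<le> \<sigma> * x $ l" "\<And>y. y \<in> Q' \<Longrightarrow> \<sigma> * y $ l \<le> m2"
    and d: "m1 - m2 = d" "d > 0" and \<sigma>: "\<bar>\<sigma>\<bar> = 1"
    and L: "\<And>x y. x \<in> Q \<Longrightarrow> y \<in> Q' \<Longrightarrow> \<bar>x $ l - y $ l\<bar> \<le> L"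
    and M: "0 \<le> M1 + M2"
  shows "form_bnd (box_amp Q Q' f (regulariser \<epsilon> l j) S c) ((M1 + M2) / d)"
proof -
  let ?b = "box_amp Q Q' f (regulariser \<epsilon> l j) S c"
  let ?b' = "\<lambda>z. box_amp Q Q' (deriv_p l f) (regulariser \<epsilon> l j) S c z + box_amp Q Q' f (regulariser \<epsilon> l (Suc j)) S c z"
  let ?s = "\<lambda>z. xv z $ l - yv z $ l"
  have b': "form_bnd ?b' (M1 + M2)" by (rule form_bnd_add[OF b1 b2])
  have f': "smooth (deriv_p l f)" by (rule smooth_deriv_p[OF f])
  have supp: "xv z \<in> Q \<and> yv z \<in> Q'" if "?b z \<noteq> 0" for z
    using that by (auto simp: box_amp_def indicator_def split: if_splits)
  have asb: "amplitude (\<lambda>z. complex_of_real (?s z) * ?b z)"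
  proof -
    obtain D where D: "integrable lborel D" "\<And>z. norm (?b z) \<le> D (pv z)" and m: "?b \<in> borel_measurable borel"
      using b by (auto simp: amplitude_def)
    have le: "norm (complex_of_real (?s z) * ?b z) \<le> \<bar>L\<bar> * D (pv z)" for z
    proof (cases "?b z = 0")
      case True
      then show ?thesis using D(2)[of z] by simp
    next
      case False
      have "\<bar>?s z\<bar> \<le> \<bar>L\<bar>"
        using L[of "xv z" "yv z"] supp[OF False] by linarith
      then show ?thesis
        using D(2)[of z] by (auto simp: norm_mult intro!: mult_mono simp del: of_real_diff)
    qed
    have "(\<lambda>z :: ((real^'n) \<times> (real^'n)) \<times> (real^'n). complex_of_real (?s z)) \<in> borel_measurable borel"
      by (intro borel_measurable_continuous_onI continuous_intros)
    then have "(\<lambda>z. complex_of_real (?s z) * ?b z) \<in> borel_measurable borel"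
      using m by (rule borel_measurable_times)
    moreover have "integrable lborel (\<lambda>p. \<bar>L\<bar> * D p)" using D(1) by simp
    ultimately show ?thesis
      unfolding amplitude_def using le by blast
  qed
  have affine_pt: "affine_pt S c (w, p) = affine_pt S c (w, 0)" for w p
    by (simp add: affine_pt_def)
  have "form_bnd (\<lambda>z. complex_of_real (?s z) * ?b z) (M1 + M2)"
    unfolding form_bnd_def
  proof (intro conjI allI impI asb)
    fix u v :: "real^'n \<Rightarrow> complex" assume uv: "L1_L2 u" "L1_L2 v"
    have "osc_form (\<lambda>z. complex_of_real (?s z) * ?b z) u v = \<i> * osc_form ?b' u v"
    proof (rule osc_form_integration_by_parts[OF b form_bnd_amplitude[OF b'] asb])
      fix w :: "(real^'n) \<times> (real^'n)" and p :: "real^'n" and s :: real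
      have "((\<lambda>s. f (affine_pt S c (w, 0), p + s *\<^sub>R axis l 1) * regulariser \<epsilon> l j (p + s *\<^sub>R axis l 1)) has_vector_derivative
        f (affine_pt S c (w, 0), p + s *\<^sub>R axis l 1) * regulariser \<epsilon> l (Suc j) (p + s *\<^sub>R axis l 1)
        + deriv_p l f (affine_pt S c (w, 0), p + s *\<^sub>R axis l 1) * regulariser \<epsilon> l j (p + s *\<^sub>R axis l 1)) (at s)"
        by (rule has_vector_derivative_mult[OF deriv_p_has_vector_derivative[OF f] regulariser_has_vector_derivative])
      from has_vector_derivative_mult_right[OF this, of "indicator Q (fst w) * indicator Q' (snd w)"]
      show "((\<lambda>s. ?b (w, p + s *\<^sub>R axis l 1)) has_vector_derivative ?b' (w, p + s *\<^sub>R axis l 1)) (at s)"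
        unfolding box_amp_def fst_conv snd_conv affine_pt[of w "p + _ *\<^sub>R axis l 1"] by (simp add: algebra_simps)
      show "continuous_on UNIV (\<lambda>s. ?b' (w, p + s *\<^sub>R axis l 1))"
        unfolding box_amp_def fst_conv snd_conv affine_pt[of w "p + _ *\<^sub>R axis l 1"]
        by (intro continuous_intros continuous_on_compose2[OF smooth_frechet(3)[OF f]] continuous_on_compose2[OF smooth_frechet(3)[OF f']]
            continuous_on_compose2[OF continuous_regulariser[of UNIV]]) auto
    qed (use uv in \<open>auto simp: L1_L2_def\<close>)
    then show "norm (osc_form (\<lambda>z. complex_of_real (?s z) * ?b z) u v) \<le> (M1 + M2) * ((sq_norm u + sq_norm v) / 2)"
      using b' uv by (simp add: norm_mult form_bnd_def)
  qed
  from form_bnd_cmult[OF this, of "complex_of_real \<sigma>"] \<sigma>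
  have "form_bnd (\<lambda>z. complex_of_real \<sigma> * (complex_of_real (?s z) * ?b z)) (M1 + M2)"
    by (simp del: of_real_diff)
  then have "form_bnd (\<lambda>z. complex_of_real \<sigma> * (complex_of_real (?s z) * ?b z) / complex_of_real (\<sigma> * ?s z)) ((M1 + M2) / d)"
  proof (rule form_bnd_divide_separation[OF _ M _ d])
    fix z assume "complex_of_real \<sigma> * (complex_of_real (?s z) * ?b z) \<noteq> 0"
    then have "?b z \<noteq> 0" by auto
    from supp[OF this] show "m1 \<le> \<sigma> * xv z $ l \<and> \<sigma> * yv z $ l \<le> m2"
      using sep by blast
  qed
  moreover have "complex_of_real \<sigma> * (complex_of_real (?s z) * ?b z) / complex_of_real (\<sigma> * ?s z) = ?b z" for z
  proof (cases "?b z = 0")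
    case False
    have "d \<le> \<sigma> * ?s z"
      using sep supp[OF False] d(1) by (fastforce simp: algebra_simps)
    then have "complex_of_real (\<sigma> * ?s z) \<noteq> 0"
      unfolding of_real_eq_0_iff using d(2) by linarith
    then show ?thesis
      by (simp only: mult.assoc[symmetric] of_real_mult[symmetric] nonzero_mult_div_cancel_left not_False_eq_True)
  qed simp
  ultimately show ?thesis by simp
qed

text \<open>Every step splits into two by the product rule, whence \<open>2 ^ N\<close>. The
  induction runs over the number \<open>m\<close> of derivatives still to be taken, so that the
  bound \<open>M\<close> is asked only of the fully differentiated amplitudes.\<close>

lemma form_bnd_box_amp_integration_by_parts_iterated:
  fixes f :: "(real^'n::finite) \<times> (real^'n) \<Rightarrow> complex"
  assumes f: "smooth f"
    and b: "\<And>k j. k + j \<le> N \<Longrightarrow> amplitude (box_amp Q Q' ((deriv_p l ^^ k) f) (regulariser \<epsilon> l j) S c)"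
    and M: "\<And>k j. k + j = N \<Longrightarrow> form_bnd (box_amp Q Q' ((deriv_p l ^^ k) f) (regulariser \<epsilon> l j) S c) M" "0 \<le> M"
    and sep: "\<And>x. x \<in> Q \<Longrightarrow> m1 \<le> \<sigma> * x $ l" "\<And>y. y \<in> Q' \<Longrightarrow> \<sigma> * y $ l \<le> m2"
    and d: "m1 - m2 = d" "d > 0" and \<sigma>: "\<bar>\<sigma>\<bar> = 1"
    and L: "\<And>x y. x \<in> Q \<Longrightarrow> y \<in> Q' \<Longrightarrow> \<bar>x $ l - y $ l\<bar> \<le> L"
  shows "form_bnd (box_amp Q Q' f (regulariser \<epsilon> l 0) S c) ((2 / d) ^ N * M)"
proof -
  have "form_bnd (box_amp Q Q' ((deriv_p l ^^ k) f) (regulariser \<epsilon> l j) S c) ((2 / d) ^ m * M)"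
    if "k + j + m = N" for m k j
    using that
  proof (induction m arbitrary: k j)
    case 0
    then show ?case using M(1) by simp
  next
    case (Suc m)
    let ?M = "(2 / d) ^ m * M"
    have "0 \<le> ?M" using M(2) d(2) by simp
    have "form_bnd (box_amp Q Q' ((deriv_p l ^^ k) f) (regulariser \<epsilon> l j) S c) ((?M + ?M) / d)"
    proof (rule form_bnd_box_amp_integration_by_parts[OF smooth_deriv_p_funpow[OF f] b _ _ sep d \<sigma> L])
      show "form_bnd (box_amp Q Q' (deriv_p l ((deriv_p l ^^ k) f)) (regulariser \<epsilon> l j) S c) ?M"
        using Suc.IH[of "Suc k" j] Suc.prems by simp
      show "form_bnd (box_amp Q Q' ((deriv_p l ^^ k) f) (regulariser \<epsilon> l (Suc j)) S c) ?M"
        using Suc.IH[of k "Suc j"] Suc.prems by simp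
    qed (use \<open>0 \<le> ?M\<close> Suc.prems in linarith)+
    then show ?case by (simp add: field_simps)
  qed
  from this[of 0 0 N] show ?thesis by simp
qed

subsection \<open>Decay off the diagonal and Schur's test\<close>

lemma foldr_funpow_single:
  assumes "distinct is"
  shows "foldr (\<lambda>i. D i ^^ (if i = l then j else 0)) is f = (if l \<in> set is then (D l ^^ j) f else f)"
  using assms by (induction "is") auto

lemma mixed_deriv_single:
  "mixed_deriv A (\<lambda>i. if i = l then j else 0) f = foldr (\<lambda>i. deriv_q i ^^ A i) index_list ((deriv_p l ^^ j) f)"
  unfolding mixed_deriv_def by (simp add: foldr_funpow_single index_list)

lemma power_slow_variation:
  fixes x y C0 :: real
  assumes "x \<le> C0 * y" "0 \<le> x" "0 \<le> y" "1 \<le> C0" "i \<le> N"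
  shows "x ^ i \<le> C0 ^ N * y ^ i"
proof -
  have "x ^ i \<le> (C0 * y) ^ i" using assms by (intro power_mono) auto
  also have "\<dots> \<le> C0 ^ N * y ^ i"
    unfolding power_mult_distrib using assms by (intro mult_right_mono power_increasing) auto
  finally show ?thesis .
qed

text \<open>The summable decay allotted to one coordinate. The exponent 2 is the reason for taking
  \<open>2 * CARD('n)\<close> derivatives in \<open>p\<close>.\<close>

definition weight :: "int \<Rightarrow> real" where "weight d = 1 / (1 + \<bar>real_of_int d\<bar>)\<^sup>2"

lemma weight_pos: "0 < weight d"
  by (simp add: weight_def add_pos_nonneg)

text \<open>Comparison with a telescoping sum; the subtracted term is its remainder and lets the
  induction close.\<close>

lemma sum_inverse_squares_le: "(\<Sum>d<Suc K. 1 / (1 + real d)\<^sup>2) \<le> 2 - 1 / (real K + 1)"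
proof (induction K)
  case (Suc K)
  have "1 / (1 + real (Suc K))\<^sup>2 \<le> 1 / ((real K + 1) * (real K + 2))"
    by (intro frac_le mult_pos_pos) (auto simp: power2_eq_square algebra_simps)
  also have "\<dots> = 1 / (real K + 1) - 1 / (real (Suc K) + 1)"
    by (simp add: divide_simps)
  finally show ?case using Suc by simp
qed simp

lemma sum_weight_le:
  assumes "finite A"
  shows "(\<Sum>a\<in>A. weight (m - a)) \<le> 4"
proof -
  \<comment> \<open>The distance to \<open>m\<close> is injective on each side of \<open>m\<close>,
    so each side contributes at most the sum of the inverse squares, which is at most 2.\<close>
  have half: "(\<Sum>a\<in>B. weight (m - a)) \<le> 2" if B: "finite B" and inj: "inj_on (\<lambda>a. nat \<bar>m - a\<bar>) B" for B
  proof -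
    let ?g = "\<lambda>a. nat \<bar>m - a\<bar>"
    obtain K where K: "?g ` B \<subseteq> {..<K}"
      using finite_nat_iff_bounded B by blast
    have "(\<Sum>a\<in>B. weight (m - a)) = (\<Sum>d\<in>?g ` B. 1 / (1 + real d)\<^sup>2)"
      by (simp add: sum.reindex[OF inj] weight_def)
    also have "\<dots> \<le> (\<Sum>d<Suc K. 1 / (1 + real d)\<^sup>2)"
      using K by (intro sum_mono2) auto
    also have "\<dots> \<le> 2"
      by (rule order_trans[OF sum_inverse_squares_le]) simp
    finally show ?thesis .
  qed
  have "(\<Sum>a\<in>A. weight (m - a)) = (\<Sum>a\<in>A \<inter> {..m}. weight (m - a)) + (\<Sum>a\<in>A \<inter> {m<..}. weight (m - a))"
    by (subst sum.union_disjoint[symmetric]) (use assms in \<open>auto intro!: sum.cong\<close>)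
  also have "\<dots> \<le> 2 + 2"
    by (intro add_mono half) (use assms in \<open>auto simp: inj_on_def\<close>)
  finally show ?thesis by simp
qed

section \<open>Pieces of a partition, and Schur's test\<close>

definition restr :: "'a set \<Rightarrow> ('a \<Rightarrow> complex) \<Rightarrow> 'a \<Rightarrow> complex" where
  "restr Q u x = indicator Q x * u x"

lemma L1_L2_restr: "L1_L2 u \<Longrightarrow> Q \<in> sets borel \<Longrightarrow> L1_L2 (restr Q u)"
  unfolding restr_def[abs_def] by (rule L1_L2_mult) (auto simp: indicator_def)

lemma sum_restr:
  assumes "finite I" "disjoint_family_on P I" "\<And>x. u x \<noteq> 0 \<Longrightarrow> x \<in> (\<Union>i\<in>I. P i)"
  shows "u x = (\<Sum>i\<in>I. restr (P i) u x)"
proof (cases "u x = 0")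
  case False
  with assms(3) obtain i where i: "i \<in> I" "x \<in> P i" by blast
  then have "x \<notin> P j" if "j \<in> I - {i}" for j
    using assms(2) that by (auto simp: disjoint_family_on_def)
  then have "(\<Sum>j\<in>I - {i}. restr (P j) u x) = 0"
    by (intro sum.neutral) (auto simp: restr_def)
  moreover have "(\<Sum>j\<in>I. restr (P j) u x) = restr (P i) u x + (\<Sum>j\<in>I - {i}. restr (P j) u x)"
    by (rule sum.remove[OF assms(1) i(1)])
  ultimately show ?thesis
    using i by (simp only: add_0_right) (simp add: restr_def)
qed (simp add: restr_def)

lemma sum_sq_norm_restr:
  assumes I: "finite I" and P: "disjoint_family_on P I" "\<And>x. u x \<noteq> 0 \<Longrightarrow> x \<in> (\<Union>i\<in>I. P i)"
    and m: "\<And>i. i \<in> I \<Longrightarrow> P i \<in> sets borel" and u: "L1_L2 u"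
  shows "(\<Sum>i\<in>I. sq_norm (restr (P i) u)) = sq_norm u"
proof -
  have "(\<Sum>i\<in>I. sq_norm (restr (P i) u)) = (LINT x|lborel. (\<Sum>i\<in>I. (norm (restr (P i) u x))\<^sup>2))"
    unfolding sq_norm_def using L1_L2_restr[OF u m] by (subst Bochner_Integration.integral_sum) (auto simp: L1_L2_def)
  also have "(\<lambda>x. \<Sum>i\<in>I. (norm (restr (P i) u x))\<^sup>2) = (\<lambda>x. (norm (u x))\<^sup>2)"
  proof
    fix x
    \<comment> \<open>\<open>sum_restr\<close> is applied to the squared modulus itself, since
      restriction to a set commutes with squaring.\<close>
    let ?w = "\<lambda>x. complex_of_real ((norm (u x))\<^sup>2)"
    have "?w x = (\<Sum>i\<in>I. restr (P i) ?w x)"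
      by (rule sum_restr[OF I P(1)]) (use P(2) in auto)
    also have "\<dots> = complex_of_real (\<Sum>i\<in>I. (norm (restr (P i) u x))\<^sup>2)"
      unfolding of_real_sum by (intro sum.cong) (auto simp: restr_def indicator_def)
    finally show "(\<Sum>i\<in>I. (norm (restr (P i) u x))\<^sup>2) = (norm (u x))\<^sup>2"
      unfolding of_real_eq_iff by simp
  qed
  finally show ?thesis by (simp add: sq_norm_def)
qed

lemma osc_form_sum:
  assumes b: "amplitude b" and I: "finite I" "finite J"
    and u: "\<And>j. j \<in> J \<Longrightarrow> integrable lborel (u j)" and v: "\<And>i. i \<in> I \<Longrightarrow> integrable lborel (v i)"
  shows "osc_form b (\<lambda>y. \<Sum>j\<in>J. u j y) (\<lambda>x. \<Sum>i\<in>I. v i x) = (\<Sum>i\<in>I. \<Sum>j\<in>J. osc_form b (u j) (v i))"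
proof -
  let ?c = "\<lambda>z. b z * cis (pv z \<bullet> (xv z - yv z))"
  have "osc_form b (\<lambda>y. \<Sum>j\<in>J. u j y) (\<lambda>x. \<Sum>i\<in>I. v i x) = (LINT z|lborel. (\<Sum>i\<in>I. \<Sum>j\<in>J. ?c z * u j (yv z) * v i (xv z)))"
    by (simp add: osc_form_def sum_distrib_left sum_distrib_right)
  also have "\<dots> = (\<Sum>i\<in>I. \<Sum>j\<in>J. LINT z|lborel. ?c z * u j (yv z) * v i (xv z))"
    using osc_form_integrable[OF b u v] by (simp add: Bochner_Integration.integral_sum Bochner_Integration.integrable_sum)
  finally show ?thesis by (simp add: osc_form_def)
qed

text \<open>Sums over \<open>j\<close> control the part of \<open>v\<close>, sums over
  \<open>i\<close> that of \<open>u\<close>; the squared norms of disjoint pieces add up. It is used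
  for the cells within a pair of strips and again for the strips.\<close>

lemma schur_partition:
  fixes u v :: "'a::euclidean_space \<Rightarrow> complex"
  assumes b: "amplitude b" and u: "L1_L2 u" and v: "L1_L2 v" and I: "finite I" "finite J"
    and P: "disjoint_family_on P I" "\<And>x. v x \<noteq> 0 \<Longrightarrow> x \<in> (\<Union>i\<in>I. P i)" "\<And>i. P i \<in> sets borel"
    and P': "disjoint_family_on P' J" "\<And>x. u x \<noteq> 0 \<Longrightarrow> x \<in> (\<Union>j\<in>J. P' j)" "\<And>j. P' j \<in> sets borel"
    and K: "\<And>i j. i \<in> I \<Longrightarrow> j \<in> J \<Longrightarrow> norm (osc_form b (restr (P' j) u) (restr (P i) v))
       \<le> K i j * ((sq_norm (restr (P' j) u) + sq_norm (restr (P i) v)) / 2)"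
    and sums: "\<And>i. i \<in> I \<Longrightarrow> (\<Sum>j\<in>J. K i j) \<le> M" "\<And>j. j \<in> J \<Longrightarrow> (\<Sum>i\<in>I. K i j) \<le> M"
  shows "norm (osc_form b u v) \<le> M * ((sq_norm u + sq_norm v) / 2)"
proof -
  let ?u = "\<lambda>j. restr (P' j) u" and ?v = "\<lambda>i. restr (P i) v"
  have i: "integrable lborel (?u j)" "integrable lborel (?v i)" for i j
    using L1_L2_restr[OF u P'(3)] L1_L2_restr[OF v P(3)] by (auto simp: L1_L2_def)
  have "osc_form b u v = osc_form b (\<lambda>y. \<Sum>j\<in>J. ?u j y) (\<lambda>x. \<Sum>i\<in>I. ?v i x)"
    using sum_restr[OF I(2) P'(1,2)] sum_restr[OF I(1) P(1,2)] by presburger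
  also have "\<dots> = (\<Sum>i\<in>I. \<Sum>j\<in>J. osc_form b (?u j) (?v i))"
    by (rule osc_form_sum[OF b I i])
  also have "norm \<dots> \<le> (\<Sum>i\<in>I. \<Sum>j\<in>J. K i j * ((sq_norm (?u j) + sq_norm (?v i)) / 2))"
    by (intro sum_norm_le K)
  also have "\<dots> = (\<Sum>j\<in>J. (\<Sum>i\<in>I. K i j) * sq_norm (?u j)) / 2 + (\<Sum>i\<in>I. (\<Sum>j\<in>J. K i j) * sq_norm (?v i)) / 2"
  proof -
    have "(\<Sum>i\<in>I. \<Sum>j\<in>J. K i j * ((sq_norm (?u j) + sq_norm (?v i)) / 2))
       = (\<Sum>i\<in>I. \<Sum>j\<in>J. K i j * sq_norm (?u j) / 2) + (\<Sum>i\<in>I. \<Sum>j\<in>J. K i j * sq_norm (?v i) / 2)"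
      by (simp add: sum.distrib add_divide_distrib distrib_left)
    also have "(\<Sum>i\<in>I. \<Sum>j\<in>J. K i j * sq_norm (?u j) / 2) = (\<Sum>j\<in>J. \<Sum>i\<in>I. K i j * sq_norm (?u j) / 2)"
      by (rule sum.swap)
    finally show ?thesis
      by (simp add: sum_distrib_right sum_divide_distrib)
  qed
  also have "\<dots> \<le> (\<Sum>j\<in>J. M * sq_norm (?u j)) / 2 + (\<Sum>i\<in>I. M * sq_norm (?v i)) / 2"
    by (intro add_mono divide_right_mono sum_mono mult_right_mono sums) auto
  also have "\<dots> = M * ((sq_norm u + sq_norm v) / 2)"
    by (simp add: sum_distrib_left[symmetric] sum_sq_norm_restr[OF I(2) P'(1,2) P'(3) u] sum_sq_norm_restr[OF I(1) P(1,2) P(3) v] algebra_simps add_divide_distrib)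
  finally show ?thesis .
qed

text \<open>\<open>Sm\<close> will be the seminorm of \<open>a\<close>. The single inequality
  \<open>slow\<close> contains both directions, since \<open>r\<close> and \<open>r'\<close> may be
  exchanged.\<close>

locale symbol_bounds =
  fixes k :: "'n::finite" and lam :: "real \<Rightarrow> real" and C0 Sm t :: real
    and a :: "(real^'n) \<times> (real^'n) \<Rightarrow> complex"
  assumes a: "smooth a"
    and lam: "\<And>r. lam r > 0"
    and C0: "1 \<le> C0"
    and slow: "\<And>r r'. \<bar>r - r'\<bar> \<le> 1 \<Longrightarrow> lam r \<le> C0 * lam r'"
    and t: "0 \<le> t" "t \<le> 1"
    and bound: "\<And>A B q p. mi_order A \<le> 2 * CARD('n) \<Longrightarrow> mi_order B \<le> 2 * CARD('n) \<Longrightarrow>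
        norm (mixed_deriv A B a (q, p)) \<le> Sm * (lam (q $ k) ^ mi_order_tail k A / lam (q $ k) ^ mi_order_tail k B)"
begin

definition S :: "bool \<Rightarrow> real^'n" where
  "S e = (\<chi> i. if e then t else 1 - t)"

lemma S_nth [simp]: "S True $ i = t" "S False $ i = 1 - t"
  by (simp_all add: S_def)

lemma Sm: "0 \<le> Sm"
proof -
  have "norm (mixed_deriv (\<lambda>_. 0) (\<lambda>_. 0) a (0, 0)) \<le> Sm"
    using bound[of "\<lambda>_. 0" "\<lambda>_. 0" 0 0] by (simp add: mi_order_def mi_order_tail_def)
  then show ?thesis using norm_ge_zero order_trans by blast
qed

lemma a_le: "norm (a z) \<le> Sm"
proof -
  have "foldr (\<lambda>i. D i ^^ 0) is f = f" for D :: "'n \<Rightarrow> _ \<Rightarrow> (real^'n) \<times> (real^'n) \<Rightarrow> complex" and "is" f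
    by (induction "is") auto
  then show ?thesis
    using bound[of "\<lambda>_. 0" "\<lambda>_. 0" "fst z" "snd z"] by (simp add: mi_order_def mi_order_tail_def mixed_deriv_def)
qed

definition widths :: "real \<Rightarrow> real^'n" where
  "widths r = (\<chi> i. if i = k then 1 else inverse (lam r))"

lemma widths_pos: "widths r $ i > 0"
  by (simp add: widths_def lam)

text \<open>Half-open, so that the cells with given sides tile the space.\<close>

definition cell :: "real^'n \<Rightarrow> ('n \<Rightarrow> int) \<Rightarrow> (real^'n) set" where
  "cell h m = {x. \<forall>i. of_int (m i) * h $ i \<le> x $ i \<and> x $ i < (of_int (m i) + 1) * h $ i}"

lemma cell_measurable [measurable]: "cell h m \<in> sets borel"
proof -
  have "cell h m = (\<Inter>i. {x. of_int (m i) * h $ i \<le> x $ i} \<inter> {x. x $ i < (of_int (m i) + 1) * h $ i})"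
    by (auto simp: cell_def)
  also have "\<dots> \<in> sets borel"
    by (intro sets.finite_INT sets.Int borel_closed borel_open closed_Collect_le open_Collect_less continuous_intros) auto
  finally show ?thesis .
qed

text \<open>\<open>(2 * pi) ^ CARD('n)\<close> is Bessel's constant, \<open>4 ^ CARD('n)\<close>
  comes from freezing all coordinates, the power of \<open>C0\<close> from comparing
  \<open>lam\<close> at two points for up to \<open>2 * CARD('n)\<close> derivatives in
  \<open>q\<close> and as many in \<open>p\<close>, the factorial from the regulariser.\<close>

definition C1 :: real where
  "C1 = (2 * pi) ^ CARD('n) * (4 ^ CARD('n) * (C0 ^ (4 * CARD('n)) * fact (2 * CARD('n) + 1)))"

lemma C1: "0 < C1"
  using C0 by (simp add: C1_def)

text \<open>While \<open>x\<close> and \<open>y\<close> run through the cells, coordinate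
  \<open>k\<close> of \<open>t x + (1 - t) y\<close> stays between \<open>r\<close> and
  \<open>r + 1\<close>, where \<open>lam\<close> is comparable with \<open>lam r\<close>. Hence the
  sides \<open>widths r\<close> compensate the derivatives in \<open>q\<close>, and \<open>i\<close>
  derivatives in \<open>p\<close> leave \<open>(widths r $ l) ^ i\<close>.\<close>

lemma form_bnd_cells:
  fixes m m' :: "'n \<Rightarrow> int"
  defines "r \<equiv> t * of_int (m k) + (1 - t) * of_int (m' k)"
  assumes j: "i + j \<le> 2 * CARD('n)" and \<epsilon>: "0 < \<epsilon>" "\<epsilon> \<le> widths r $ l"
  shows "form_bnd (box_amp (cell (widths r) m) (cell (widths r) m') ((deriv_p l ^^ i) a) (regulariser \<epsilon> l j) S 0)
     (C1 * Sm * (widths r $ l) ^ (i + j))"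
proof -
  let ?h = "widths r"
  define o0 where "o0 e = (\<chi> i. of_int ((if e then m else m') i) * widths r $ i)" for e
  let ?w = "affine_pt S 0 ((o0 True, o0 False), 0)"
  let ?B = "Sm * C0 ^ (4 * CARD('n)) * (?h $ l) ^ i"
  have h: "?h $ i > 0" for i by (rule widths_pos)
  have sub: "cell ?h m \<subseteq> cbox (o0 True) (o0 True + ?h)" "cell ?h m' \<subseteq> cbox (o0 False) (o0 False + ?h)"
    by (auto simp: cell_def o0_def mem_box_cart algebra_simps less_imp_le)
  have "form_bnd (box_amp (cell (widths r) m) (cell (widths r) m') ((deriv_p l ^^ i) a) (regulariser \<epsilon> l j) S 0)
     ((2 * pi) ^ CARD('n) * (4 ^ length (index_list :: 'n list) * ?B * (\<bar>\<epsilon>\<bar> ^ j * fact (j + 1))))"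
  proof (rule form_bnd_box_amp[OF regulariser_integrable norm_regulariser _ _ sub h index_list(1) smooth_deriv_p_funpow[OF a], where R = "cbox ?w (?w + ?h)"])
    show "\<bar>S e $ i\<bar> \<le> 1" for e i
      using t by (simp add: S_def)
    show "S e $ i = 0" if "i \<notin> set index_list" for e i
      using that index_list(2) by auto
    \<comment> \<open>A convex combination of two boxes with sides \<open>?h\<close> is again a box
      with sides \<open>?h\<close>, whatever \<open>t\<close>.\<close>
    show "affine_pt S 0 z \<in> cbox ?w (?w + ?h)"
      if "xv z \<in> cbox (o0 True) (o0 True + ?h)" "yv z \<in> cbox (o0 False) (o0 False + ?h)" for z
    proof -
      have "t * o0 True $ i + (1 - t) * o0 False $ i \<le> t * xv z $ i + (1 - t) * yv z $ i"
        "t * xv z $ i + (1 - t) * yv z $ i \<le> t * (o0 True $ i + ?h $ i) + (1 - t) * (o0 False $ i + ?h $ i)" for i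
        using that t by (auto simp: mem_box_cart intro!: add_mono mult_left_mono)
      then show ?thesis
        by (auto simp: mem_box_cart affine_pt_def algebra_simps)
    qed
    fix A :: "'n \<Rightarrow> nat" and z p :: "real^'n"
    assume A: "\<And>i. A i \<le> 2" and z: "z \<in> cbox ?w (?w + ?h)"
    let ?al = "mi_order_tail k A" and ?be = "if l = k then 0 else i"
    let ?\<Lambda> = "lam r" and ?z = "lam (z $ k)"
    have "o0 True $ k = of_int (m k)" "o0 False $ k = of_int (m' k)" "?h $ k = 1"
      by (simp_all add: o0_def widths_def)
    then have "r \<le> z $ k" "z $ k \<le> r + 1"
      using z by (auto simp: mem_box_cart affine_pt_def r_def dest!: spec[of _ k])
    then have zr: "?z \<le> C0 * ?\<Lambda>" "?\<Lambda> \<le> C0 * ?z"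
      by (auto intro!: slow)
    have oA: "mi_order A \<le> 2 * CARD('n)"
      using sum_bounded_above[of UNIV A 2] A by (simp add: mi_order_def mult.commute)
    have al: "?al \<le> 2 * CARD('n)"
      using oA sum_mono2[of UNIV "UNIV - {k}" A] unfolding mi_order_tail_def mi_order_def by auto
    have be: "?be \<le> 2 * CARD('n)" using j by simp
    have oB: "mi_order (\<lambda>ia. if ia = l then i else 0) \<le> 2 * CARD('n)"
      using j by (simp add: mi_order_def)
    have tB: "mi_order_tail k (\<lambda>ia. if ia = l then i else 0) = ?be"
      by (auto simp: mi_order_tail_def)
    have "norm (foldr (\<lambda>i. deriv_q i ^^ A i) index_list ((deriv_p l ^^ i) a) (z, p))
       \<le> Sm * (?z ^ ?al / ?z ^ ?be)"
      using bound[OF oA oB, of z p] unfolding mixed_deriv_single tB .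
    also have "\<dots> \<le> Sm * ((C0 ^ (2 * CARD('n)) * ?\<Lambda> ^ ?al) * (C0 ^ (2 * CARD('n)) / ?\<Lambda> ^ ?be))"
    proof -
      have "?\<Lambda> ^ ?be \<le> C0 ^ (2 * CARD('n)) * ?z ^ ?be"
        by (rule power_slow_variation[OF zr(2)]) (use lam C0 be in \<open>auto intro: less_imp_le\<close>)
      then have "1 / ?z ^ ?be \<le> C0 ^ (2 * CARD('n)) / ?\<Lambda> ^ ?be"
        using lam by (simp add: divide_simps mult.commute)
      moreover have "?z ^ ?al \<le> C0 ^ (2 * CARD('n)) * ?\<Lambda> ^ ?al"
        by (rule power_slow_variation[OF zr(1)]) (use lam C0 al in \<open>auto intro: less_imp_le\<close>)
      ultimately have "?z ^ ?al * (1 / ?z ^ ?be) \<le> (C0 ^ (2 * CARD('n)) * ?\<Lambda> ^ ?al) * (C0 ^ (2 * CARD('n)) / ?\<Lambda> ^ ?be)"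
        using lam[THEN less_imp_le] C0 by (intro mult_mono) auto
      then show ?thesis using Sm by (intro mult_left_mono) auto
    qed
    also have "\<dots> = ?B * ?\<Lambda> ^ ?al"
    proof -
      have "(?h $ l) ^ i = 1 / ?\<Lambda> ^ ?be"
        by (simp add: widths_def power_one_over inverse_eq_divide)
      moreover have "C0 ^ (4 * CARD('n)) = C0 ^ (2 * CARD('n)) * C0 ^ (2 * CARD('n))"
        by (simp flip: power_add)
      ultimately show ?thesis by (simp add: mult_ac)
    qed
    finally have le: "norm (foldr (\<lambda>i. deriv_q i ^^ A i) index_list ((deriv_p l ^^ i) a) (z, p)) \<le> ?B * ?\<Lambda> ^ ?al" .
    have "(\<Prod>i\<in>UNIV. ?h $ i ^ A i) = (\<Prod>i\<in>UNIV - {k}. inverse ?\<Lambda> ^ A i)"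
      by (subst prod.remove[of _ k]) (auto simp: widths_def intro!: prod.cong)
    also have "\<dots> = inverse ?\<Lambda> ^ ?al"
      by (simp add: mi_order_tail_def power_sum)
    finally have "(\<Prod>i\<in>set index_list. ?h $ i ^ A i) = 1 / ?\<Lambda> ^ ?al"
      by (simp add: index_list(2) power_one_over inverse_eq_divide)
    moreover have "norm (foldr (\<lambda>i. deriv_q i ^^ A i) index_list ((deriv_p l ^^ i) a) (z, p)) * (1 / ?\<Lambda> ^ ?al) \<le> ?B"
      using mult_right_mono[OF le, of "1 / ?\<Lambda> ^ ?al"] lam[of r] by simp
    ultimately show "norm (foldr (\<lambda>i. deriv_q i ^^ A i) index_list ((deriv_p l ^^ i) a) (z, p)) * (\<Prod>i\<in>set index_list. ?h $ i ^ A i) \<le> ?B"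
      by simp
  qed (use \<epsilon> in auto)
  then show ?thesis
  proof (rule form_bnd_mono)
    have len: "length (index_list :: 'n list) = CARD('n)"
      using distinct_card[OF index_list(1)] index_list(2) by metis
    \<comment> \<open>As \<open>\<epsilon>\<close> lies below the side, a derivative of the
      regulariser costs no more than one of the symbol.\<close>
    have "\<bar>\<epsilon>\<bar> ^ j * fact (j + 1) \<le> (?h $ l) ^ j * fact (2 * CARD('n) + 1)"
      using \<epsilon> j h[of l] by (intro mult_mono power_mono fact_mono) auto
    then have "(2 * pi) ^ CARD('n) * (4 ^ CARD('n) * ?B * (\<bar>\<epsilon>\<bar> ^ j * fact (j + 1)))
      \<le> (2 * pi) ^ CARD('n) * (4 ^ CARD('n) * ?B * ((?h $ l) ^ j * fact (2 * CARD('n) + 1)))"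
      using Sm C0 h[of l] by (intro mult_left_mono) auto
    also have "\<dots> = C1 * Sm * (?h $ l) ^ (i + j)"
      by (simp only: C1_def power_add mult_ac)
    finally show "(2 * pi) ^ CARD('n) * (4 ^ length (index_list :: 'n list) * ?B * (\<bar>\<epsilon>\<bar> ^ j * fact (j + 1))) \<le> C1 * Sm * (?h $ l) ^ (i + j)"
      unfolding len .
  qed
qed

text \<open>The 6 is chosen so that \<open>2 / (D - 1) \<le> 6 / (1 + D)\<close> for all
  \<open>D \<ge> 2\<close>, with equality at \<open>D = 2\<close>; it also covers smaller
  \<open>D\<close>, where \<open>1 \<le> 6 / (1 + D)\<close>.\<close>

definition C2 :: real where "C2 = 6 ^ (2 * CARD('n)) * C1"

text \<open>All \<open>2 * CARD('n)\<close> integrations by parts are spent in one direction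
  \<open>l\<close>, that of the largest index difference \<open>D\<close>; each factor
  \<open>weight (m i - m' i)\<close> is then at least the inverse square of
  \<open>1 + D\<close>.\<close>

lemma form_bnd_cells_decay:
  fixes m m' :: "'n \<Rightarrow> int"
  defines "r \<equiv> t * of_int (m k) + (1 - t) * of_int (m' k)"
  assumes \<epsilon>: "0 < \<epsilon>" "\<And>l. \<epsilon> \<le> widths r $ l"
  shows "form_bnd (box_amp (cell (widths r) m) (cell (widths r) m') a (regulariser \<epsilon> k 0) S 0) (C2 * Sm * (\<Prod>i\<in>UNIV. weight (m i - m' i)))"
proof -
  let ?f = "\<lambda>i. \<bar>m i - m' i\<bar>" and ?h = "widths r"
  note B = form_bnd_cells[of _ _ \<epsilon> m m', folded r_def]
  \<comment> \<open>The undifferentiated regulariser does not see the direction, so \<open>l\<close>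
    may be chosen for each pair of cells.\<close>
  have regulariser: "regulariser \<epsilon> l 0 = regulariser \<epsilon> k 0" for l
    by (simp add: fun_eq_iff regulariser_0)
  have "Max (range ?f) \<in> range ?f" by (intro Max_in) auto
  then obtain l where "Max (range ?f) = ?f l" by blast
  then have l: "?f i \<le> ?f l" for i
    using Max_ge[of "range ?f" "?f i"] by simp
  define D where "D = ?f l"
  have wtD: "(1 / (1 + real_of_int D)) ^ (2 * CARD('n)) \<le> (\<Prod>i\<in>UNIV. weight (m i - m' i))"
  proof -
    have "(1 / (1 + real_of_int D)) ^ (2 * CARD('n)) = (\<Prod>i\<in>(UNIV :: 'n set). (1 / (1 + real_of_int D))\<^sup>2)"
      by (simp add: power_mult)
    also have "\<dots> \<le> (\<Prod>i\<in>UNIV. weight (m i - m' i))"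
    proof (intro prod_mono conjI)
      fix i
      have "real_of_int (?f i) \<le> real_of_int D" using l[of i] by (simp only: D_def of_int_le_iff)
      then have "1 + \<bar>real_of_int (m i - m' i)\<bar> \<le> 1 + real_of_int D" by simp
      then have "(1 + \<bar>real_of_int (m i - m' i)\<bar>)\<^sup>2 \<le> (1 + real_of_int D)\<^sup>2"
        by (intro power_mono) auto
      then show "(1 / (1 + real_of_int D))\<^sup>2 \<le> weight (m i - m' i)"
        unfolding weight_def power_one_over by (intro divide_left_mono) (auto intro!: mult_pos_pos add_pos_nonneg simp: D_def)
    qed auto
    finally show ?thesis .
  qed
  have D0: "0 \<le> D" by (simp add: D_def)
  have hl: "?h $ l > 0" by (rule widths_pos)
  show ?thesis
  proof (cases "D \<ge> 2")
    \<comment> \<open>Cells whose indices differ by at most 1 may touch; there the bound without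
      integration by parts is used.\<close>
    case False
    have "1 \<le> (6 * (1 / (1 + real_of_int D))) ^ (2 * CARD('n))"
      using False D0 by (intro one_le_power) (auto simp: field_simps)
    also have "\<dots> = 6 ^ (2 * CARD('n)) * (1 / (1 + real_of_int D)) ^ (2 * CARD('n))"
      by (rule power_mult_distrib)
    also have "\<dots> \<le> 6 ^ (2 * CARD('n)) * (\<Prod>i\<in>UNIV. weight (m i - m' i))"
      by (intro mult_left_mono wtD) auto
    finally have "C1 * Sm * 1 \<le> C1 * Sm * (6 ^ (2 * CARD('n)) * (\<Prod>i\<in>UNIV. weight (m i - m' i)))"
      using C1 Sm by (intro mult_left_mono) auto
    moreover have "form_bnd (box_amp (cell ?h m) (cell ?h m') a (regulariser \<epsilon> k 0) S 0) (C1 * Sm)"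
      using B[of 0 0 k] \<epsilon> by simp
    ultimately show ?thesis
      by (elim form_bnd_mono) (simp add: C2_def mult_ac)
  next
    case True
    \<comment> \<open>After reflection by \<open>\<sigma>\<close>, \<open>m1\<close> is the lower
      end of the cell of \<open>x\<close> and \<open>m2\<close> the upper end of the cell of
      \<open>y\<close>; the gap is \<open>D - 1\<close> sides, not \<open>D\<close>.\<close>
    define \<sigma> m1 m2 :: real where "\<sigma> = (if m l > m' l then 1 else - 1)"
      and "m1 = (if m l > m' l then m l * ?h $ l else - ((m l + 1) * ?h $ l))"
      and "m2 = (if m l > m' l then (m' l + 1) * ?h $ l else - (m' l * ?h $ l))"
    have d: "m1 - m2 = (D - 1) * ?h $ l"
      using True by (auto simp: m1_def m2_def D_def algebra_simps)
    have d0: "0 < (real_of_int D - 1) * ?h $ l"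
      using True hl by simp
    have xl: "\<bar>x $ l\<bar> \<le> (\<bar>real_of_int (q l)\<bar> + 1) * ?h $ l" if "x \<in> cell ?h q" for x q
    proof -
      have "q l * ?h $ l \<le> x $ l" "x $ l \<le> (q l + 1) * ?h $ l"
        using that by (auto simp: cell_def less_imp_le)
      moreover have "- ((\<bar>real_of_int (q l)\<bar> + 1) * ?h $ l) \<le> q l * ?h $ l" "(q l + 1) * ?h $ l \<le> (\<bar>real_of_int (q l)\<bar> + 1) * ?h $ l"
        using hl by (auto simp flip: mult_minus_left intro!: mult_right_mono)
      ultimately show ?thesis by linarith
    qed
    have "form_bnd (box_amp (cell ?h m) (cell ?h m') a (regulariser \<epsilon> l 0) S 0) ((2 / ((D - 1) * ?h $ l)) ^ (2 * CARD('n)) * (C1 * Sm * ?h $ l ^ (2 * CARD('n))))"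
    proof (rule form_bnd_box_amp_integration_by_parts_iterated[OF a _ _ _ _ _ d, where \<sigma> = \<sigma>])
      show "amplitude (box_amp (cell ?h m) (cell ?h m') ((deriv_p l ^^ i) a) (regulariser \<epsilon> l j) S 0)" if "i + j \<le> 2 * CARD('n)" for i j
        using B[OF that] \<epsilon> form_bnd_amplitude by blast
      show "form_bnd (box_amp (cell ?h m) (cell ?h m') ((deriv_p l ^^ i) a) (regulariser \<epsilon> l j) S 0) (C1 * Sm * ?h $ l ^ (2 * CARD('n)))"
        if "i + j = 2 * CARD('n)" for i j
        using B[of i j l] \<epsilon> that by simp
      show "0 \<le> C1 * Sm * ?h $ l ^ (2 * CARD('n))"
        using C1 Sm hl by simp
      show "m1 \<le> \<sigma> * x $ l" if "x \<in> cell ?h m" for x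
        using that by (auto simp: cell_def \<sigma>_def m1_def less_imp_le)
      show "\<sigma> * x $ l \<le> m2" if "x \<in> cell ?h m'" for x
        using that by (auto simp: cell_def \<sigma>_def m2_def less_imp_le)
      show "\<bar>x $ l - y $ l\<bar> \<le> (\<bar>real_of_int (m l)\<bar> + 1) * ?h $ l + (\<bar>real_of_int (m' l)\<bar> + 1) * ?h $ l"
        if "x \<in> cell ?h m" "y \<in> cell ?h m'" for x y
        using xl[OF that(1)] xl[OF that(2)] by linarith
    qed (use d0 in \<open>auto simp: \<sigma>_def\<close>)
    then show ?thesis
      unfolding regulariser[of l]
    proof (rule form_bnd_mono)
      have "(2 / ((D - 1) * ?h $ l)) ^ (2 * CARD('n)) * ?h $ l ^ (2 * CARD('n)) = (2 / (D - 1)) ^ (2 * CARD('n))"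
        using hl True by (simp add: power_mult_distrib[symmetric])
      also have "\<dots> \<le> (6 * (1 / (1 + real_of_int D))) ^ (2 * CARD('n))"
        using True by (intro power_mono) (auto simp: field_simps)
      also have "\<dots> = 6 ^ (2 * CARD('n)) * (1 / (1 + real_of_int D)) ^ (2 * CARD('n))"
        by (rule power_mult_distrib)
      also have "\<dots> \<le> 6 ^ (2 * CARD('n)) * (\<Prod>i\<in>UNIV. weight (m i - m' i))"
        by (intro mult_left_mono wtD) auto
      finally have "C1 * Sm * ((2 / ((D - 1) * ?h $ l)) ^ (2 * CARD('n)) * ?h $ l ^ (2 * CARD('n))) \<le> C1 * Sm * (6 ^ (2 * CARD('n)) * (\<Prod>i\<in>UNIV. weight (m i - m' i)))"
        using C1 Sm by (intro mult_left_mono) auto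
      then show "(2 / ((D - 1) * ?h $ l)) ^ (2 * CARD('n)) * (C1 * Sm * ?h $ l ^ (2 * CARD('n))) \<le> C2 * Sm * (\<Prod>i\<in>UNIV. weight (m i - m' i))"
        by (simp only: C2_def mult_ac)
    qed
  qed
qed

end

subsection \<open>The operators in flat $L^2$\<close>

lemma borel_measurable_lborel_integral:
  fixes f :: "'a::euclidean_space \<Rightarrow> 'b::euclidean_space \<Rightarrow> complex"
  assumes "(\<lambda>w. f (fst w) (snd w)) \<in> borel_measurable borel"
  shows "(\<lambda>x. LINT y|lborel. f x y) \<in> borel_measurable borel"
proof (rule lborel.borel_measurable_lebesgue_integral)
  have "sets (borel \<Otimes>\<^sub>M lborel :: ('a \<times> 'b) measure) = sets (borel \<Otimes>\<^sub>M borel)"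
    by (intro sets_pair_measure_cong) auto
  also have "\<dots> = sets borel"
    by (simp only: borel_prod)
  finally have "sets (borel \<Otimes>\<^sub>M lborel :: ('a \<times> 'b) measure) = sets borel" .
  then show "case_prod f \<in> borel_measurable (borel \<Otimes>\<^sub>M lborel)"
    using assms by (simp add: split_beta' cong: measurable_cong_sets)
qed

lemma weight_minus: "weight (a - b) = weight (b - a)"
  by (simp add: weight_def abs_minus_commute)

text \<open>The sum over a product of index sets factorises. Coordinate \<open>k\<close> is pinned
  to the strip and leaves \<open>weight (i - j)\<close> for the sum over strips; each other
  coordinate gives at most 4.\<close>

lemma sum_prod_weight_le:
  fixes k :: "'n::finite" and m :: "'n \<Rightarrow> int"
  assumes "m k = i"
  shows "(\<Sum>m'\<in>PiE UNIV (\<lambda>l. if l = k then {j} else {-R..R}). \<Prod>l\<in>UNIV. weight (m l - m' l)) \<le> weight (i - j) * 4 ^ CARD('n)"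
proof -
  let ?A = "\<lambda>l. if l = k then {j} else {-R..R}"
  have "(\<Sum>m'\<in>PiE UNIV ?A. \<Prod>l\<in>UNIV. weight (m l - m' l)) = (\<Prod>l\<in>UNIV. \<Sum>b\<in>?A l. weight (m l - b))"
    by (rule prod_sum_PiE[symmetric]) auto
  also have "\<dots> = weight (i - j) * (\<Prod>l\<in>UNIV - {k}. \<Sum>b\<in>?A l. weight (m l - b))"
    by (subst prod.remove[of _ k]) (auto simp: assms)
  also have "\<dots> \<le> weight (i - j) * (\<Prod>l\<in>UNIV - {k}. 4)"
    by (intro mult_left_mono prod_mono conjI sum_nonneg sum_weight_le) (auto simp: weight_pos less_imp_le)
  also have "\<dots> \<le> weight (i - j) * 4 ^ CARD('n)"
    by (intro mult_left_mono) (auto simp: weight_pos less_imp_le intro!: power_increasing card_mono)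
  finally show ?thesis .
qed

context symbol_bounds
begin

definition reg_amp :: "real \<Rightarrow> ((real^'n) \<times> (real^'n)) \<times> (real^'n) \<Rightarrow> complex" where
  "reg_amp \<epsilon> z = a (t *\<^sub>R xv z + (1 - t) *\<^sub>R yv z, pv z) * regulariser \<epsilon> k 0 (pv z)"

lemma affine_pt_S: "affine_pt S 0 z = t *\<^sub>R xv z + (1 - t) *\<^sub>R yv z"
  by (simp add: vec_eq_iff affine_pt_def)

lemma a_measurable [measurable]: "a \<in> borel_measurable borel"
  by (intro borel_measurable_continuous_onI smooth_frechet(3)[OF a])

lemma regulariser_measurable [measurable]: "regulariser \<epsilon> l j \<in> borel_measurable borel"
  by (intro borel_measurable_continuous_onI continuous_regulariser)

lemma amplitude_reg_amp:
  assumes "\<epsilon> \<noteq> 0"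
  shows "amplitude (reg_amp \<epsilon>)"
proof -
  have "integrable lborel (\<lambda>p. Sm * norm (regulariser \<epsilon> k 0 p))"
    using integrable_norm[OF regulariser_integrable[OF assms, of k 0]] by simp
  moreover have "norm (reg_amp \<epsilon> z) \<le> Sm * norm (regulariser \<epsilon> k 0 (pv z))" for z
    unfolding reg_amp_def norm_mult by (intro mult_right_mono a_le norm_ge_zero)
  moreover have "reg_amp \<epsilon> \<in> borel_measurable borel"
  proof -
    have "(\<lambda>z. t *\<^sub>R xv z + (1 - t) *\<^sub>R yv z) \<in> borel_measurable (borel :: (((real^'n) \<times> (real^'n)) \<times> (real^'n)) measure)"
      by (intro borel_measurable_continuous_onI continuous_intros)
    then have "(\<lambda>z. a (t *\<^sub>R xv z + (1 - t) *\<^sub>R yv z, pv z)) \<in> borel_measurable borel"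
      by (intro measurable_compose[OF _ a_measurable] borel_measurable_Pair) auto
    then show ?thesis
      unfolding reg_amp_def[abs_def] by measurable
  qed
  ultimately show ?thesis
    unfolding amplitude_def by blast
qed

lemma cell_disjoint:
  assumes h: "\<And>l. h $ l > 0"
  shows "disjoint_family_on (cell h) I"
proof -
  have "m = m'" if x: "x \<in> cell h m" "x \<in> cell h m'" for m m' x
  proof
    fix l
    have "m l = \<lfloor>x $ l / h $ l\<rfloor>" "m' l = \<lfloor>x $ l / h $ l\<rfloor>"
      using x h[of l] by (auto simp: cell_def floor_eq_iff pos_le_divide_eq pos_divide_less_eq intro!: floor_unique[symmetric])
    then show "m l = m' l" by simp
  qed
  then show ?thesis by (auto simp: disjoint_family_on_def)
qed

text \<open>\<open>\<lambda>\<close> may vary exponentially between distant strips, so the cells used for \<open>x\<close> and \<open>y\<close> are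
  chosen for each pair of strips: on such a pair \<open>\<lambda>\<close> is only evaluated in an interval of length 1.\<close>

lemma osc_form_strips:
  fixes i j :: int
  defines "r \<equiv> t * of_int i + (1 - t) * of_int j"
  assumes \<epsilon>: "0 < \<epsilon>" "\<And>l. \<epsilon> \<le> widths r $ l"
    and u: "L1_L2 u" "\<And>x l. u x \<noteq> 0 \<Longrightarrow> \<bar>x $ l\<bar> \<le> \<rho>" "\<And>x. u x \<noteq> 0 \<Longrightarrow> \<lfloor>x $ k\<rfloor> = j"
    and v: "L1_L2 v" "\<And>x l. v x \<noteq> 0 \<Longrightarrow> \<bar>x $ l\<bar> \<le> \<rho>" "\<And>x. v x \<noteq> 0 \<Longrightarrow> \<lfloor>x $ k\<rfloor> = i"
  shows "norm (osc_form (reg_amp \<epsilon>) u v) \<le> (C2 * Sm * (weight (i - j) * 4 ^ CARD('n))) * ((sq_norm u + sq_norm v) / 2)"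
proof -
  let ?h = "widths r"
  have h: "?h $ l > 0" for l by (rule widths_pos)
  \<comment> \<open>A crude common bound on the indices of the cells that meet the supports. It
    makes the sums finite and does not enter the estimate.\<close>
  define s where "s = (\<Sum>l\<in>UNIV. \<bar>\<rho>\<bar> / ?h $ l)"
  define R where "R = \<lceil>s\<rceil> + 1"
  define I where "I i = PiE UNIV (\<lambda>l. if l = k then {i} else {-R..R})" for i
  have I_k: "m k = i'" if "m \<in> I i'" for m i'
    using PiE_mem[OF that[unfolded I_def], of k] by simp
  have C2: "0 \<le> C2" using C1 by (simp add: C2_def)
  have cover: "x \<in> (\<Union>m\<in>I i'. cell ?h m)" if x: "\<And>l. \<bar>x $ l\<bar> \<le> \<rho>" "\<lfloor>x $ k\<rfloor> = i'" for x i'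
  proof
    let ?m = "\<lambda>l. \<lfloor>x $ l / ?h $ l\<rfloor>"
    show "x \<in> cell ?h ?m"
    proof -
      have "of_int (?m l) * ?h $ l \<le> x $ l" for l
        by (rule pos_le_divide_eq[OF h, THEN iffD1]) (rule of_int_floor_le)
      moreover have "x $ l < (of_int (?m l) + 1) * ?h $ l" for l
        by (rule pos_divide_less_eq[OF h, THEN iffD1]) (simp only: floor_less_cancel of_int_add[symmetric] real_of_int_floor_add_one_gt)
      ultimately show ?thesis
        by (simp add: cell_def)
    qed
    show "?m \<in> I i'"
    proof -
      have "?m l \<in> {-R..R}" for l
      proof -
        have "\<bar>x $ l / ?h $ l\<bar> \<le> \<bar>\<rho>\<bar> / ?h $ l"
          using x(1)[of l] h[of l] by (simp add: abs_divide divide_right_mono)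
        also have "\<dots> \<le> s"
          unfolding s_def by (intro member_le_sum) (auto intro!: divide_nonneg_pos h)
        finally have "x $ l / ?h $ l \<le> s" "- s \<le> x $ l / ?h $ l" by linarith+
        then show ?thesis unfolding R_def by simp linarith
      qed
      moreover have "?m k = i'" using x(2) by (simp add: widths_def)
      ultimately show ?thesis by (auto simp: I_def PiE_UNIV_domain)
    qed
  qed
  show ?thesis
  proof (rule schur_partition[OF amplitude_reg_amp u(1) v(1), where P = "cell ?h" and P' = "cell ?h" and I = "I i" and J = "I j"
        and K = "\<lambda>m m'. C2 * Sm * (\<Prod>l\<in>UNIV. weight (m l - m' l))"])
    show "finite (I i)" "finite (I j)" by (auto simp: I_def intro!: finite_PiE)
    show "x \<in> (\<Union>m\<in>I i. cell ?h m)" if "v x \<noteq> 0" for x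
      using cover[OF v(2,3)] that by blast
    show "x \<in> (\<Union>m\<in>I j. cell ?h m)" if "u x \<noteq> 0" for x
      using cover[OF u(2,3)] that by blast
    fix m m' assume m: "m \<in> I i" and m': "m' \<in> I j"
    then have mk: "m k = i" "m' k = j" by (auto intro: I_k)
    let ?K = "C2 * Sm * (\<Prod>l\<in>UNIV. weight (m l - m' l))"
    let ?u = "restr (cell ?h m') u" and ?v = "restr (cell ?h m) v"
    \<comment> \<open>Every pair of cells from these two strips has the same \<open>r\<close>, so
      one choice of sides serves them all.\<close>
    have "form_bnd (box_amp (cell ?h m) (cell ?h m') a (regulariser \<epsilon> k 0) S 0) ?K"
      using form_bnd_cells_decay[of \<epsilon> m m'] \<epsilon> by (simp add: mk r_def)
    then have "norm (osc_form (box_amp (cell ?h m) (cell ?h m') a (regulariser \<epsilon> k 0) S 0) ?u ?v) \<le> ?K * ((sq_norm ?u + sq_norm ?v) / 2)"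
      unfolding form_bnd_def using L1_L2_restr[OF u(1)] L1_L2_restr[OF v(1)] by simp
    moreover have "osc_form (box_amp (cell ?h m) (cell ?h m') a (regulariser \<epsilon> k 0) S 0) ?u ?v = osc_form (reg_amp \<epsilon>) ?u ?v"
      unfolding osc_form_def by (intro Bochner_Integration.integral_cong) (auto simp: box_amp_def reg_amp_def affine_pt_S restr_def indicator_def)
    ultimately show "norm (osc_form (reg_amp \<epsilon>) ?u ?v) \<le> ?K * ((sq_norm ?u + sq_norm ?v) / 2)" by simp
  next
    fix m assume "m \<in> I i"
    then have "m k = i" by (rule I_k)
    from sum_prod_weight_le[of m, OF this]
    show "(\<Sum>m'\<in>I j. C2 * Sm * (\<Prod>l\<in>UNIV. weight (m l - m' l))) \<le> C2 * Sm * (weight (i - j) * 4 ^ CARD('n))"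
      unfolding sum_distrib_left[symmetric] I_def using C2 Sm by (intro mult_left_mono) auto
  next
    fix m' assume "m' \<in> I j"
    then have "m' k = j" by (rule I_k)
    from sum_prod_weight_le[of m', OF this]
    show "(\<Sum>m\<in>I i. C2 * Sm * (\<Prod>l\<in>UNIV. weight (m l - m' l))) \<le> C2 * Sm * (weight (i - j) * 4 ^ CARD('n))"
      unfolding sum_distrib_left[symmetric] I_def weight_minus[of _ "m' _"] weight_minus[of i j] using C2 Sm by (intro mult_left_mono) auto
  qed (use \<epsilon> h in \<open>auto intro!: cell_disjoint\<close>)
qed

text \<open>\<open>4 ^ CARD('n)\<close> comes from the sum over cells, the last 4 from the sum over
  strips.\<close>

definition C3 :: real where "C3 = C2 * 4 ^ CARD('n) * 4"

lemma C3: "0 < C3"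
  using C1 by (simp add: C3_def C2_def)

text \<open>\<open>\<epsilon>\<close> has to be small only on the range of \<open>r\<close> met by
  the supports, and the bound contains neither \<open>\<epsilon>\<close> nor \<open>\<rho>\<close>,
  so that both can be sent to their limits.\<close>

lemma osc_form_reg_amp:
  assumes \<epsilon>: "0 < \<epsilon>" "\<And>r l. \<bar>r\<bar> \<le> \<rho> + 2 \<Longrightarrow> \<epsilon> \<le> widths r $ l"
    and u: "L1_L2 u" "\<And>x l. u x \<noteq> 0 \<Longrightarrow> \<bar>x $ l\<bar> \<le> \<rho>"
    and v: "L1_L2 v" "\<And>x l. v x \<noteq> 0 \<Longrightarrow> \<bar>x $ l\<bar> \<le> \<rho>"
  shows "norm (osc_form (reg_amp \<epsilon>) u v) \<le> C3 * Sm * ((sq_norm u + sq_norm v) / 2)"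
proof -
  define R where "R = \<lceil>\<rho>\<rceil> + 1"
  let ?I = "{-R..R}" and ?P = "\<lambda>i. {x :: real^'n. \<lfloor>x $ k\<rfloor> = i}"
  have R: "real_of_int R \<le> \<rho> + 2" unfolding R_def by linarith
  have C2: "0 \<le> C2" using C1 by (simp add: C2_def)
  have cover: "x \<in> (\<Union>i\<in>?I. ?P i)" if "\<bar>x $ k\<bar> \<le> \<rho>" for x :: "real^'n"
  proof -
    have "\<lfloor>x $ k\<rfloor> \<in> ?I" using that unfolding R_def by simp linarith
    then show ?thesis by auto
  qed
  have P: "?P i \<in> sets borel" for i
  proof -
    have "?P i = {x. of_int i \<le> x $ k} \<inter> {x. x $ k < of_int i + 1}"
      by (auto simp: floor_eq_iff)
    also have "\<dots> \<in> sets borel"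
      by (intro sets.Int borel_closed borel_open closed_Collect_le open_Collect_less continuous_intros)
    finally show ?thesis .
  qed
  have sw: "(\<Sum>j\<in>?I. weight (i - j)) \<le> 4" for i by (rule sum_weight_le) simp
  let ?K = "\<lambda>i j. C2 * Sm * (weight (i - j) * 4 ^ CARD('n))"
  have sK: "(\<Sum>j\<in>?I. ?K i j) \<le> C3 * Sm" for i
  proof -
    have "(\<Sum>j\<in>?I. ?K i j) = C2 * Sm * 4 ^ CARD('n) * (\<Sum>j\<in>?I. weight (i - j))"
      by (simp add: sum_distrib_left mult_ac)
    also have "\<dots> \<le> C2 * Sm * 4 ^ CARD('n) * 4"
      using C2 Sm by (intro mult_left_mono sw) auto
    finally show ?thesis by (simp add: C3_def mult_ac)
  qed
  show ?thesis
  proof (rule schur_partition[OF amplitude_reg_amp u(1) v(1), where P = ?P and P' = ?P and I = ?I and J = ?I and K = ?K])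
    show "x \<in> (\<Union>i\<in>?I. ?P i)" if "v x \<noteq> 0" for x
      by (rule cover[OF v(2)[OF that]])
    show "x \<in> (\<Union>i\<in>?I. ?P i)" if "u x \<noteq> 0" for x
      by (rule cover[OF u(2)[OF that]])
    show "?P i \<in> sets borel" "?P i \<in> sets borel" for i by (rule P)+
    fix i j assume ij: "i \<in> ?I" "j \<in> ?I"
    \<comment> \<open>\<open>?r\<close> is a convex combination of strip indices, which are at most
      the ceiling of \<open>\<rho>\<close> plus 1 in modulus; this is where
      \<open>\<rho> + 2\<close> comes from.\<close>
    let ?r = "t * of_int i + (1 - t) * of_int j"
    have "\<bar>?r\<bar> \<le> t * R + (1 - t) * R"
    proof -
      have "\<bar>?r\<bar> \<le> \<bar>t * of_int i\<bar> + \<bar>(1 - t) * of_int j\<bar>" by (rule abs_triangle_ineq)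
      also have "\<dots> = t * \<bar>of_int i\<bar> + (1 - t) * \<bar>of_int j\<bar>" using t by (simp add: abs_mult)
      also have "\<dots> \<le> t * R + (1 - t) * R"
        using t ij by (intro add_mono mult_left_mono) auto
      finally show ?thesis .
    qed
    also have "\<dots> = R" by (simp add: algebra_simps)
    finally have r: "\<bar>?r\<bar> \<le> \<rho> + 2" using R by linarith
    show "norm (osc_form (reg_amp \<epsilon>) (restr (?P j) u) (restr (?P i) v)) \<le> ?K i j * ((sq_norm (restr (?P j) u) + sq_norm (restr (?P i) v)) / 2)"
    proof (rule osc_form_strips[OF \<epsilon>(1) \<epsilon>(2)[OF r]])
      show "L1_L2 (restr (?P j) u)" "L1_L2 (restr (?P i) v)" by (intro L1_L2_restr u v P)+
    qed (auto simp: restr_def indicator_def split: if_splits intro: u v)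
  next
    fix i assume "i \<in> ?I" show "(\<Sum>j\<in>?I. ?K i j) \<le> C3 * Sm" by (rule sK)
  next
    fix j assume "j \<in> ?I" show "(\<Sum>i\<in>?I. ?K i j) \<le> C3 * Sm"
      using sK[of j] by (subst weight_minus)
  qed (use \<epsilon> in \<open>auto simp: disjoint_family_on_def\<close>)
qed

text \<open>Slow variation is chained from 0 to \<open>r\<close> in \<open>m\<close> steps of length
  at most 1. This bounds \<open>lam\<close> locally, hence the cell sides from below, without any
  continuity.\<close>

lemma lam_bounded: "\<bar>r\<bar> \<le> real m \<Longrightarrow> lam r \<le> C0 ^ m * lam 0"
proof (induction m arbitrary: r)
  case (Suc m)
  \<comment> \<open>The shrinking removes \<open>r / real (Suc m)\<close>, of modulus at most
    1.\<close>
  let ?r = "r * (real m / real (Suc m))"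
  have "\<bar>?r\<bar> = \<bar>r\<bar> * (real m / real (Suc m))" by (simp add: abs_mult)
  also have "\<dots> \<le> real (Suc m) * (real m / real (Suc m))"
    by (intro mult_right_mono Suc.prems) auto
  finally have "lam ?r \<le> C0 ^ m * lam 0" by (intro Suc.IH) simp
  moreover have "\<bar>r - ?r\<bar> \<le> 1"
  proof -
    have "r - ?r = r / real (Suc m)" by (simp add: field_simps)
    then show ?thesis using Suc.prems by (simp add: abs_divide divide_le_eq_1)
  qed
  then have "lam r \<le> C0 * lam ?r" by (rule slow)
  ultimately show ?case
    using C0 by (smt (verit) mult.assoc mult_left_mono power_Suc)
qed simp

lemma ex_widths_bound: "\<exists>\<epsilon>>0. \<forall>r l. \<bar>r\<bar> \<le> \<rho> \<longrightarrow> \<epsilon> \<le> widths r $ l"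
proof -
  let ?m = "nat \<lceil>\<rho>\<rceil>"
  let ?\<Lambda> = "C0 ^ ?m * lam 0"
  have L: "0 < ?\<Lambda>" using C0 lam by simp
  have "min 1 (inverse ?\<Lambda>) \<le> widths r $ l" if "\<bar>r\<bar> \<le> \<rho>" for r l
  proof -
    have "lam r \<le> ?\<Lambda>" using that by (intro lam_bounded) linarith
    then have "inverse ?\<Lambda> \<le> inverse (lam r)" using lam by (intro le_imp_inverse_le) auto
    then show ?thesis by (auto simp: widths_def)
  qed
  moreover have "0 < min 1 (inverse ?\<Lambda>)"
    using positive_imp_inverse_positive[OF L] by (simp only: min_less_iff_conj zero_less_one)
  ultimately show ?thesis by blast
qed

section \<open>The operator as an iterated integral, and its regularisation\<close>

definition pdo_inner :: "(real^'n \<Rightarrow> complex) \<Rightarrow> real^'n \<Rightarrow> real^'n \<Rightarrow> complex" where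
  "pdo_inner u x p = (LINT y|lborel. a (t *\<^sub>R x + (1 - t) *\<^sub>R y, p) * cis (p \<bullet> (x - y)) * u y)"

definition pdo_reg :: "real \<Rightarrow> (real^'n \<Rightarrow> complex) \<Rightarrow> real^'n \<Rightarrow> complex" where
  "pdo_reg \<epsilon> u x = (LINT p|lborel. pdo_inner u x p * regulariser \<epsilon> k 0 p)"

definition pdo :: "(real^'n \<Rightarrow> complex) \<Rightarrow> real^'n \<Rightarrow> complex" where
  "pdo u x = (LINT p|lborel. pdo_inner u x p)"

lemma amplitude_kernel_measurable:
  assumes [measurable]: "u \<in> borel_measurable borel"
  shows "(\<lambda>z. a (t *\<^sub>R xv z + (1 - t) *\<^sub>R yv z, pv z) * cis (pv z \<bullet> (xv z - yv z)) * u (yv z)) \<in> borel_measurable borel"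
proof -
  have "(\<lambda>z. t *\<^sub>R xv z + (1 - t) *\<^sub>R yv z) \<in> borel_measurable (borel :: (((real^'n) \<times> (real^'n)) \<times> (real^'n)) measure)"
    by (intro borel_measurable_continuous_onI continuous_intros)
  then have [measurable]: "(\<lambda>z. a (t *\<^sub>R xv z + (1 - t) *\<^sub>R yv z, pv z)) \<in> borel_measurable borel"
    by (intro measurable_compose[OF _ a_measurable] borel_measurable_Pair) auto
  show ?thesis by measurable
qed

lemma pdo_inner_measurable:
  assumes "u \<in> borel_measurable borel"
  shows "(\<lambda>w. pdo_inner u (fst w) (snd w)) \<in> borel_measurable borel"
  unfolding pdo_inner_def
proof (rule borel_measurable_lborel_integral)
  have "(\<lambda>w. ((fst (fst w), snd w), snd (fst w))) \<in> borel_measurable (borel :: (((real^'n) \<times> (real^'n)) \<times> (real^'n)) measure)"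
    by (intro borel_measurable_continuous_onI continuous_intros)
  from measurable_compose[OF this amplitude_kernel_measurable[OF assms]]
  show "(\<lambda>w. a (t *\<^sub>R fst (fst w) + (1 - t) *\<^sub>R snd w, snd (fst w)) * cis (snd (fst w) \<bullet> (fst (fst w) - snd w)) * u (snd w))
    \<in> borel_measurable borel" by simp
qed

lemma pdo_reg_measurable:
  assumes "u \<in> borel_measurable borel"
  shows "pdo_reg \<epsilon> u \<in> borel_measurable borel"
  unfolding pdo_reg_def[abs_def]
proof (rule borel_measurable_lborel_integral)
  have "(\<lambda>w. regulariser \<epsilon> k 0 (snd w)) \<in> borel_measurable (borel :: ((real^'n) \<times> (real^'n)) measure)"
    by (intro borel_measurable_continuous_onI continuous_on_compose2[OF continuous_regulariser[of UNIV]] continuous_intros) auto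
  with pdo_inner_measurable[OF assms] show "(\<lambda>w. pdo_inner u (fst w) (snd w) * regulariser \<epsilon> k 0 (snd w)) \<in> borel_measurable borel"
    by (rule borel_measurable_times)
qed

lemma pdo_measurable:
  assumes "u \<in> borel_measurable borel"
  shows "pdo u \<in> borel_measurable borel"
  unfolding pdo_def[abs_def] using pdo_inner_measurable[OF assms]
  by (intro borel_measurable_lborel_integral)

lemma pdo_reg_kernel_integrable:
  assumes u: "integrable lborel u" and \<epsilon>: "\<epsilon> \<noteq> 0"
  shows "integrable lborel (\<lambda>w. a (t *\<^sub>R x + (1 - t) *\<^sub>R fst w, snd w) * cis (snd w \<bullet> (x - fst w)) * u (fst w) * regulariser \<epsilon> k 0 (snd w))"
proof -
  have i: "integrable lborel (\<lambda>w. (Sm * norm (u (fst w))) * norm (regulariser \<epsilon> k 0 (snd w)))"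
    by (rule integrable_lborel_times[where f = "\<lambda>y. Sm * norm (u y)"]) (use u regulariser_integrable[OF \<epsilon>, of k 0] in \<open>simp_all add: integrable_norm\<close>)
  show ?thesis
  proof (rule Bochner_Integration.integrable_bound[OF i])
    have m: "u \<in> borel_measurable borel" using borel_measurable_integrable[OF u] by simp
    have "(\<lambda>w. ((x, fst w), snd w)) \<in> borel_measurable (borel :: ((real^'n) \<times> (real^'n)) measure)"
      by (intro borel_measurable_continuous_onI continuous_intros)
    from measurable_compose[OF this amplitude_kernel_measurable[OF m]]
    have "(\<lambda>w. a (t *\<^sub>R x + (1 - t) *\<^sub>R fst w, snd w) * cis (snd w \<bullet> (x - fst w)) * u (fst w)) \<in> borel_measurable borel"
      by simp
    then show "(\<lambda>w. a (t *\<^sub>R x + (1 - t) *\<^sub>R fst w, snd w) * cis (snd w \<bullet> (x - fst w)) * u (fst w) * regulariser \<epsilon> k 0 (snd w)) \<in> borel_measurable lborel"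
      by measurable
    show "AE w in lborel. norm (a (t *\<^sub>R x + (1 - t) *\<^sub>R fst w, snd w) * cis (snd w \<bullet> (x - fst w)) * u (fst w) * regulariser \<epsilon> k 0 (snd w))
       \<le> norm ((Sm * norm (u (fst w))) * norm (regulariser \<epsilon> k 0 (snd w)))"
      using Sm by (intro AE_I2) (auto simp: norm_mult abs_mult intro!: mult_right_mono a_le)
  qed
qed

text \<open>Crude and dependent on \<open>\<epsilon>\<close>: it serves to see that
  \<open>pdo_reg \<epsilon> u\<close>, cut to a cube, is an admissible test function.\<close>

lemma pdo_reg_le:
  assumes u: "integrable lborel u" and \<epsilon>: "\<epsilon> \<noteq> 0"
  shows "norm (pdo_reg \<epsilon> u x) \<le> Sm * (LINT y|lborel. norm (u y)) * (LINT p|lborel. norm (regulariser \<epsilon> k 0 p))"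
proof -
  have K: "norm (pdo_inner u x p) \<le> Sm * (LINT y|lborel. norm (u y))" for p
  proof (cases "integrable lborel (\<lambda>y. a (t *\<^sub>R x + (1 - t) *\<^sub>R y, p) * cis (p \<bullet> (x - y)) * u y)")
    case True
    have "norm (pdo_inner u x p) \<le> (LINT y|lborel. Sm * norm (u y))"
      unfolding pdo_inner_def by (rule Bochner_Integration.integral_norm_bound_integral[OF True])
        (use u in \<open>auto simp: norm_mult intro!: mult_right_mono a_le\<close>)
    then show ?thesis by simp
  next
    case False
    then show ?thesis using Sm by (simp add: pdo_inner_def not_integrable_integral_eq)
  qed
  have r: "integrable lborel (\<lambda>p. norm (regulariser \<epsilon> k 0 p))"
    by (rule integrable_norm[OF regulariser_integrable[OF \<epsilon>]])
  have "integrable lborel (\<lambda>p. pdo_inner u x p * regulariser \<epsilon> k 0 p)"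
    using lborel_split_fst(4)[OF pdo_reg_kernel_integrable[OF u \<epsilon>, of x]] by (simp add: pdo_inner_def)
  then have "norm (pdo_reg \<epsilon> u x) \<le> (LINT p|lborel. Sm * (LINT y|lborel. norm (u y)) * norm (regulariser \<epsilon> k 0 p))"
    unfolding pdo_reg_def
  proof (rule Bochner_Integration.integral_norm_bound_integral)
    show "integrable lborel (\<lambda>p. Sm * (LINT y|lborel. norm (u y)) * norm (regulariser \<epsilon> k 0 p))"
      using r by simp
  qed (auto simp: norm_mult intro!: mult_right_mono K)
  then show ?thesis using r by simp
qed

lemma osc_form_reg_amp_pdo_reg:
  assumes u: "integrable lborel u" and v: "integrable lborel v" and \<epsilon>: "\<epsilon> \<noteq> 0"
  shows "osc_form (reg_amp \<epsilon>) u v = (LINT x|lborel. pdo_reg \<epsilon> u x * v x)"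
proof -
  let ?F = "\<lambda>x y p. a (t *\<^sub>R x + (1 - t) *\<^sub>R y, p) * cis (p \<bullet> (x - y)) * u y * regulariser \<epsilon> k 0 p"
  note I = osc_form_integrable[OF amplitude_reg_amp[OF \<epsilon>] u v]
  have "osc_form (reg_amp \<epsilon>) u v = (LINT w|lborel. (LINT p|lborel. ?F (fst w) (snd w) p) * v (fst w))"
    unfolding osc_form_def lborel_split_fst(1)[OF I] fst_conv snd_conv integral_mult_left_zero[symmetric]
    by (simp add: reg_amp_def mult_ac)
  also have "\<dots> = (LINT x|lborel. LINT y|lborel. (LINT p|lborel. ?F x y p) * v x)"
  proof (subst lborel_split_fst(1))
    show "integrable lborel (\<lambda>w. (LINT p|lborel. ?F (fst w) (snd w) p) * v (fst w))"
      using lborel_split_fst(3)[OF I] unfolding fst_conv snd_conv integral_mult_left_zero[symmetric]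
      by (simp add: reg_amp_def mult_ac)
  qed simp
  also have "\<dots> = (LINT x|lborel. (LINT y|lborel. LINT p|lborel. ?F x y p) * v x)"
    by simp
  also have "\<dots> = (LINT x|lborel. pdo_reg \<epsilon> u x * v x)"
  proof -
    have "(LINT y|lborel. LINT p|lborel. ?F x y p) = pdo_reg \<epsilon> u x" for x
      using lborel_split_fst(1,2)[OF pdo_reg_kernel_integrable[OF u \<epsilon>, of x]] by (simp add: pdo_reg_def pdo_inner_def)
    then show ?thesis by simp
  qed
  finally show ?thesis .
qed

definition cube :: "real \<Rightarrow> (real^'n) set" where
  "cube \<rho> = {x. \<forall>l. \<bar>x $ l\<bar> \<le> \<rho>}"

lemma cube_cbox: "cube \<rho> = cbox (\<chi> l. - \<rho>) (\<chi> l. \<rho>)"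
  by (auto simp: cube_def mem_box_cart abs_le_iff minus_le_iff)

lemma cube_measurable [measurable]: "cube \<rho> \<in> sets borel"
  by (simp add: cube_cbox)

text \<open>Duality: the form is tested with the conjugate of \<open>pdo_reg \<epsilon> u\<close>
  itself, cut to a cube so that it is integrable and its support meets the condition on
  \<open>\<epsilon>\<close>.\<close>

lemma pdo_reg_L2:
  assumes \<epsilon>: "0 < \<epsilon>" "\<And>r l. \<bar>r\<bar> \<le> \<rho> + 2 \<Longrightarrow> \<epsilon> \<le> widths r $ l"
    and u: "L1_L2 u" "\<And>x l. u x \<noteq> 0 \<Longrightarrow> \<bar>x $ l\<bar> \<le> \<rho>"
  shows "integrable lborel (\<lambda>x. indicator (cube \<rho>) x * (norm (pdo_reg \<epsilon> u x))\<^sup>2)"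
    and "(LINT x|lborel. indicator (cube \<rho>) x * (norm (pdo_reg \<epsilon> u x))\<^sup>2) \<le> (C3 * Sm)\<^sup>2 * sq_norm u"
proof -
  have u1: "integrable lborel u" using u(1) by (simp add: L1_L2_def)
  have um: "u \<in> borel_measurable borel" by (rule L1_L2_measurable[OF u(1)])
  note [measurable] = pdo_reg_measurable[OF um]
  have [measurable]: "(\<lambda>x. cnj (pdo_reg \<epsilon> u x)) \<in> borel_measurable borel"
    by (rule measurable_compose[OF pdo_reg_measurable[OF um]]) (intro borel_measurable_continuous_onI continuous_intros)
  let ?v = "\<lambda>x. restr (cube \<rho>) (\<lambda>x. cnj (pdo_reg \<epsilon> u x)) x"
  define Bd where "Bd = Sm * (LINT y|lborel. norm (u y)) * (LINT p|lborel. norm (regulariser \<epsilon> k 0 p))"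
  have Bd: "norm (pdo_reg \<epsilon> u x) \<le> Bd" for x
    unfolding Bd_def by (rule pdo_reg_le[OF u1]) (use \<epsilon> in simp)
  have ic: "integrable lborel (indicat_real (cube \<rho>))"
    unfolding cube_cbox using emeasure_lborel_cbox_finite[of "\<chi> l. - \<rho>" "\<chi> l. \<rho>"]
    by (simp add: integrable_indicator_iff)
  have v1: "integrable lborel ?v"
  proof (rule Bochner_Integration.integrable_bound)
    show "integrable lborel (\<lambda>x. indicat_real (cube \<rho>) x * Bd)" using ic by simp
    show "?v \<in> borel_measurable lborel" unfolding restr_def by measurable
    show "AE x in lborel. norm (?v x) \<le> norm (indicat_real (cube \<rho>) x * Bd)"
      using Bd order_trans[OF Bd abs_ge_self] by (auto simp: restr_def indicator_def)
  qed
  have n2: "(norm (?v x))\<^sup>2 = indicator (cube \<rho>) x * (norm (pdo_reg \<epsilon> u x))\<^sup>2" for x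
    by (simp add: restr_def indicator_def)
  show v2: "integrable lborel (\<lambda>x. indicator (cube \<rho>) x * (norm (pdo_reg \<epsilon> u x))\<^sup>2)"
  proof (rule Bochner_Integration.integrable_bound)
    show "integrable lborel (\<lambda>x. indicat_real (cube \<rho>) x * Bd\<^sup>2)" using ic by simp
    show "(\<lambda>x. indicator (cube \<rho>) x * (norm (pdo_reg \<epsilon> u x))\<^sup>2) \<in> borel_measurable lborel" by measurable
    show "AE x in lborel. norm (indicator (cube \<rho>) x * (norm (pdo_reg \<epsilon> u x))\<^sup>2) \<le> norm (indicat_real (cube \<rho>) x * Bd\<^sup>2)"
      by (intro AE_I2) (auto simp: indicator_def intro!: power_mono Bd)
  qed
  have v: "L1_L2 ?v" using v1 v2 by (simp add: L1_L2_def n2)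
  have N2v: "sq_norm ?v = (LINT x|lborel. indicator (cube \<rho>) x * (norm (pdo_reg \<epsilon> u x))\<^sup>2)"
    by (simp add: sq_norm_def n2)
  show "(LINT x|lborel. indicator (cube \<rho>) x * (norm (pdo_reg \<epsilon> u x))\<^sup>2) \<le> (C3 * Sm)\<^sup>2 * sq_norm u"
  proof (cases "Sm = 0")
    case True
    then have "a z = 0" for z using a_le[of z] by simp
    then show ?thesis by (simp add: pdo_reg_def pdo_inner_def True)
  next
    case False
    define c where "c = C3 * Sm"
    have c: "c > 0" using False C3 Sm by (simp add: c_def)
    \<comment> \<open>Division by \<open>c\<close> balances the mean: with
      \<open>N = sq_norm ?v\<close> the bound reads
      \<open>N / c \<le> c * sq_norm u / 2 + N / (2 * c)\<close>, and the left side absorbs the last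
      term.\<close>
    let ?w = "\<lambda>x. ?v x / complex_of_real c"
    have N2w: "sq_norm ?w = sq_norm ?v / c\<^sup>2"
      using c by (simp add: sq_norm_def norm_divide power_divide)
    have w: "L1_L2 ?w"
      using v c by (simp add: L1_L2_def norm_divide power_divide)
    have "osc_form (reg_amp \<epsilon>) u ?w = (LINT x|lborel. pdo_reg \<epsilon> u x * ?w x)"
      by (rule osc_form_reg_amp_pdo_reg) (use u1 w \<epsilon> in \<open>auto simp: L1_L2_def\<close>)
    also have "\<dots> = (LINT x|lborel. complex_of_real (indicator (cube \<rho>) x * (norm (pdo_reg \<epsilon> u x))\<^sup>2 / c))"
    proof -
      have "pdo_reg \<epsilon> u x * ?w x = complex_of_real (indicator (cube \<rho>) x * (norm (pdo_reg \<epsilon> u x))\<^sup>2 / c)" for x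
        unfolding of_real_divide of_real_mult complex_norm_square by (simp add: restr_def indicator_def)
      then show ?thesis by (simp only:)
    qed
    also have "\<dots> = complex_of_real (sq_norm ?v / c)"
      unfolding integral_complex_of_real N2v by simp
    finally have "sq_norm ?v / c = norm (osc_form (reg_amp \<epsilon>) u ?w)"
      using c by (simp add: norm_divide)
    also have "\<dots> \<le> c * ((sq_norm u + sq_norm ?w) / 2)"
      unfolding c_def
    proof (rule osc_form_reg_amp[OF \<epsilon> u])
      show "L1_L2 (\<lambda>x. ?v x / complex_of_real (C3 * Sm))"
        using w unfolding c_def .
    qed (auto simp: restr_def indicator_def cube_def split: if_splits)
    finally have "sq_norm ?v \<le> c\<^sup>2 * sq_norm u"
      unfolding N2w using c by (simp add: field_simps power2_eq_square)
    then show ?thesis unfolding N2v c_def .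
  qed
qed

lemma regulariser_0_tendsto: "(\<lambda>j. regulariser (\<epsilon> / real (Suc j)) k 0 p) \<longlonglongrightarrow> 1"
proof -
  have "(\<lambda>j. \<epsilon> / real (Suc j)) \<longlonglongrightarrow> 0"
    using LIMSEQ_Suc[OF lim_const_over_n[of \<epsilon>]] by simp
  then have "(\<lambda>j. regulariser (\<epsilon> / real (Suc j)) k 0 p) \<longlonglongrightarrow> (\<Prod>i\<in>(UNIV::'n set). inverse (1 + \<i> * complex_of_real (0 * p $ i)) ^ 2)"
    unfolding regulariser_0 by (intro tendsto_intros) auto
  then show ?thesis by simp
qed

text \<open>Where the \<open>p\<close>-integral does not converge absolutely, \<open>pdo u\<close> takes the junk value 0, so
  no decay in \<open>p\<close> is needed to remove the regularisation by Fatou's lemma.\<close>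

lemma pdo_L2:
  assumes u: "L1_L2 u" "\<And>x l. u x \<noteq> 0 \<Longrightarrow> \<bar>x $ l\<bar> \<le> \<rho>0"
  shows "integrable lborel (\<lambda>x. (norm (pdo u x))\<^sup>2)"
    and "(LINT x|lborel. (norm (pdo u x))\<^sup>2) \<le> (C3 * Sm)\<^sup>2 * sq_norm u"
proof -
  have um: "u \<in> borel_measurable borel" by (rule L1_L2_measurable[OF u(1)])
  note [measurable] = pdo_measurable[OF um]
  \<comment> \<open>Two passages to the limit: on a fixed cube the regulariser tends to 1, then the
    cubes exhaust the space. The order matters, as the admissible \<open>\<epsilon>\<close> depends
    on the cube.\<close>
  let ?F = "\<lambda>m x. indicator (cube (\<bar>\<rho>0\<bar> + real m)) x * (norm (pdo u x))\<^sup>2"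
  have F: "integrable lborel (?F m)" "(LINT x|lborel. ?F m x) \<le> (C3 * Sm)\<^sup>2 * sq_norm u" for m
  proof -
    let ?\<rho> = "\<bar>\<rho>0\<bar> + real m"
    obtain e where e: "e > 0" "\<And>r l. \<bar>r\<bar> \<le> ?\<rho> + 2 \<Longrightarrow> e \<le> widths r $ l"
      using ex_widths_bound by blast
    \<comment> \<open>These tend to 0 and stay below \<open>e\<close>, so the condition attached to
      the cube persists.\<close>
    let ?e = "\<lambda>j. e / real (Suc j)"
    have e': "0 < ?e j" "\<And>r l. \<bar>r\<bar> \<le> ?\<rho> + 2 \<Longrightarrow> ?e j \<le> widths r $ l" for j
    proof -
      have "?e j \<le> e" using e(1) by (simp add: divide_le_eq)
      then show "0 < ?e j" "\<And>r l. \<bar>r\<bar> \<le> ?\<rho> + 2 \<Longrightarrow> ?e j \<le> widths r $ l"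
        using e by (simp, meson order_trans)
    qed
    have su: "\<bar>x $ l\<bar> \<le> ?\<rho>" if "u x \<noteq> 0" for x l
      using u(2)[OF that, of l] by linarith
    note T = pdo_reg_L2[OF e' u(1) su]
    have lim: "?F m x = 0 \<or> (\<lambda>j. indicator (cube ?\<rho>) x * (norm (pdo_reg (?e j) u x))\<^sup>2) \<longlonglongrightarrow> ?F m x" for x
    proof (cases "integrable lborel (pdo_inner u x)")
      case True
      have "(\<lambda>j. pdo_reg (?e j) u x) \<longlonglongrightarrow> pdo u x"
        unfolding pdo_reg_def pdo_def
      proof (rule integral_dominated_convergence)
        show "integrable lborel (\<lambda>p. norm (pdo_inner u x p))" using True by simp
        show "pdo_inner u x \<in> borel_measurable lborel" using True by auto
        then show "(\<lambda>p. pdo_inner u x p * regulariser (?e j) k 0 p) \<in> borel_measurable lborel" for j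
          by measurable
        show "AE p in lborel. (\<lambda>j. pdo_inner u x p * regulariser (?e j) k 0 p) \<longlonglongrightarrow> pdo_inner u x p"
          using tendsto_mult[OF tendsto_const regulariser_0_tendsto[of e]] by (intro AE_I2) simp
        show "AE p in lborel. norm (pdo_inner u x p * regulariser (?e j) k 0 p) \<le> norm (pdo_inner u x p)" for j
          using mult_left_mono[OF norm_regulariser_0 norm_ge_zero] by (intro AE_I2) (simp add: norm_mult)
      qed
      then show ?thesis by (intro disjI2 tendsto_intros)
    next
      case False
      then show ?thesis by (simp add: pdo_def not_integrable_integral_eq)
    qed
    have m: "?F m \<in> borel_measurable lborel" by measurable
    have nn: "0 \<le> indicator (cube ?\<rho>) x * (norm (pdo_reg (?e j) u x))\<^sup>2" "0 \<le> ?F m x" for x j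
      by auto
    show "integrable lborel (?F m)"
      by (rule fatou_bound(1)[OF m T(1) nn(1) T(2) lim nn(2)])
    show "(LINT x|lborel. ?F m x) \<le> (C3 * Sm)\<^sup>2 * sq_norm u"
      by (rule fatou_bound(2)[OF m T(1) nn(1) T(2) lim nn(2)])
  qed
  have m: "(\<lambda>x. (norm (pdo u x))\<^sup>2) \<in> borel_measurable lborel" by measurable
  have lim: "(\<lambda>m. ?F m x) \<longlonglongrightarrow> (norm (pdo u x))\<^sup>2" for x
  proof (rule tendsto_eventually)
    have "eventually (\<lambda>m. Max (range (\<lambda>l. \<bar>x $ l\<bar>)) \<le> real m) sequentially"
      by (rule eventually_sequentiallyI[of "nat \<lceil>Max (range (\<lambda>l. \<bar>x $ l\<bar>))\<rceil>"]) linarith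
    then show "eventually (\<lambda>m. ?F m x = (norm (pdo u x))\<^sup>2) sequentially"
    proof eventually_elim
      case (elim m)
      have "\<bar>x $ l\<bar> \<le> \<bar>\<rho>0\<bar> + real m" for l
        using order_trans[OF Max_ge[of "range (\<lambda>l. \<bar>x $ l\<bar>)" "\<bar>x $ l\<bar>"] elim] by auto
      then have "x \<in> cube (\<bar>\<rho>0\<bar> + real m)" by (simp add: cube_def)
      then show ?case by simp
    qed
  qed
  have nn: "0 \<le> ?F m x" "0 \<le> (norm (pdo u x))\<^sup>2" for m x by auto
  show "integrable lborel (\<lambda>x. (norm (pdo u x))\<^sup>2)"
    "(LINT x|lborel. (norm (pdo u x))\<^sup>2) \<le> (C3 * Sm)\<^sup>2 * sq_norm u"
    by (rule fatou_bound[OF m F(1) nn(1) F(2) disjI2[OF lim] nn(2)])+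
qed

end

subsection \<open>Symbol seminorms and the weighted space\<close>

lemma jap_pos: "0 < jap k l p"
  unfolding jap_def by (intro real_sqrt_gt_zero add_pos_nonneg sum_nonneg) auto

lemma jap_nonzero [simp]: "jap k l p \<noteq> 0"
  using jap_pos[of k l p] by simp

text \<open>Membership in the symbol class makes each real-valued supremum one of a bounded set,
  hence an upper bound; for \<open>m = \<sigma> = 0\<close> the powers of \<open>jap\<close> are
  1.\<close>

lemma weighted_deriv_le_seminorm:
  fixes k :: "'n::finite"
  assumes a: "a \<in> symbol_class k lam 0 0" and AB: "mi_order A + mi_order B \<le> M"
  shows "norm (weighted_deriv k lam A B a (q, p)) \<le> symbol_seminorm k lam M 0 0 a"
proof -
  obtain C where C: "\<And>q p A B. mi_order A + mi_order B \<le> M \<Longrightarrow> norm (weighted_deriv k lam A B a (q, p)) \<le> C"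
  proof -
    have "\<exists>C>0. \<forall>q p A B. mi_order A + mi_order B \<le> M \<longrightarrow>
        norm (weighted_deriv k lam A B a (q, p)) \<le> C * jap k (lam (q $ k)) p powr (0 - 0 * real (mi_order B))"
      using a unfolding symbol_class_def by blast
    then show ?thesis using that by auto
  qed
  let ?S = "\<lambda>A B. SUP (q, p)\<in>UNIV. norm (weighted_deriv k lam A B a (q, p))"
  have e: "symbol_seminorm k lam M 0 0 a = (\<Sum>(A, B)\<in>{(A, B). mi_order A + mi_order B \<le> M}. ?S A B)"
    by (simp add: symbol_seminorm_def)
  have le: "norm (weighted_deriv k lam A B a (q, p)) \<le> ?S A B" if "mi_order A + mi_order B \<le> M" for A B q p
  proof -
    have "bdd_above (range (\<lambda>(q, p). norm (weighted_deriv k lam A B a (q, p))))"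
      using C[OF that] by (auto intro!: bdd_aboveI)
    from cSUP_upper[OF UNIV_I this, of "(q, p)"] show ?thesis by simp
  qed
  have "norm (weighted_deriv k lam A B a (q, p)) \<le> ?S A B" by (rule le[OF AB])
  also have "\<dots> \<le> symbol_seminorm k lam M 0 0 a"
  proof -
    have "(case (A, B) of (A, B) \<Rightarrow> ?S A B) \<le> (\<Sum>(A, B)\<in>{(A, B). mi_order A + mi_order B \<le> M}. ?S A B)"
    proof (rule member_le_sum[OF _ _ finite_mi_pairs])
      fix x assume "x \<in> {(A, B). mi_order A + mi_order B \<le> M} - {(A, B)}"
      then show "0 \<le> (case x of (A, B) \<Rightarrow> ?S A B)"
        using order_trans[OF norm_ge_zero le] by auto
    qed (use AB in auto)
    then show ?thesis unfolding e by simp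
  qed
  finally show ?thesis .
qed

text \<open>The order \<open>4 * CARD('n)\<close> leaves room for \<open>2 * CARD('n)\<close>
  derivatives in \<open>q\<close> and as many in \<open>p\<close>; the powers of \<open>lam\<close>
  are moved to the right.\<close>

lemma symbol_bounds_seminorm:
  fixes k :: "'n::finite"
  assumes a: "a \<in> symbol_class k lam 0 0" and lam: "\<And>r. lam r > 0" and C0: "1 \<le> C0"
    and slow: "\<And>r r'. \<bar>r - r'\<bar> \<le> 1 \<Longrightarrow> lam r \<le> C0 * lam r'" and t: "t \<in> {0..1}"
  shows "symbol_bounds k lam C0 (symbol_seminorm k lam (4 * CARD('n)) 0 0 a) t a"
proof
  show "smooth a" using a by (simp add: symbol_class_def)
  show "0 \<le> t" "t \<le> 1" using t by auto
  fix A B :: "'n \<Rightarrow> nat" and q p :: "real^'n"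
  assume "mi_order A \<le> 2 * CARD('n)" "mi_order B \<le> 2 * CARD('n)"
  then have "mi_order A + mi_order B \<le> 4 * CARD('n)" by simp
  from weighted_deriv_le_seminorm[OF a this, of q p]
  have "inverse (lam (q $ k)) ^ mi_order_tail k A * lam (q $ k) ^ mi_order_tail k B * norm (mixed_deriv A B a (q, p))
     \<le> symbol_seminorm k lam (4 * CARD('n)) 0 0 a"
    using lam[of "q $ k"] by (simp add: weighted_deriv_def abs_mult less_imp_le)
  then show "norm (mixed_deriv A B a (q, p)) \<le>
      symbol_seminorm k lam (4 * CARD('n)) 0 0 a * (lam (q $ k) ^ mi_order_tail k A / lam (q $ k) ^ mi_order_tail k B)"
    using lam[of "q $ k"] by (simp add: field_simps power_inverse)
qed (use lam C0 slow in auto)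

lemma L2_space_weighted_iff:
  assumes g: "smooth g" "\<And>q. g q > 0" and f: "f \<in> borel_measurable borel"
  shows "f \<in> L2_space (weighted_measure g) \<longleftrightarrow> integrable lborel (\<lambda>x. g x powr (1/2) * (norm (f x))\<^sup>2)"
    and "L2_norm (weighted_measure g) f = sqrt (LINT x|lborel. g x powr (1/2) * (norm (f x))\<^sup>2)"
proof -
  have [measurable]: "g \<in> borel_measurable borel"
    by (intro borel_measurable_continuous_onI smooth_frechet(3)[OF g(1)])
  note [measurable] = f
  have m: "(\<lambda>x. (norm (f x))\<^sup>2) \<in> borel_measurable lborel" "(\<lambda>x. g x powr (1/2)) \<in> borel_measurable lborel"
    by measurable
  have "f \<in> borel_measurable (weighted_measure g)"
    using f by (simp add: weighted_measure_def)
  then show "f \<in> L2_space (weighted_measure g) \<longleftrightarrow> integrable lborel (\<lambda>x. g x powr (1/2) * (norm (f x))\<^sup>2)"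
    using integrable_density[OF m] by (simp add: L2_space_def weighted_measure_def)
  show "L2_norm (weighted_measure g) f = sqrt (LINT x|lborel. g x powr (1/2) * (norm (f x))\<^sup>2)"
    using integral_density[OF m] by (simp add: L2_norm_def weighted_measure_def)
qed

lemma continuous_compact_support_L1_L2:
  fixes w :: "real^'n::finite \<Rightarrow> complex"
  assumes w: "continuous_on UNIV w" and K: "compact K" "\<And>x. w x \<noteq> 0 \<Longrightarrow> x \<in> K"
  shows "L1_L2 w" "\<exists>\<rho>. \<forall>x l. w x \<noteq> 0 \<longrightarrow> \<bar>x $ l\<bar> \<le> \<rho>"
proof -
  have c: "continuous_on K w" "continuous_on K (\<lambda>x. (norm (w x))\<^sup>2)"
    using continuous_on_subset[OF w] by (auto intro!: continuous_intros)
  have e: "indicator K x *\<^sub>R w x = w x" "indicator K x *\<^sub>R (norm (w x))\<^sup>2 = (norm (w x))\<^sup>2" for x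
    using K(2)[of x] by (auto simp: indicator_def)
  show "L1_L2 w"
    using borel_integrable_compact[OF K(1) c(1)] borel_integrable_compact[OF K(1) c(2)] unfolding e L1_L2_def ..
  obtain B where "\<And>x. x \<in> K \<Longrightarrow> norm x \<le> B"
    using compact_imp_bounded[OF K(1)] by (auto simp: bounded_iff)
  then show "\<exists>\<rho>. \<forall>x l. w x \<noteq> 0 \<longrightarrow> \<bar>x $ l\<bar> \<le> \<rho>"
    using K(2) component_le_norm_cart order_trans by blast
qed

theorem theorem1p5:
  fixes k :: "'n::finite"
    and g :: "real^'n \<Rightarrow> real"
    and lam :: "real \<Rightarrow> real"
  assumes "smooth g" and "\<And>q. g q > 0"
    and "\<And>r. lam r > 0"
    and "\<exists>C\<^sub>0>0. \<forall>r r'. \<bar>r - r'\<bar> \<le> 1 \<longrightarrow>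
           inverse C\<^sub>0 \<le> lam r / lam r' \<and> lam r / lam r' \<le> C\<^sub>0"
  shows "\<exists>C>0. \<exists>M::nat. \<forall>a\<in>symbol_class k lam 0 0. \<forall>u :: real^'n \<Rightarrow> complex. \<forall>t\<in>{0..1}.
           smooth_compact_support u \<longrightarrow>
             Op g t a u \<in> L2_space (weighted_measure g) \<and>
             L2_norm (weighted_measure g) (Op g t a u)
               \<le> C * symbol_seminorm k lam M 0 0 a * L2_norm (weighted_measure g) u"
proof -
  note g = assms(1,2) and lam = assms(3)
  obtain c where c: "\<And>r r'. \<bar>r - r'\<bar> \<le> 1 \<Longrightarrow> lam r / lam r' \<le> c"
    using assms(4) by blast
  \<comment> \<open>Taking \<open>r = r'\<close> shows that \<open>c\<close> is at least 1 anyway;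
    the maximum makes this immediate.\<close>
  define C0 where "C0 = max 1 c"
  have C0: "1 \<le> C0" by (simp add: C0_def)
  have slow: "lam r \<le> C0 * lam r'" if "\<bar>r - r'\<bar> \<le> 1" for r r'
  proof -
    have "lam r / lam r' \<le> C0" using c[OF that] by (simp add: C0_def)
    then show ?thesis using lam[of r'] by (simp add: divide_le_eq)
  qed
  define P where "P = (2 * pi) powr (- real CARD('n))"
  \<comment> \<open>The value of \<open>C3\<close> written out: it contains only \<open>C0\<close>
    and the dimension, so the constant is fixed before \<open>a\<close>, \<open>t\<close> and
    \<open>u\<close>.\<close>
  define K :: real where "K = 6 ^ (2 * CARD('n)) * ((2 * pi) ^ CARD('n) * (4 ^ CARD('n) * (C0 ^ (4 * CARD('n)) * fact (2 * CARD('n) + 1)))) * 4 ^ CARD('n) * 4"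
  have P: "P > 0" by (simp add: P_def)
  have K: "K > 0" using C0 by (simp add: K_def)
  let ?Sm = "\<lambda>a. symbol_seminorm k lam (4 * CARD('n)) 0 0 a"
  have gm [measurable]: "g \<in> borel_measurable borel"
    by (intro borel_measurable_continuous_onI smooth_frechet(3)[OF g(1)])
  have main: "Op g t a u \<in> L2_space (weighted_measure g) \<and>
      L2_norm (weighted_measure g) (Op g t a u) \<le> P * K * ?Sm a * L2_norm (weighted_measure g) u"
    if a: "a \<in> symbol_class k lam 0 0" and t: "t \<in> {0..1}" and u: "smooth_compact_support u"
    for a t and u :: "real^'n \<Rightarrow> complex"
  proof -
    interpret symbol_bounds k lam C0 "?Sm a" t a
      by (rule symbol_bounds_seminorm[OF a lam C0 slow t])
    have C3_eq: "C3 = K" by (simp only: C3_def C2_def C1_def K_def)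
    \<comment> \<open>The factor \<open>g(q')\<close> to the power 1/4 in the quantization is
      absorbed here, leaving the flat operator \<open>pdo\<close>; in the norms the remaining powers
      of \<open>g\<close> cancel exactly.\<close>
    define w where "w q = u q * complex_of_real (g q powr (1/4))" for q
    have uc: "continuous_on UNIV u"
      using u by (intro smooth_frechet(3)) (simp add: smooth_compact_support_def)
    then have [measurable]: "u \<in> borel_measurable borel"
      by (rule borel_measurable_continuous_onI)
    have wc: "continuous_on UNIV w"
      unfolding w_def[abs_def]
      by (intro continuous_intros uc smooth_frechet(3)[OF g(1)]) (metis g(2) less_irrefl)
    have supp: "x \<in> closure {x. u x \<noteq> 0}" if "w x \<noteq> 0" for x
      using that closure_subset by (fastforce simp: w_def)
    have cpt: "compact (closure {x. u x \<noteq> 0})"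
      using u by (simp add: smooth_compact_support_def)
    note w = continuous_compact_support_L1_L2[OF wc cpt supp]
    obtain \<rho> where \<rho>: "\<And>x l. w x \<noteq> 0 \<Longrightarrow> \<bar>x $ l\<bar> \<le> \<rho>"
      using w(2) by blast
    note T = pdo_L2[OF w(1) \<rho>]
    have [measurable]: "pdo w \<in> borel_measurable borel"
      by (rule pdo_measurable[OF L1_L2_measurable[OF w(1)]])
    have Op: "Op g t a u q = (P * g q powr (- 1/4)) *\<^sub>R pdo w q" for q
      by (simp add: Op_def pdo_def pdo_inner_def w_def P_def cis_conv_exp mult.assoc)
    have Opm: "Op g t a u \<in> borel_measurable borel"
      unfolding Op[abs_def] by measurable
    have sq: "g x powr (1/2) * (norm (Op g t a u x))\<^sup>2 = P\<^sup>2 * (norm (pdo w x))\<^sup>2" for x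
    proof -
      have "g x powr (1/2) * (g x powr (- 1/4))\<^sup>2 = 1"
        using g(2)[of x] by (simp add: powr_power flip: powr_add)
      moreover have "g x powr (1/2) * (norm (Op g t a u x))\<^sup>2
         = (g x powr (1/2) * (g x powr (- 1/4))\<^sup>2) * (P\<^sup>2 * (norm (pdo w x))\<^sup>2)"
        using P by (simp add: Op power_mult_distrib mult_ac)
      ultimately show ?thesis by simp
    qed
    have uw: "g x powr (1/2) * (norm (u x))\<^sup>2 = (norm (w x))\<^sup>2" for x
    proof -
      have "(g x powr (1/4))\<^sup>2 = g x powr (1/2)"
        using g(2)[of x] by (simp add: powr_power)
      then show ?thesis by (simp add: w_def norm_mult power_mult_distrib mult_ac)
    qed
    note L = L2_space_weighted_iff[OF g]
    have "Op g t a u \<in> L2_space (weighted_measure g)"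
      unfolding L(1)[OF Opm] sq using T(1) by simp
    moreover have "L2_norm (weighted_measure g) (Op g t a u) \<le> P * K * ?Sm a * L2_norm (weighted_measure g) u"
    proof -
      have "L2_norm (weighted_measure g) (Op g t a u) = sqrt (P\<^sup>2 * (LINT x|lborel. (norm (pdo w x))\<^sup>2))"
        unfolding L(2)[OF Opm] sq by simp
      also have "\<dots> \<le> sqrt (P\<^sup>2 * ((C3 * ?Sm a)\<^sup>2 * sq_norm w))"
        by (intro real_sqrt_le_mono mult_left_mono T(2)) auto
      also have "\<dots> = P * (C3 * ?Sm a) * sqrt (sq_norm w)"
        using P C3 Sm by (simp add: real_sqrt_mult abs_mult)
      also have "sq_norm w = (LINT x|lborel. g x powr (1/2) * (norm (u x))\<^sup>2)"
        by (simp add: sq_norm_def uw)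
      also have "sqrt \<dots> = L2_norm (weighted_measure g) u"
        by (rule L(2)[symmetric]) measurable
      finally show ?thesis by (simp add: C3_eq mult_ac)
    qed
    ultimately show ?thesis ..
  qed
  show ?thesis
    by (rule exI[of _ "P * K"], intro conjI exI[of _ "4 * CARD('n)"] ballI allI impI) (use P K main in auto)
qed

end
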